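(* Identify each non-crossing plant with its associated rational function in $\mathrm{Mould}$. Then the non-crossing plants form a suboperad $\mathrm{NCP}$ of $\mathrm{Mould}$ in the category of sets (i.e. they contain the unit and are closed under the compositions $\circ_i$), and $\mathrm{NCP}$ is contained in the image of $\psi:\mathrm{Dend}\to\mathrm{Mould}$. As a non-symmetric operad in the category of sets, $\mathrm{NCP}$ has the following presentation: three generators of degree $2$, $$a=\frac1{u_1(u_1+u_2)},\qquad b=\frac1{(u_1+u_2)u_2},\qquad c=\frac1{u_1u_2}$$ (the three non-crossing plants in a triangle), subject only to the relations $$a\circ_2b=b\circ_1a,\qquad c\circ_1c=c\circ_2c,\qquad a\circ_1c=a\circ_2a,\qquad b\circ_2c=b\circ_1b.$$
   Context: Notation: $u_{i\dots j}=\sum_{i\le k\le j}u_k$. The non-symmetric operad $\mathrm{Mould}$: $\mathrm{Mould}(n)$ ($n\ge1$) is the $\mathbb{Q}$-vector space of rational functions with rational coefficients in $u_1,\dots,u_n$; the unit is $1/u_1$; for $f\in\mathrm{Mould}(m)$, $g\in\mathrm{Mould}(n)$, $1\le i\le m$, $f\circ_i g=u_{i\dots i+n-1}f(u_1,\dots,u_{i-1},u_{i\dots i+n-1},u_{i+n},\dots,u_{m+n-1})g(u_i,\dots,u_{i+n-1})$. $\mathrm{Dend}$ is the non-symmetric operad in $\mathbb{Q}$-vector spaces generated by $L,R$ of arity $2$ with relations $L\circ_1(L+R)=L\circ_2L$, $R\circ_1L=L\circ_2R$, $R\circ_1R=R\circ_2(L+R)$, and $\psi:\mathrm{Dend}\to\mathrm{Mould}$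 is the operad morphism with $\psi(L)=\frac1{u_1(u_1+u_2)}$, $\psi(R)=\frac1{(u_1+u_2)u_2}$. Non-crossing plants. Let $n\ge2$ and consider the vertices $v_0,v_1,\dots,v_n$ of a regular (convex) polygon with $n+1$ sides, in clockwise order; the base side is $v_0v_n$ and side $i$ is $v_{i-1}v_i$ for $1\le i\le n$. A diagonal is a segment between any two distinct vertices (sides and the base side included). Two diagonals are crossing if they are distinct and meet at a point in the interior of the polygon. A non-crossing plant (of degree $n$) consists of two disjoint sets of diagonals, the numerator diagonals and the denominator diagonals, such that: (1) any two diagonals in the union of these sets are non-crossing; (2) the simplicial complex made of the denominator diagonals is connected and contains all vertices; (3) any numerator diagonal is contained in (the region bounded by) a closed cycle of denominator diagonals; (4) any closed cycle of denominator diagonals contains exactly one numerator diagonal. Here a closed cycle means a cycle of denominator diagonals having no other denominator diagonal in the region it bounds, i.e. the boundary of a bounded face. Associated function: to the diagonal $v_{i-1}v_j$ ($1\le i\le j\le n$) associate the linear function $u_{i\dots j}$ (so side $i\mapsto u_i$ and base side $\mapsto u_{1\dots n}$). A non-crossing plant is mapped to the product of the linear functions of its numerator diagonals divided by the product of the linear functions of its denominator diagonals; this map is injective. In degree $n=1$ there is by convention a single non-crossing plant, mapped to the unit $1/u_1$. *)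

theory Defs
  imports
    "HOL-Analysis.Analysis"
    "HOL-Library.Poly_Mapping"
    "HOL-Library.Tree"
    "HOL-Computational_Algebra.Fraction_Field"
begin

section \<open>Non-symmetric operads\<close>

text \<open>
  Operads are graded by the arity \<open>n \<ge> 1\<close>; there are no operations of arity \<open>0\<close>.
  \<open>op_comp P m n i x y\<close> is the partial composite of \<open>x\<close> and \<open>y\<close> at input \<open>i\<close>, where \<open>x\<close> has arity
  \<open>m\<close> and \<open>y\<close> has arity \<open>n\<close>. The arities are arguments because they cannot be recovered from the
  elements: \<open>1 / u\<^sub>1\<close> is a rational function of \<open>u\<^sub>1, \<dots>, u\<^sub>n\<close> for every \<open>n\<close>.
\<close>

record 'a operad_data =
  op_set :: "nat \<Rightarrow> 'a set"
  op_unit :: 'a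
  op_comp :: "nat \<Rightarrow> nat \<Rightarrow> nat \<Rightarrow> 'a \<Rightarrow> 'a \<Rightarrow> 'a"

record 'a lin_operad_data = "'a operad_data" +
  op_add :: "nat \<Rightarrow> 'a \<Rightarrow> 'a \<Rightarrow> 'a"
  op_scale :: "nat \<Rightarrow> rat \<Rightarrow> 'a \<Rightarrow> 'a"

locale ns_operad =
  fixes P :: "('a, 'b) operad_data_scheme"
  assumes arity_pos: "op_set P 0 = {}"
    and unit_closed: "op_unit P \<in> op_set P 1"
    and comp_closed: "\<lbrakk>x \<in> op_set P m; y \<in> op_set P n; 1 \<le> i; i \<le> m\<rbrakk>
      \<Longrightarrow> op_comp P m n i x y \<in> op_set P (m + n - 1)"
    and unit_left: "x \<in> op_set P n \<Longrightarrow> op_comp P 1 n 1 (op_unit P) x = x"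
    and unit_right: "\<lbrakk>x \<in> op_set P m; 1 \<le> i; i \<le> m\<rbrakk> \<Longrightarrow> op_comp P m 1 i x (op_unit P) = x"
    and sequential: "\<lbrakk>x \<in> op_set P l; y \<in> op_set P m; z \<in> op_set P n;
        1 \<le> i; i \<le> l; 1 \<le> j; j \<le> m\<rbrakk>
      \<Longrightarrow> op_comp P (l + m - 1) n (i + j - 1) (op_comp P l m i x y) z
        = op_comp P l (m + n - 1) i x (op_comp P m n j y z)"
    and parallel: "\<lbrakk>x \<in> op_set P l; y \<in> op_set P m; z \<in> op_set P n; 1 \<le> i; i < k; k \<le> l\<rbrakk>
      \<Longrightarrow> op_comp P (l + m - 1) n (k + m - 1) (op_comp P l m i x y) z
        = op_comp P (l + n - 1) m i (op_comp P l n k x z) y"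

definition suboperad :: "('a, 'b) operad_data_scheme \<Rightarrow> ('a, 'c) operad_data_scheme \<Rightarrow> bool" where
  "suboperad P Q \<longleftrightarrow>
     ns_operad Q
     \<and> (\<forall>n. op_set P n \<subseteq> op_set Q n)
     \<and> op_unit P = op_unit Q \<and> op_comp P = op_comp Q
     \<and> op_unit Q \<in> op_set P 1
     \<and> (\<forall>m n i. \<forall>x\<in>op_set P m. \<forall>y\<in>op_set P n. 1 \<le> i \<longrightarrow> i \<le> m
          \<longrightarrow> op_comp Q m n i x y \<in> op_set P (m + n - 1))"

definition operad_hom ::
  "(nat \<Rightarrow> 'a \<Rightarrow> 'b) \<Rightarrow> ('a, 'c) operad_data_scheme \<Rightarrow> ('b, 'd) operad_data_scheme \<Rightarrow> bool" where
  "operad_hom \<phi> P Q \<longleftrightarrow>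
     (\<forall>n. \<phi> n ` op_set P n \<subseteq> op_set Q n)
     \<and> \<phi> 1 (op_unit P) = op_unit Q
     \<and> (\<forall>m n i. \<forall>x\<in>op_set P m. \<forall>y\<in>op_set P n. 1 \<le> i \<longrightarrow> i \<le> m
          \<longrightarrow> \<phi> (m + n - 1) (op_comp P m n i x y) = op_comp Q m n i (\<phi> m x) (\<phi> n y))"

definition lin_operad_hom ::
  "(nat \<Rightarrow> 'a \<Rightarrow> 'b) \<Rightarrow> ('a, 'c) lin_operad_data_scheme \<Rightarrow> ('b, 'd) lin_operad_data_scheme \<Rightarrow> bool"
where
  "lin_operad_hom \<phi> P Q \<longleftrightarrow>
     operad_hom \<phi> P Q
     \<and> (\<forall>n. \<forall>x\<in>op_set P n. \<forall>y\<in>op_set P n. \<phi> n (op_add P n x y) = op_add Q n (\<phi> n x) (\<phi> n y))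
     \<and> (\<forall>n c. \<forall>x\<in>op_set P n. \<phi> n (op_scale P n c x) = op_scale Q n c (\<phi> n x))"

definition operad_iso ::
  "(nat \<Rightarrow> 'a \<Rightarrow> 'b) \<Rightarrow> ('a, 'c) operad_data_scheme \<Rightarrow> ('b, 'd) operad_data_scheme \<Rightarrow> bool" where
  "operad_iso \<phi> P Q \<longleftrightarrow> operad_hom \<phi> P Q \<and> (\<forall>n. bij_betw (\<phi> n) (op_set P n) (op_set Q n))"


section \<open>Presentations by binary generators\<close>

subsection \<open>Congruences and quotients\<close>

text \<open>Relations are triples \<open>(n, x, y)\<close>, meaning that \<open>x\<close> and \<open>y\<close> are identified in arity \<open>n\<close>.\<close>

inductive op_cong ::
  "('a, 'b) operad_data_scheme \<Rightarrow> (nat \<times> 'a \<times> 'a) set \<Rightarrow> nat \<Rightarrow> 'a \<Rightarrow> 'a \<Rightarrow> bool"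
  for P and R where
  rel: "\<lbrakk>(n, x, y) \<in> R; x \<in> op_set P n; y \<in> op_set P n\<rbrakk> \<Longrightarrow> op_cong P R n x y"
| refl: "x \<in> op_set P n \<Longrightarrow> op_cong P R n x x"
| sym: "op_cong P R n x y \<Longrightarrow> op_cong P R n y x"
| trans: "\<lbrakk>op_cong P R n x y; op_cong P R n y z\<rbrakk> \<Longrightarrow> op_cong P R n x z"
| comp: "\<lbrakk>op_cong P R m x x'; op_cong P R n y y'; 1 \<le> i; i \<le> m\<rbrakk>
    \<Longrightarrow> op_cong P R (m + n - 1) (op_comp P m n i x y) (op_comp P m n i x' y')"

text \<open>
  The linear version is congruence modulo the operadic ideal generated by the differences
  \<open>x - y\<close> of the relations.
\<close>

inductive lin_op_cong ::
  "('a, 'b) lin_operad_data_scheme \<Rightarrow> (nat \<times> 'a \<times> 'a) set \<Rightarrow> nat \<Rightarrow> 'a \<Rightarrow> 'a \<Rightarrow> bool"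
  for P and R where
  rel: "\<lbrakk>(n, x, y) \<in> R; x \<in> op_set P n; y \<in> op_set P n\<rbrakk> \<Longrightarrow> lin_op_cong P R n x y"
| refl: "x \<in> op_set P n \<Longrightarrow> lin_op_cong P R n x x"
| sym: "lin_op_cong P R n x y \<Longrightarrow> lin_op_cong P R n y x"
| trans: "\<lbrakk>lin_op_cong P R n x y; lin_op_cong P R n y z\<rbrakk> \<Longrightarrow> lin_op_cong P R n x z"
| comp: "\<lbrakk>lin_op_cong P R m x x'; lin_op_cong P R n y y'; 1 \<le> i; i \<le> m\<rbrakk>
    \<Longrightarrow> lin_op_cong P R (m + n - 1) (op_comp P m n i x y) (op_comp P m n i x' y')"
| add: "\<lbrakk>lin_op_cong P R n x x'; lin_op_cong P R n y y'\<rbrakk>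
    \<Longrightarrow> lin_op_cong P R n (op_add P n x y) (op_add P n x' y')"
| scale: "lin_op_cong P R n x x' \<Longrightarrow> lin_op_cong P R n (op_scale P n c x) (op_scale P n c x')"

definition cong_class :: "(nat \<Rightarrow> 'a \<Rightarrow> 'a \<Rightarrow> bool) \<Rightarrow> nat \<Rightarrow> 'a \<Rightarrow> 'a set" where
  "cong_class E n x = {y. E n x y}"

definition quotient_operad ::
  "('a, 'b) operad_data_scheme \<Rightarrow> (nat \<Rightarrow> 'a \<Rightarrow> 'a \<Rightarrow> bool) \<Rightarrow> 'a set operad_data" where
  "quotient_operad P E = \<lparr>
     op_set = (\<lambda>n. cong_class E n ` op_set P n),
     op_unit = cong_class E 1 (op_unit P),
     op_comp = (\<lambda>m n i X Y. \<Union>x\<in>X. \<Union>y\<in>Y. cong_class E (m + n - 1) (op_comp P m n i x y))\<rparr>"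

definition quotient_lin_operad ::
  "('a, 'b) lin_operad_data_scheme \<Rightarrow> (nat \<Rightarrow> 'a \<Rightarrow> 'a \<Rightarrow> bool) \<Rightarrow> 'a set lin_operad_data" where
  "quotient_lin_operad P E = \<lparr>
     op_set = op_set (quotient_operad P E),
     op_unit = op_unit (quotient_operad P E),
     op_comp = op_comp (quotient_operad P E),
     op_add = (\<lambda>n X Y. \<Union>x\<in>X. \<Union>y\<in>Y. cong_class E n (op_add P n x y)),
     op_scale = (\<lambda>n c X. \<Union>x\<in>X. cong_class E n (op_scale P n c x))\<rparr>"

subsection \<open>Free operads on binary generators\<close>

text \<open>
  The free operad on a type \<open>'g\<close> of generators of arity \<open>2\<close> consists of the planar binary trees
  whose inner vertices carry generators; the arity is the number \<open>size1\<close> of leaves.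
  \<open>graft s i t\<close> replaces the \<open>i\<close>-th leaf of \<open>s\<close> (from the left, starting with \<open>1\<close>) by \<open>t\<close>.
\<close>

fun graft :: "'g tree \<Rightarrow> nat \<Rightarrow> 'g tree \<Rightarrow> 'g tree" where
  "graft Leaf i t = t"
| "graft (Node l g r) i t =
     (if i \<le> size1 l then Node (graft l i t) g r else Node l g (graft r (i - size1 l) t))"

definition corolla :: "'g \<Rightarrow> 'g tree" where
  "corolla g = Node Leaf g Leaf"

definition free_operad :: "'g tree operad_data" where
  "free_operad = \<lparr>
     op_set = (\<lambda>n. {t. size1 t = n}),
     op_unit = Leaf,
     op_comp = (\<lambda>m n i s t. graft s i t)\<rparr>"

text \<open>The free operad in rational vector spaces: formal linear combinations of trees.\<close>

definition free_lin_operad :: "('g tree \<Rightarrow>\<^sub>0 rat) lin_operad_data" where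
  "free_lin_operad = \<lparr>
     op_set = (\<lambda>n. {x. n \<ge> 1 \<and> (\<forall>t\<in>Poly_Mapping.keys x. size1 t = n)}),
     op_unit = Poly_Mapping.single Leaf 1,
     op_comp = (\<lambda>m n i x y. \<Sum>s\<in>Poly_Mapping.keys x. \<Sum>t\<in>Poly_Mapping.keys y.
       Poly_Mapping.single (graft s i t) (Poly_Mapping.lookup x s * Poly_Mapping.lookup y t)),
     op_add = (\<lambda>n x y. x + y),
     op_scale = (\<lambda>n c x. Poly_Mapping.map ((*) c) x)\<rparr>"

text \<open>
  \<open>P\<close> is presented, as an operad in sets, by the generators \<open>\<gamma> g\<close> of arity \<open>2\<close> subject only to the
  relations \<open>R\<close>.
\<close>

definition presented_by ::
  "('a, 'b) operad_data_scheme \<Rightarrow> ('g \<Rightarrow> 'a) \<Rightarrow> (nat \<times> 'g tree \<times> 'g tree) set \<Rightarrow> bool" where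
  "presented_by P \<gamma> R \<longleftrightarrow>
     (\<exists>\<phi>. operad_iso \<phi> (quotient_operad free_operad (op_cong free_operad R)) P
        \<and> (\<forall>g. \<phi> 2 (cong_class (op_cong free_operad R) 2 (corolla g)) = \<gamma> g))"


section \<open>The operad Mould\<close>

text \<open>
  Polynomials in variables indexed by natural numbers (finitely supported functions from monomials
  to coefficients) and their fraction field. Only the variables with index \<open>\<ge> 1\<close> are used.
\<close>

type_synonym ratpoly = "(nat \<Rightarrow>\<^sub>0 nat) \<Rightarrow>\<^sub>0 rat"
type_synonym ratfun = "ratpoly fract"

definition rconst :: "rat \<Rightarrow> ratfun" where
  "rconst c = Fract (Poly_Mapping.single 0 c) 1"

definition uvar :: "nat \<Rightarrow> ratfun" where
  "uvar k = Fract (Poly_Mapping.single (Poly_Mapping.single k 1) 1) 1"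

definition usum :: "nat \<Rightarrow> nat \<Rightarrow> ratfun" where
  "usum i j = (\<Sum>k\<in>{i..j}. uvar k)"

definition pvars :: "ratpoly \<Rightarrow> nat set" where
  "pvars p = (\<Union>m\<in>Poly_Mapping.keys p. Poly_Mapping.keys m)"

definition poly_subst :: "(nat \<Rightarrow> ratfun) \<Rightarrow> ratpoly \<Rightarrow> ratfun" where
  "poly_subst \<sigma> p = (\<Sum>m\<in>Poly_Mapping.keys p.
     rconst (Poly_Mapping.lookup p m) * (\<Prod>k\<in>Poly_Mapping.keys m. \<sigma> k ^ Poly_Mapping.lookup m k))"

text \<open>
  Substitution into a rational function, with the usual meaning whenever some representation
  \<open>p / q\<close> has a denominator that does not become zero; the value is then independent of the
  representation. The substitutions used below are by linearly independent linear forms, for which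
  no nonzero denominator becomes zero.
\<close>

definition rf_subst :: "(nat \<Rightarrow> ratfun) \<Rightarrow> ratfun \<Rightarrow> ratfun" where
  "rf_subst \<sigma> f = (THE y. \<exists>p q. f = Fract p q \<and> q \<noteq> 0 \<and> poly_subst \<sigma> q \<noteq> 0
     \<and> y = poly_subst \<sigma> p / poly_subst \<sigma> q)"

definition Mould :: "ratfun lin_operad_data" where
  "Mould = \<lparr>
     op_set = (\<lambda>n. {Fract p q | p q. n \<ge> 1 \<and> q \<noteq> 0 \<and> pvars p \<subseteq> {1..n} \<and> pvars q \<subseteq> {1..n}}),
     op_unit = 1 / uvar 1,
     op_comp = (\<lambda>m n i f g.
       usum i (i + n - 1)
       * rf_subst
           (\<lambda>k. if k < i then uvar k else if k = i then usum i (i + n - 1) else uvar (k + n - 1)) f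
       * rf_subst (\<lambda>k. uvar (k + i - 1)) g),
     op_add = (\<lambda>n f g. f + g),
     op_scale = (\<lambda>n c f. rconst c * f)\<rparr>"


section \<open>The operad Dend and its morphism to Mould\<close>

datatype dend_gen = DL | DR

definition dend_free_gen :: "dend_gen \<Rightarrow> dend_gen tree \<Rightarrow>\<^sub>0 rat" where
  "dend_free_gen g = Poly_Mapping.single (corolla g) 1"

definition dend_rels ::
  "(nat \<times> (dend_gen tree \<Rightarrow>\<^sub>0 rat) \<times> (dend_gen tree \<Rightarrow>\<^sub>0 rat)) set" where
  "dend_rels =
    (let L = dend_free_gen DL; R = dend_free_gen DR; comp = op_comp free_lin_operad 2 2 in
     {(3, comp 1 L (L + R), comp 2 L L),
      (3, comp 1 R L, comp 2 L R),
      (3, comp 1 R R, comp 2 R (L + R))})"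

definition Dend :: "(dend_gen tree \<Rightarrow>\<^sub>0 rat) set lin_operad_data" where
  "Dend = quotient_lin_operad free_lin_operad (lin_op_cong free_lin_operad dend_rels)"

definition dend_elem :: "dend_gen \<Rightarrow> (dend_gen tree \<Rightarrow>\<^sub>0 rat) set" where
  "dend_elem g = cong_class (lin_op_cong free_lin_operad dend_rels) 2 (dend_free_gen g)"

text \<open>Since \<open>Dend\<close> is generated by \<open>L\<close> and \<open>R\<close>, this determines \<open>\<psi> n\<close> on \<open>Dend(n)\<close>.\<close>

definition is_dend_to_mould :: "(nat \<Rightarrow> (dend_gen tree \<Rightarrow>\<^sub>0 rat) set \<Rightarrow> ratfun) \<Rightarrow> bool" where
  "is_dend_to_mould \<psi> \<longleftrightarrow>
     lin_operad_hom \<psi> Dend Mould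
     \<and> \<psi> 2 (dend_elem DL) = 1 / (uvar 1 * (uvar 1 + uvar 2))
     \<and> \<psi> 2 (dend_elem DR) = 1 / ((uvar 1 + uvar 2) * uvar 2)"


section \<open>Non-crossing plants\<close>

text \<open>
  The regular polygon with \<open>n + 1\<close> sides is inscribed in the unit circle, with its vertices
  numbered clockwise. The diagonal between the vertices \<open>i < j\<close> is encoded as the pair \<open>(i, j)\<close>.
\<close>

definition vertex :: "nat \<Rightarrow> nat \<Rightarrow> complex" where
  "vertex n k = cis (- (2 * pi * real k / real (n + 1)))"

definition polygon :: "nat \<Rightarrow> complex set" where
  "polygon n = convex hull (vertex n ` {0..n})"

definition diagonals :: "nat \<Rightarrow> (nat \<times> nat) set" where
  "diagonals n = {(i, j). i < j \<and> j \<le> n}"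

definition seg :: "nat \<Rightarrow> nat \<times> nat \<Rightarrow> complex set" where
  "seg n d = closed_segment (vertex n (fst d)) (vertex n (snd d))"

definition crossing :: "nat \<Rightarrow> nat \<times> nat \<Rightarrow> nat \<times> nat \<Rightarrow> bool" where
  "crossing n d e \<longleftrightarrow> d \<noteq> e \<and> seg n d \<inter> seg n e \<inter> interior (polygon n) \<noteq> {}"

definition cycle_edges :: "nat list \<Rightarrow> (nat \<times> nat) set" where
  "cycle_edges ws =
     {(min v w, max v w) | v w. \<exists>i<length ws. v = ws ! i \<and> w = ws ! ((i + 1) mod length ws)}"

definition is_cycle :: "(nat \<times> nat) set \<Rightarrow> nat list \<Rightarrow> bool" where
  "is_cycle D ws \<longleftrightarrow> length ws \<ge> 3 \<and> distinct ws \<and> cycle_edges ws \<subseteq> D"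

text \<open>
  The sides of a cycle of pairwise non-crossing diagonals form the boundary of a convex polygon,
  so the region it bounds is the convex hull of its vertices.
\<close>

definition region :: "nat \<Rightarrow> nat list \<Rightarrow> complex set" where
  "region n ws = convex hull (vertex n ` set ws)"

definition closed_cycle :: "nat \<Rightarrow> (nat \<times> nat) set \<Rightarrow> nat list \<Rightarrow> bool" where
  "closed_cycle n D ws \<longleftrightarrow>
     is_cycle D ws \<and> (\<forall>d\<in>D. seg n d \<subseteq> region n ws \<longrightarrow> d \<in> cycle_edges ws)"

definition connected_spanning :: "nat \<Rightarrow> (nat \<times> nat) set \<Rightarrow> bool" where
  "connected_spanning n D \<longleftrightarrow>
     fst ` D \<union> snd ` D = {0..n} \<and> (\<forall>i\<in>{0..n}. \<forall>j\<in>{0..n}. (i, j) \<in> (D \<union> D\<inverse>)\<^sup>*)"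

text \<open>\<open>N\<close> and \<open>D\<close> are the sets of numerator and denominator diagonals.\<close>

definition noncrossing_plant :: "nat \<Rightarrow> (nat \<times> nat) set \<Rightarrow> (nat \<times> nat) set \<Rightarrow> bool" where
  "noncrossing_plant n N D \<longleftrightarrow>
     N \<subseteq> diagonals n \<and> D \<subseteq> diagonals n \<and> N \<inter> D = {}
     \<and> (\<forall>d\<in>N \<union> D. \<forall>e\<in>N \<union> D. \<not> crossing n d e)
     \<and> connected_spanning n D
     \<and> (\<forall>d\<in>N. \<exists>ws. closed_cycle n D ws \<and> seg n d \<subseteq> region n ws)
     \<and> (\<forall>ws. closed_cycle n D ws \<longrightarrow> (\<exists>!d. d \<in> N \<and> seg n d \<subseteq> region n ws))"

definition diag_form :: "nat \<times> nat \<Rightarrow> ratfun" where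
  "diag_form d = usum (fst d + 1) (snd d)"

definition plant_fun :: "(nat \<times> nat) set \<Rightarrow> (nat \<times> nat) set \<Rightarrow> ratfun" where
  "plant_fun N D = (\<Prod>d\<in>N. diag_form d) / (\<Prod>d\<in>D. diag_form d)"

definition NCP :: "ratfun operad_data" where
  "NCP = \<lparr>
     op_set = (\<lambda>n. if n = 0 then {}
                   else if n = 1 then {1 / uvar 1}
                   else {plant_fun N D | N D. noncrossing_plant n N D}),
     op_unit = op_unit Mould,
     op_comp = op_comp Mould\<rparr>"

datatype ncp_gen = GenA | GenB | GenC

fun ncp_gen_fun :: "ncp_gen \<Rightarrow> ratfun" where
  "ncp_gen_fun GenA = 1 / (uvar 1 * (uvar 1 + uvar 2))"
| "ncp_gen_fun GenB = 1 / ((uvar 1 + uvar 2) * uvar 2)"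
| "ncp_gen_fun GenC = 1 / (uvar 1 * uvar 2)"

definition ncp_rels :: "(nat \<times> ncp_gen tree \<times> ncp_gen tree) set" where
  "ncp_rels =
    (let a = corolla GenA; b = corolla GenB; c = corolla GenC;
         comp = op_comp free_operad 2 2 in
     {(3, comp 2 a b, comp 1 b a),
      (3, comp 1 c c, comp 2 c c),
      (3, comp 1 a c, comp 2 a a),
      (3, comp 2 b c, comp 1 b b)})"

end

theory Submission
  imports Defs
begin

text \<open>
  The proof goes through three descriptions of the elements of \<open>NCP\<close>: rational functions, planar
  binary trees labelled by \<open>a\<close>, \<open>b\<close>, \<open>c\<close>, and plants.

  \<^emph>\<open>Trees and rational functions.\<close> Placing a tree with \<open>n\<close> leaves on the vertices \<open>0, \<dots>, n\<close> makes each
  generator act as gluing of two functions along a vertex: \<open>c\<close> multiplies them, \<open>a\<close> and \<open>b\<close> multiply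
  them and then divide by the base and multiply by the base of the right, respectively left, factor.
  Grafting becomes the composition of \<open>Mould\<close> (\<open>tree_fun_graft\<close>), so the functions of trees form the
  suboperad generated by \<open>a\<close>, \<open>b\<close>, \<open>c\<close>, and the four relations hold. Every such function is a product
  of integer powers of the linear forms of the diagonals; these forms are multiplicatively
  independent (\<open>diag_forms_independent\<close>: some point annihilates one form and no other), so
  a function is the same as its exponents.

  \<^emph>\<open>Normal forms.\<close> The relations say that \<open>c\<close> is an associative product and that \<open>a\<close> and \<open>b\<close> are
  commuting left and right actions of it. So every tree is congruent to \<open>x \<cdot> k \<cdot> y\<close> with optional
  factors \<open>x\<close> and \<open>y\<close> and a core \<open>k\<close> that is a leaf or a product, and a product can be written with a
  first factor that is not a product. The exponents of the normal form are those of \<open>x\<close>, \<open>k\<close> and \<open>y\<close>,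
  plus one at the base of \<open>k\<close> and minus one at the total base. They determine the position of the core
  (\<open>core_position\<close>, by means of the lower bound \<open>weight_expo\<close>), hence all the pieces. By induction,
  trees with the same function are congruent (\<open>tree_expo_inj\<close>), which is the presentation.

  \<^emph>\<open>Trees and plants.\<close> The same pieces occur in plants. If the base is not a denominator, the
  plant splits at a vertex into two plants. If the base is a denominator and a bridge, removing it
  leaves two plants side by side: the core is a leaf. Otherwise the base bounds a face, whose unique
  numerator is the base of the core. Conversely, these three constructions yield plants. So the
  functions of plants are exactly the functions of trees (\<open>NCP_eq\<close>). For this, plants are described
  combinatorially on an interval of vertices, and \<open>noncrossing_plant_iff\<close> identifies this description
  with the one by segments and cycles in the regular polygon.

  Finally, \<open>\<psi>\<close> is the linear extension of the function of a tree with \<open>L\<close> sent to \<open>a\<close> and \<open>R\<close> to \<open>b\<close>.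
  Its image contains \<open>c = a + b\<close>, hence every element of the suboperad generated by \<open>a\<close>, \<open>b\<close>, \<open>c\<close>.
\<close>

section \<open>Combinatorial non-crossing plants\<close>

text \<open>
  A diagonal is a pair \<open>(i, j)\<close> with \<open>i < j\<close>. Plants are considered on an arbitrary interval of
  vertices \<open>p, \<dots>, q\<close>, so that the pieces of a plant need no renumbering; \<open>intv p q\<close> is the set of
  its diagonals.
\<close>

definition intv :: "nat \<Rightarrow> nat \<Rightarrow> (nat \<times> nat) set" where
  "intv p q = {(i, j). p \<le> i \<and> i < j \<and> j \<le> q}"

text \<open>
  Combinatorial crossing: the end points of the two diagonals alternate. Diagonals that share an end
  point do not cross.
\<close>

definition interlaced :: "nat \<times> nat \<Rightarrow> nat \<times> nat \<Rightarrow> bool" where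
  "interlaced d e \<longleftrightarrow> fst d < fst e \<and> fst e < snd d \<and> snd d < snd e
     \<or> fst e < fst d \<and> fst d < snd e \<and> snd e < snd d"

text \<open>
  The vertex set \<open>V\<close> of a bounded face: the edges of \<open>D\<close> between vertices in \<open>V\<close> are exactly the
  pairs of consecutive vertices, together with the pair of the first and the last one.
\<close>

definition face :: "(nat \<times> nat) set \<Rightarrow> nat set \<Rightarrow> bool" where
  "face D V \<longleftrightarrow> finite V \<and> card V \<ge> 3 \<and>
     (\<forall>i\<in>V. \<forall>j\<in>V. i < j \<longrightarrow> ((i, j) \<in> D \<longleftrightarrow> V \<inter> {i<..<j} = {} \<or> V \<subseteq> {i..j}))"

text \<open>The diagonal is a chord or a side of the convex polygon with vertex set \<open>V\<close>.\<close>

definition ends_in :: "nat \<times> nat \<Rightarrow> nat set \<Rightarrow> bool" where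
  "ends_in d V \<longleftrightarrow> fst d \<in> V \<and> snd d \<in> V"

text \<open>The vertices in \<open>A\<close> lie in one connected component of the graph \<open>D\<close>.\<close>

definition linked :: "(nat \<times> nat) set \<Rightarrow> nat set \<Rightarrow> bool" where
  "linked D A \<longleftrightarrow> (\<forall>i\<in>A. \<forall>j\<in>A. (i, j) \<in> (D \<union> D\<inverse>)\<^sup>*)"

text \<open>
  Non-crossing plants on the vertices \<open>p, \<dots>, q\<close>. The degree \<open>q - p\<close> may be \<open>1\<close>, where the side is the
  only plant, and even \<open>0\<close>, where the empty plant stands for an absent factor.
\<close>

definition plant :: "nat \<Rightarrow> nat \<Rightarrow> (nat \<times> nat) set \<Rightarrow> (nat \<times> nat) set \<Rightarrow> bool" where
  "plant p q N D \<longleftrightarrow> N \<subseteq> intv p q \<and> D \<subseteq> intv p q \<and> N \<inter> D = {}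
     \<and> (\<forall>d\<in>N \<union> D. \<forall>e\<in>N \<union> D. \<not> interlaced d e)
     \<and> linked D {p..q}
     \<and> (\<forall>d\<in>N. \<exists>V. face D V \<and> ends_in d V)
     \<and> (\<forall>V. face D V \<longrightarrow> (\<exists>!d. d \<in> N \<and> ends_in d V))"

lemma intv_iff [simp]: "(i, j) \<in> intv p q \<longleftrightarrow> p \<le> i \<and> i < j \<and> j \<le> q"
  by (simp add: intv_def)

lemma intv_mono: "p' \<le> p \<Longrightarrow> q \<le> q' \<Longrightarrow> intv p q \<subseteq> intv p' q'"
  by (auto simp: intv_def)

lemma interlaced_iff [simp]:
  "interlaced (i, j) (k, l) \<longleftrightarrow> i < k \<and> k < j \<and> j < l \<or> k < i \<and> i < l \<and> l < j"
  by (simp add: interlaced_def)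

lemma ends_in_iff [simp]: "ends_in (i, j) V \<longleftrightarrow> i \<in> V \<and> j \<in> V"
  by (simp add: ends_in_def)

lemma face_finite: "face D V \<Longrightarrow> finite V"
  by (simp add: face_def)

lemma face_third:
  assumes "face D V"
  obtains v where "v \<in> V" "v \<noteq> i" "v \<noteq> j"
proof -
  have "card {i, j} < card V"
    using assms card_insert_le_m1[of 2 "{j}" i] by (auto simp: face_def card_insert_if)
  then have "\<not> V \<subseteq> {i, j}" using card_mono[of "{i, j}" V] by auto
  then show ?thesis using that by auto
qed

lemma face_bounds:
  assumes "face D V"
  obtains i j where "i \<in> V" "j \<in> V" "i < j" "V \<subseteq> {i..j}" "(i, j) \<in> D"
proof -
  have f: "finite V" "V \<noteq> {}" using assms by (auto simp: face_def)
  obtain v where v: "v \<in> V" "v \<noteq> Min V" "v \<noteq> Min V" by (rule face_third[OF assms])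
  have "Min V < Max V" using v f Min_le[of V v] Max_ge[of V v] by linarith
  moreover have "V \<subseteq> {Min V..Max V}" using f by auto
  ultimately show ?thesis
    using that[of "Min V" "Max V"] f assms by (simp add: face_def)
qed

lemma face_within:
  assumes "face D V" "D \<subseteq> intv a b"
  shows "V \<subseteq> {a..b}"
proof -
  obtain i j where ij: "V \<subseteq> {i..j}" "(i, j) \<in> D" using face_bounds[OF assms(1)] by metis
  then have "a \<le> i" "j \<le> b" using assms(2) by auto
  then show ?thesis using ij(1) by auto
qed

lemma face_edge: "face D V \<Longrightarrow> i \<in> V \<Longrightarrow> j \<in> V \<Longrightarrow> i < j \<Longrightarrow>
    (i, j) \<in> D \<longleftrightarrow> V \<inter> {i<..<j} = {} \<or> V \<subseteq> {i..j}"
  by (simp add: face_def)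

text \<open>The two members of \<open>V\<close> closest to a point strictly between two members of \<open>V\<close>.\<close>

lemma gap:
  fixes V :: "nat set"
  assumes "finite V" "x \<in> V" "x < v" "y \<in> V" "v < y" "v \<notin> V"
  obtains a b where "a \<in> V" "b \<in> V" "x \<le> a" "a < v" "v < b" "b \<le> y" "V \<inter> {a<..<b} = {}"
proof -
  let ?A = "V \<inter> {..<v}" and ?B = "V \<inter> {v<..}"
  have f: "finite ?A" "x \<in> ?A" "finite ?B" "y \<in> ?B" using assms by auto
  have A: "Max ?A \<in> ?A" "x \<le> Max ?A" using f Max_in[of ?A] Max_ge[of ?A x] by blast+
  have B: "Min ?B \<in> ?B" "Min ?B \<le> y" using f Min_in[of ?B] Min_le[of ?B y] by blast+
  have "w \<notin> {Max ?A<..<Min ?B}" if w: "w \<in> V" for w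
  proof -
    have "w < v \<or> w > v" using w assms(6) by (metis linorder_neqE_nat)
    then show ?thesis
    proof
      assume "w < v"
      then have "w \<le> Max ?A" using w assms(1) by (intro Max_ge) auto
      then show ?thesis by simp
    next
      assume "w > v"
      then have "Min ?B \<le> w" using w assms(1) by (intro Min_le) auto
      then show ?thesis by simp
    qed
  qed
  then have "V \<inter> {Max ?A<..<Min ?B} = {}" by blast
  then show ?thesis using that[of "Max ?A" "Min ?B"] A B by simp
qed

lemma face_gap:
  assumes "face D V" "x \<in> V" "x < v" "y \<in> V" "v < y" "v \<notin> V"
  obtains a b where "a \<in> V" "b \<in> V" "x \<le> a" "a < v" "v < b" "b \<le> y" "V \<inter> {a<..<b} = {}" "(a, b) \<in> D"
  using gap[OF face_finite[OF assms(1)] assms(2-)] face_edge[OF assms(1)] by (metis less_trans)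

lemma face_cong:
  assumes "\<And>i j. i \<in> V \<Longrightarrow> j \<in> V \<Longrightarrow> i < j \<Longrightarrow> (i, j) \<in> D \<longleftrightarrow> (i, j) \<in> D'"
  shows "face D V \<longleftrightarrow> face D' V"
  using assms by (auto simp: face_def)

lemma plantD:
  assumes "plant p q N D"
  shows "N \<subseteq> intv p q" "D \<subseteq> intv p q" "N \<inter> D = {}"
    "\<And>d e. d \<in> N \<union> D \<Longrightarrow> e \<in> N \<union> D \<Longrightarrow> \<not> interlaced d e"
    "linked D {p..q}"
    "\<And>d. d \<in> N \<Longrightarrow> \<exists>V. face D V \<and> ends_in d V"
    "\<And>V. face D V \<Longrightarrow> \<exists>!d. d \<in> N \<and> ends_in d V"
  using assms unfolding plant_def by blast+

lemma plant_trivial: "plant p p {} {}"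
proof -
  have "\<not> face {} V" for V using face_bounds[of "{}" V] by blast
  then show ?thesis by (simp add: plant_def linked_def)
qed

lemma plant_side: "plant p (p + 1) {} {(p, p + 1)}"
proof -
  have "\<not> face {(p, p + 1)} V" for V
  proof
    assume V: "face {(p, p + 1)} V"
    obtain i j where ij: "V \<subseteq> {i..j}" "(i, j) \<in> {(p, p + 1)}" using face_bounds[OF V] by metis
    obtain v where "v \<in> V" "v \<noteq> p" "v \<noteq> p + 1" using face_third[OF V] by metis
    then show False using ij by auto
  qed
  moreover have "linked {(p, p + 1)} {p..p + 1}"
    unfolding linked_def
  proof (intro ballI)
    fix i j assume "i \<in> {p..p + 1}" "j \<in> {p..p + 1}"
    then have "i = j \<or> (i, j) \<in> {(p, p + 1)} \<union> {(p, p + 1)}\<inverse>" by auto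
    then show "(i, j) \<in> ({(p, p + 1)} \<union> {(p, p + 1)}\<inverse>)\<^sup>*" by auto
  qed
  ultimately show ?thesis by (auto simp: plant_def)
qed

lemma plant_empty: "plant p p N D \<Longrightarrow> N = {} \<and> D = {}"
  by (auto simp: plant_def intv_def)

text \<open>A numerator diagonal lies strictly under a denominator diagonal.\<close>

lemma numerator_below:
  assumes P: "plant p q N D" and d: "(k, l) \<in> N"
  obtains W i j where "face D W" "k \<in> W" "l \<in> W" "i \<in> W" "j \<in> W" "W \<subseteq> {i..j}" "(i, j) \<in> D"
    "i \<le> k" "k < l" "l \<le> j" "(i, j) \<noteq> (k, l)"
proof -
  obtain W where W: "face D W" "k \<in> W" "l \<in> W" using plantD(6)[OF P d] by auto
  obtain i j where ij: "i \<in> W" "j \<in> W" "i < j" "W \<subseteq> {i..j}" "(i, j) \<in> D"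
    by (rule face_bounds[OF W(1)])
  moreover have "i \<le> k" "l \<le> j" using W ij(4) by auto
  moreover have "k < l" using plantD(1)[OF P] d by auto
  moreover have "(k, l) \<notin> D" using plantD(3)[OF P] d by auto
  ultimately show ?thesis using W that[of W i j] by auto
qed

lemma base_not_numerator: "plant p q N D \<Longrightarrow> (p, q) \<notin> N"
proof
  assume P: "plant p q N D" and d: "(p, q) \<in> N"
  obtain W i j where "(i, j) \<in> D" "i \<le> p" "q \<le> j" "(i, j) \<noteq> (p, q)"
    by (rule numerator_below[OF P d])
  then show False using plantD(2)[OF P] by auto
qed

lemma linked_mono: "linked D A \<Longrightarrow> D \<subseteq> D' \<Longrightarrow> linked D' A"
  unfolding linked_def by (meson converse_mono rtrancl_mono subsetD sup.mono)

lemma linked_union: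
  assumes "linked D A" "linked D B" "a \<in> A" "b \<in> B" "(a, b) \<in> (D \<union> D\<inverse>)\<^sup>*"
  shows "linked D (A \<union> B)"
proof -
  have s: "(y, x) \<in> (D \<union> D\<inverse>)\<^sup>*" if "(x, y) \<in> (D \<union> D\<inverse>)\<^sup>*" for x y
    using that by (metis converse_Un converse_converse rtrancl_converseI sup_commute)
  have "(x, a) \<in> (D \<union> D\<inverse>)\<^sup>*" if "x \<in> A \<union> B" for x
    using that assms s unfolding linked_def by (metis Un_iff rtrancl_trans)
  then show ?thesis unfolding linked_def using s by (meson rtrancl_trans)
qed

lemma linked_map:
  assumes "linked D A" "B \<subseteq> A" "\<And>x. x \<in> B \<Longrightarrow> f x = x"
    and "\<And>i j. (i, j) \<in> D \<Longrightarrow> (f i, f j) \<in> (D' \<union> D'\<inverse>)\<^sup>*"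
  shows "linked D' B"
  unfolding linked_def
proof (intro ballI)
  have s: "(y, x) \<in> (D' \<union> D'\<inverse>)\<^sup>*" if "(x, y) \<in> (D' \<union> D'\<inverse>)\<^sup>*" for x y
    using that by (metis converse_Un converse_converse rtrancl_converseI sup_commute)
  have "(f x, f y) \<in> (D' \<union> D'\<inverse>)\<^sup>*" if "(x, y) \<in> (D \<union> D\<inverse>)\<^sup>*" for x y
    using that
  proof induction
    case (step y z)
    have "(f y, f z) \<in> (D' \<union> D'\<inverse>)\<^sup>*" using step(2) assms(4)[of y z] assms(4)[of z y] s by blast
    then show ?case using step by (meson rtrancl_trans)
  qed simp
  then show "(i, j) \<in> (D' \<union> D'\<inverse>)\<^sup>*" if "i \<in> B" "j \<in> B" for i j
    using that assms(1-3) unfolding linked_def by (metis subsetD)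
qed

subsection \<open>Building plants\<close>

text \<open>
  Two plants on intervals that share at most one vertex, possibly with the common base as a further
  denominator, form a plant if this does not create new faces.
\<close>

lemma plant_union:
  assumes P1: "plant p m N1 D1" and P2: "plant m' q N2 D2" and le: "p \<le> m" "m \<le> m'" "m' \<le> q"
    and B: "B \<subseteq> {(p, q)}" "B = {} \<or> m < m'"
    and link: "linked (B \<union> (D1 \<union> D2)) {p..q}"
    and sep: "\<And>V. face (B \<union> (D1 \<union> D2)) V \<Longrightarrow> V \<subseteq> {..m} \<or> V \<subseteq> {m'..}"
  shows "plant p q (N1 \<union> N2) (B \<union> (D1 \<union> D2))"
proof -
  note A1 = plantD[OF P1] and A2 = plantD[OF P2]
  let ?D = "B \<union> (D1 \<union> D2)"
  have f1: "face ?D V \<longleftrightarrow> face D1 V" if "V \<subseteq> {..m}" for V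
  proof (rule face_cong)
    fix i j assume "i \<in> V" "j \<in> V" "i < j"
    then have "j \<le> m" "i < j" using that by auto
    then have "(i, j) \<notin> D2" "(i, j) \<notin> B" using A2(2) B le by auto
    then show "(i, j) \<in> ?D \<longleftrightarrow> (i, j) \<in> D1" by auto
  qed
  have f2: "face ?D V \<longleftrightarrow> face D2 V" if "V \<subseteq> {m'..}" for V
  proof (rule face_cong)
    fix i j assume "i \<in> V" "j \<in> V" "i < j"
    then have "m' \<le> i" "i < j" using that by auto
    then have "(i, j) \<notin> D1" "(i, j) \<notin> B" using A1(2) B le by auto
    then show "(i, j) \<in> ?D \<longleftrightarrow> (i, j) \<in> D2" by auto
  qed
  have g1: "V \<subseteq> {..m}" if "face D1 V" for V
    using face_within[OF that A1(2)] by auto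
  have g2: "V \<subseteq> {m'..}" if "face D2 V" for V
    using face_within[OF that A2(2)] by auto
  have sub: "N1 \<union> D1 \<subseteq> intv p m" "N2 \<union> D2 \<subseteq> intv m' q" using A1(1,2) A2(1,2) by auto
  have dj: "intv p m \<inter> intv m' q = {}" "B \<inter> intv p m = {}" "B \<inter> intv m' q = {}"
    using le B by (auto simp: intv_def)
  show ?thesis
    unfolding plant_def
  proof (intro conjI allI impI ballI)
    have i: "intv p m \<subseteq> intv p q" "intv m' q \<subseteq> intv p q" using le by (auto intro!: intv_mono)
    have "p < q" if "B \<noteq> {}" using that B(2) le by auto
    then have "(p, q) \<in> intv p q" if "B \<noteq> {}" using that by simp
    then have "B \<subseteq> intv p q" using B(1) by blast
    then show "N1 \<union> N2 \<subseteq> intv p q" "?D \<subseteq> intv p q" using sub i by blast+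
    show "(N1 \<union> N2) \<inter> ?D = {}" using A1(3) A2(3) sub dj by blast
    show "linked ?D {p..q}" by (fact link)
  next
    fix d e assume de: "d \<in> N1 \<union> N2 \<union> ?D" "e \<in> N1 \<union> N2 \<union> ?D"
    obtain i j k l where [simp]: "d = (i, j)" "e = (k, l)" by (cases d, cases e)
    have cl: "x \<in> B \<or> x \<in> N1 \<union> D1 \<and> x \<in> intv p m \<or> x \<in> N2 \<union> D2 \<and> x \<in> intv m' q"
      if "x \<in> N1 \<union> N2 \<union> ?D" for x using that sub by blast
    show "\<not> interlaced d e"
    proof (cases "d \<in> N1 \<union> D1 \<and> e \<in> N1 \<union> D1 \<or> d \<in> N2 \<union> D2 \<and> e \<in> N2 \<union> D2")
      case True then show ?thesis using A1(4)[of d e] A2(4)[of d e] by blast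
    next
      case False
      then consider "d \<in> B" | "e \<in> B" | "d \<in> intv p m" "e \<in> intv m' q" | "d \<in> intv m' q" "e \<in> intv p m"
        using cl[OF de(1)] cl[OF de(2)] by blast
      then show ?thesis
      proof cases
        case 1
        then show ?thesis using cl[OF de(2)] B(1) le by auto
      next
        case 2
        then show ?thesis using cl[OF de(1)] B(1) le by auto
      qed (use le in auto)
    qed
  next
    fix d assume "d \<in> N1 \<union> N2"
    then consider V where "face D1 V" "ends_in d V" | V where "face D2 V" "ends_in d V"
      using A1(6)[of d] A2(6)[of d] by blast
    then show "\<exists>V. face ?D V \<and> ends_in d V"
    proof cases
      case 1 then show ?thesis using f1[OF g1] by blast
    next
      case 2 then show ?thesis using f2[OF g2] by blast
    qed
  next
    fix V assume V: "face ?D V"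
    from sep[OF V] show "\<exists>!d. d \<in> N1 \<union> N2 \<and> ends_in d V"
    proof
      assume s: "V \<subseteq> {..m}"
      have "\<not> ends_in d V" if "d \<in> N2" for d
        using that s A2(1) le by (cases d) force
      then show ?thesis using A1(7)[of V] f1[OF s] V by blast
    next
      assume s: "V \<subseteq> {m'..}"
      have "\<not> ends_in d V" if "d \<in> N1" for d
        using that s A1(1) le by (cases d) force
      then show ?thesis using A2(7)[of V] f2[OF s] V by blast
    qed
  qed
qed

lemma plant_glue:
  assumes P1: "plant p m N1 D1" and P2: "plant m q N2 D2" and le: "p \<le> m" "m \<le> q"
  shows "plant p q (N1 \<union> N2) (D1 \<union> D2)"
proof -
  note A = plantD[OF P1] and B = plantD[OF P2]
  have "plant p q (N1 \<union> N2) ({} \<union> (D1 \<union> D2))"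
  proof (rule plant_union[OF P1 P2])
    have "linked (D1 \<union> D2) ({p..m} \<union> {m..q})"
      using linked_mono[OF A(5), of "D1 \<union> D2"] linked_mono[OF B(5), of "D1 \<union> D2"] le
      by (intro linked_union[of _ _ _ m m]) auto
    then show "linked ({} \<union> (D1 \<union> D2)) {p..q}" using le by (simp add: ivl_disj_un)
    fix V assume V: "face ({} \<union> (D1 \<union> D2)) V"
    obtain i j where "V \<subseteq> {i..j}" "(i, j) \<in> D1 \<union> D2" using face_bounds[OF V] by (metis Un_empty_left)
    then have "j \<le> m \<or> m \<le> i" using A(2) B(2) by auto
    then show "V \<subseteq> {..m} \<or> V \<subseteq> {m..}" using \<open>V \<subseteq> {i..j}\<close> by auto
  qed (use le in auto)
  then show ?thesis by simp
qed

text \<open>Two plants on adjacent intervals, joined by the common base.\<close>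

lemma plant_bridge:
  assumes P1: "plant p m N1 D1" and P2: "plant (m + 1) q N2 D2" and le: "p \<le> m" "m + 1 \<le> q"
  shows "plant p q (N1 \<union> N2) (insert (p, q) (D1 \<union> D2))"
proof -
  note A = plantD[OF P1] and B = plantD[OF P2]
  let ?D = "{(p, q)} \<union> (D1 \<union> D2)"
  have "plant p q (N1 \<union> N2) ?D"
  proof (rule plant_union[OF P1 P2])
    have "linked ?D ({p..m} \<union> {m + 1..q})"
      using linked_mono[OF A(5), of ?D] linked_mono[OF B(5), of ?D] le
      by (intro linked_union[of _ _ _ p q]) auto
    moreover have "{p..m} \<union> {m + 1..q} = {p..q}" using le by auto
    ultimately show "linked ?D {p..q}" by simp
    fix V assume V: "face ?D V"
    obtain i j where ij: "i \<in> V" "j \<in> V" "i < j" "V \<subseteq> {i..j}" "(i, j) \<in> ?D"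
      by (rule face_bounds[OF V])
    show "V \<subseteq> {..m} \<or> V \<subseteq> {m + 1..}"
    proof (cases "(i, j) = (p, q)")
      case False
      then have "j \<le> m \<or> m + 1 \<le> i" using ij A(2) B(2) by auto
      then show ?thesis using ij by auto
    next
      case True
      \<comment> \<open>such a face would contain another edge from one interval to the other\<close>
      let ?a = "Max (V \<inter> {..m})" and ?b = "Min (V \<inter> {m + 1..})"
      have fin: "finite V" by (rule face_finite[OF V])
      have a: "?a \<in> V \<inter> {..m}" using fin ij(1) True le by (intro Max_in) auto
      have b: "?b \<in> V \<inter> {m + 1..}" using fin ij(2) True le by (intro Min_in) auto
      have "w \<notin> {?a<..<?b}" if w: "w \<in> V" for w
      proof (cases "w \<le> m")
        case True
        then have "w \<le> ?a" using w fin by (intro Max_ge) auto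
        then show ?thesis by simp
      next
        case False
        then have "?b \<le> w" using w fin by (intro Min_le) auto
        then show ?thesis by simp
      qed
      then have e: "V \<inter> {?a<..<?b} = {}" by blast
      have "?a < ?b" using a b by simp
      then have "(?a, ?b) \<in> ?D" using face_edge[OF V, of ?a ?b] a b e by simp
      moreover have "(?a, ?b) \<notin> D1 \<union> D2" using a b A(2) B(2) by auto
      ultimately have "?a = p" "?b = q" by auto
      obtain v where v: "v \<in> V" "v \<noteq> p" "v \<noteq> q" by (rule face_third[OF V])
      then have "v \<in> {p<..<q}" using ij(4) True by auto
      then show ?thesis using e v(1) unfolding \<open>?a = p\<close> \<open>?b = q\<close> by blast
    qed
  qed (use le in auto)
  then show ?thesis by simp
qed

text \<open>
  The boundary path from \<open>p\<close> to \<open>q\<close> along the outer face, given by its vertices: consecutive ones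
  are joined by an edge of \<open>D\<close>, and there are no other edges between them.
\<close>

definition outer_path :: "(nat \<times> nat) set \<Rightarrow> nat \<Rightarrow> nat \<Rightarrow> nat set \<Rightarrow> bool" where
  "outer_path D p q V \<longleftrightarrow> finite V \<and> p \<in> V \<and> q \<in> V \<and> V \<subseteq> {p..q}
     \<and> (\<forall>i\<in>V. \<forall>j\<in>V. i < j \<longrightarrow> ((i, j) \<in> D \<longleftrightarrow> V \<inter> {i<..<j} = {}))"

lemma outer_path_trivial: "outer_path D p p {p}"
  by (simp add: outer_path_def)

lemma outer_path_base: "(p, q) \<in> D \<Longrightarrow> p < q \<Longrightarrow> outer_path D p q {p, q}"
  by (auto simp: outer_path_def)

lemma outer_path_glue:
  assumes "outer_path D1 p m V1" "outer_path D2 m q V2" "D1 \<subseteq> intv p m" "D2 \<subseteq> intv m q"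
    "p \<le> m" "m \<le> q"
  shows "outer_path (D1 \<union> D2) p q (V1 \<union> V2)"
proof -
  have v: "V1 \<subseteq> {p..m}" "V2 \<subseteq> {m..q}" "m \<in> V1" "m \<in> V2"
    using assms by (auto simp: outer_path_def)
  have e: "(i, j) \<in> D1 \<union> D2 \<longleftrightarrow> (V1 \<union> V2) \<inter> {i<..<j} = {}"
    if ij: "i \<in> V1 \<union> V2" "j \<in> V1 \<union> V2" "i < j" for i j
  proof -
    consider "j \<le> m" | "m \<le> i" | "i < m" "m < j" by linarith
    then show ?thesis
    proof cases
      case 1
      then have "i \<in> V1" "j \<in> V1" "V2 \<inter> {i<..<j} = {}" "(i, j) \<notin> D2"
        using ij v assms(4) by (auto dest: subsetD)
      then show ?thesis using assms(1) ij(3) by (auto simp: outer_path_def Int_Un_distrib2)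
    next
      case 2
      then have "i \<in> V2" "j \<in> V2" "V1 \<inter> {i<..<j} = {}" "(i, j) \<notin> D1"
        using ij v assms(3) by (auto dest: subsetD)
      then show ?thesis using assms(2) ij(3) by (auto simp: outer_path_def Int_Un_distrib2)
    next
      case 3
      then have "(i, j) \<notin> D1 \<union> D2" using assms(3,4) by auto
      moreover have "m \<in> (V1 \<union> V2) \<inter> {i<..<j}" using 3 v by auto
      ultimately show ?thesis by blast
    qed
  qed
  have "V1 \<subseteq> {p..q}" "V2 \<subseteq> {p..q}" using v(1,2) assms(5,6) by (auto dest!: subsetD)
  moreover have "finite V1" "finite V2" "p \<in> V1" "q \<in> V2"
    using assms(1,2) by (auto simp: outer_path_def)
  ultimately show ?thesis unfolding outer_path_def using e by simp
qed

text \<open>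
  Closing the outer path of a plant by its base and adding a numerator \<open>(r, t)\<close> in the new face. No
  diagonal jumps over \<open>r\<close> or \<open>t\<close>, which forces the new face to contain these two vertices. An old
  numerator cannot have both its ends in the new face: the denominator above it would be a chord.
\<close>

lemma plant_close:
  assumes P: "plant p q N D" and V: "outer_path D p q V" and rt: "r \<in> V" "t \<in> V" "r < t"
    and nb: "(p, q) \<notin> D" "(r, t) \<notin> D" "(r, t) \<noteq> (p, q)"
    and ns: "\<And>i j. (i, j) \<in> N \<union> D \<Longrightarrow> \<not> (i < r \<and> r < j) \<and> \<not> (i < t \<and> t < j)"
  shows "plant p q (insert (r, t) N) (insert (p, q) D)"
proof -
  note A = plantD[OF P]
  let ?D = "insert (p, q) D" and ?N = "insert (r, t) N"
  have Vs: "V \<subseteq> {p..q}" "p \<in> V" "q \<in> V" "finite V" using V by (auto simp: outer_path_def)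
  have "p \<le> r" "t \<le> q" using rt Vs by auto
  then have pq: "p \<le> r" "t \<le> q" "p < q" using rt(3) by auto
  have f1: "face ?D W" "\<not> (p \<in> W \<and> q \<in> W)" if W: "face D W" for W
  proof -
    obtain i j where ij: "i \<in> W" "j \<in> W" "i < j" "W \<subseteq> {i..j}" "(i, j) \<in> D"
      by (rule face_bounds[OF W])
    have "p \<le> i" "j \<le> q" using ij(5) A(2) by auto
    then show n: "\<not> (p \<in> W \<and> q \<in> W)" using ij nb(1) by (metis atLeastAtMost_iff le_antisym subsetD)
    have "face D W \<longleftrightarrow> face ?D W" by (rule face_cong) (use n in auto)
    then show "face ?D W" using W by simp
  qed
  have f2: "face D W \<or> (p \<in> W \<and> q \<in> W \<and> W \<subseteq> {p..q})" if W: "face ?D W" for W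
  proof -
    obtain i j where ij: "i \<in> W" "j \<in> W" "i < j" "W \<subseteq> {i..j}" "(i, j) \<in> ?D"
      by (rule face_bounds[OF W])
    show ?thesis
    proof (cases "(i, j) = (p, q)")
      case True then show ?thesis using ij by auto
    next
      case False
      then have "p \<le> i" "j \<le> q" using ij(5) A(2) by auto
      then have n: "\<not> (p \<in> W \<and> q \<in> W)"
        using ij False by (metis atLeastAtMost_iff le_antisym subsetD)
      have "face D W \<longleftrightarrow> face ?D W" by (rule face_cong) (use n in auto)
      then show ?thesis using W by simp
    qed
  qed
  have mid: "\<not> W \<inter> {p<..<q} = {}" if W: "face ?D W" and s: "W \<subseteq> {p..q}" for W
  proof -
    obtain v where "v \<in> W" "v \<noteq> p" "v \<noteq> q" by (rule face_third[OF W])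
    then show ?thesis using s by force
  qed
  have fV: "face ?D V"
  proof -
    have "V \<inter> {p<..<q} \<noteq> {}" using V nb(1) pq(3) by (auto simp: outer_path_def)
    then obtain v where v: "v \<in> V" "p < v" "v < q" by auto
    have "{p, v, q} \<subseteq> V" using v Vs by blast
    then have "card {p, v, q} \<le> card V" by (rule card_mono[OF Vs(4)])
    then have c: "card V \<ge> 3" using v by simp
    have "(i, j) \<in> ?D \<longleftrightarrow> V \<inter> {i<..<j} = {} \<or> V \<subseteq> {i..j}" if ij: "i \<in> V" "j \<in> V" "i < j" for i j
    proof -
      have "p \<le> i" "j \<le> q" using Vs(1) ij by auto
      then have "V \<subseteq> {i..j} \<longleftrightarrow> (i, j) = (p, q)" using Vs(1-3) by auto
      then show ?thesis using V ij by (auto simp: outer_path_def)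
    qed
    then show ?thesis using c Vs(4) by (simp add: face_def)
  qed
  \<comment> \<open>no edge other than the base jumps over \<open>r\<close> or \<open>t\<close>, so the new face contains both\<close>
  have rtW: "v \<in> W" if W: "face ?D W" and pqW: "p \<in> W" "q \<in> W" "W \<subseteq> {p..q}" and v: "v \<in> {r, t}"
    for W v
  proof (rule ccontr)
    assume vW: "v \<notin> W"
    have "p < v" "v < q" using vW v pqW pq rt by (metis insertE le_neq_implies_less order.strict_trans1
          order.strict_trans2 singletonD)+
    then obtain a b where ab: "a \<in> W" "b \<in> W" "a < v" "v < b" "W \<inter> {a<..<b} = {}" "(a, b) \<in> ?D"
      using face_gap[OF W pqW(1) _ pqW(2) _ vW] by metis
    have "(a, b) = (p, q)" using ab ns[of a b] v by auto
    then show False using mid[OF W pqW(3)] ab(5) by auto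
  qed
  have old: "\<not> ends_in d W" if W: "face ?D W" and pqW: "p \<in> W" "q \<in> W" "W \<subseteq> {p..q}" and d: "d \<in> N"
    for W d
  proof
    assume dW: "ends_in d W"
    obtain i j where [simp]: "d = (i, j)" by (cases d)
    have ij: "i \<in> W" "j \<in> W" using dW by auto
    obtain U a b where U: "(a, b) \<in> D" "a \<le> i" "i < j" "j \<le> b"
      using numerator_below[OF P] d by (metis \<open>d = (i, j)\<close>)
    have "(i, j) \<notin> ?D" using d A(3) base_not_numerator[OF P] by auto
    then have "W \<inter> {i<..<j} \<noteq> {}"
      using face_edge[OF W ij \<open>i < j\<close>] by blast
    then obtain v where v: "v \<in> W" "i < v" "v < j" by auto
    have ni: "\<not> interlaced (x, y) (a, b)" if "(x, y) \<in> ?D" "(x, y) \<noteq> (p, q)" for x y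
      using that A(4)[of "(x, y)" "(a, b)"] U(1) by auto
    have abpq: "p \<le> a" "b \<le> q" using U(1) A(2) by auto
    have gapn: "(x, y) \<noteq> (p, q)" if "W \<inter> {x<..<y} = {}" for x y
      using that v U abpq by auto
    have "a \<in> W"
    proof (rule ccontr)
      assume aW: "a \<notin> W"
      have "p < a" "a < i" using aW pqW(1) ij abpq U by (metis le_neq_implies_less)+
      then obtain x y where xy: "x < a" "a < y" "y \<le> i" "W \<inter> {x<..<y} = {}" "(x, y) \<in> ?D"
        using face_gap[OF W pqW(1) _ ij(1) _ aW] by metis
      then show False using ni[OF xy(5) gapn[OF xy(4)]] U by simp
    qed
    moreover have "b \<in> W"
    proof (rule ccontr)
      assume bW: "b \<notin> W"
      have "b < q" "j < b" using bW pqW(2) ij abpq U by (metis le_neq_implies_less)+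
      then obtain x y where xy: "j \<le> x" "x < b" "b < y" "W \<inter> {x<..<y} = {}" "(x, y) \<in> ?D"
        using face_gap[OF W ij(2) _ pqW(2) _ bW] by metis
      then show False using ni[OF xy(5) gapn[OF xy(4)]] U by simp
    qed
    ultimately have "W \<inter> {a<..<b} = {} \<or> W \<subseteq> {a..b}"
      using face_edge[OF W, of a b] U by simp
    moreover have "v \<in> {a<..<b}" using v U by simp
    ultimately have "W \<subseteq> {a..b}" using v(1) by blast
    then have "(a, b) = (p, q)" using pqW abpq by auto
    then show False using U(1) nb(1) by simp
  qed
  show ?thesis
    unfolding plant_def
  proof (intro conjI allI impI ballI)
    show "?N \<subseteq> intv p q" "?D \<subseteq> intv p q" using A(1,2) pq rt by auto
    show "?N \<inter> ?D = {}" using A(3) nb base_not_numerator[OF P] by auto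
  next
    fix d e assume de: "d \<in> ?N \<union> ?D" "e \<in> ?N \<union> ?D"
    obtain i j k l where [simp]: "d = (i, j)" "e = (k, l)" by (cases d, cases e)
    have "d = (p, q) \<or> d = (r, t) \<or> d \<in> N \<union> D" "p \<le> i" "i < j" "j \<le> q"
      "e = (p, q) \<or> e = (r, t) \<or> e \<in> N \<union> D" "p \<le> k" "k < l" "l \<le> q"
      using de A(1,2) pq rt by auto
    then show "\<not> interlaced d e" using A(4)[of d e] ns[of i j] ns[of k l] by auto
  next
    show "linked ?D {p..q}" by (rule linked_mono[OF A(5)]) auto
  next
    fix d assume "d \<in> ?N"
    then show "\<exists>V. face ?D V \<and> ends_in d V"
      using A(6)[of d] f1(1) fV rt by (metis ends_in_iff insertE)
  next
    fix W assume W: "face ?D W"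
    show "\<exists>!d. d \<in> ?N \<and> ends_in d W"
    proof (cases "face D W")
      case True
      have "\<not> ends_in (r, t) W"
      proof
        assume e: "ends_in (r, t) W"
        obtain i j where ij: "i \<in> W" "j \<in> W" "i < j" "W \<subseteq> {i..j}" "(i, j) \<in> D"
          by (rule face_bounds[OF True])
        have "i \<le> r" "t \<le> j" using e ij(4) by auto
        then have "(i, j) = (r, t)" using ns[of i j] ij(5) rt(3) by fastforce
        then show False using ij(5) nb by simp
      qed
      then show ?thesis using A(7)[OF True] by auto
    next
      case False
      then have pqW: "p \<in> W" "q \<in> W" "W \<subseteq> {p..q}" using f2[OF W] by auto
      show ?thesis
        by (rule ex1I[of _ "(r, t)"]) (use rtW[OF W pqW] old[OF W pqW] in auto)
    qed
  qed
qed

subsection \<open>Taking plants apart\<close>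

text \<open>
  The part of a plant between two vertices \<open>a\<close> and \<open>b\<close> that no denominator diagonal other than
  the base jumps over.
\<close>

lemma plant_restrict:
  fixes N D p q a b
  defines "D' \<equiv> (D - {(p, q)}) \<inter> intv a b" and "N' \<equiv> N \<inter> intv a b - {(a, b)}"
  assumes P: "plant p q N D" and ab: "p \<le> a" "a \<le> b" "b \<le> q"
    and sep: "\<And>i j. (i, j) \<in> D \<Longrightarrow> (i, j) \<noteq> (p, q) \<Longrightarrow> (i, j) \<in> intv a b \<or> j \<le> a \<or> b \<le> i"
    and base: "\<And>W d. face D W \<Longrightarrow> p \<in> W \<Longrightarrow> q \<in> W \<Longrightarrow> ends_in d W \<Longrightarrow> d \<notin> N'"
    and link: "linked D' {a..b}"
  shows "plant a b N' D'"
proof -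
  note A = plantD[OF P]
  have D'D: "D' \<subseteq> D" "(p, q) \<notin> D'" "D' \<subseteq> intv a b" "N' \<subseteq> N" "N' \<subseteq> intv a b"
    by (auto simp: D'_def N'_def)
  have fc: "face D W \<longleftrightarrow> face D' W" if "W \<subseteq> {a..b}" "\<not> (p \<in> W \<and> q \<in> W)" for W
  proof (rule face_cong)
    fix i j assume "i \<in> W" "j \<in> W" "i < j"
    then show "(i, j) \<in> D \<longleftrightarrow> (i, j) \<in> D'" using that by (auto simp: D'_def)
  qed
  have F1: "face D W" "W \<subseteq> {a..b}" "(a, b) \<in> D' \<or> \<not> (a \<in> W \<and> b \<in> W)" if W: "face D' W" for W
  proof -
    obtain i j where ij: "i \<in> W" "j \<in> W" "i < j" "W \<subseteq> {i..j}" "(i, j) \<in> D'"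
      by (rule face_bounds[OF W])
    have "a \<le> i" "j \<le> b" using ij(5) D'D(3) by auto
    then show s: "W \<subseteq> {a..b}" using ij(4) by force
    have "\<not> (p \<in> W \<and> q \<in> W)"
    proof
      assume "p \<in> W \<and> q \<in> W"
      then have "i = p" "j = q" using ij(4) \<open>a \<le> i\<close> \<open>j \<le> b\<close> ab by auto
      then show False using ij(5) D'D(2) by simp
    qed
    then show "face D W" using fc[OF s] W by simp
    show "(a, b) \<in> D' \<or> \<not> (a \<in> W \<and> b \<in> W)"
    proof (rule disjCI)
      assume "\<not> \<not> (a \<in> W \<and> b \<in> W)"
      then have "i = a" "j = b" using ij(4) \<open>a \<le> i\<close> \<open>j \<le> b\<close> by auto
      then show "(a, b) \<in> D'" using ij(5) by simp
    qed
  qed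
  have F2: "face D' W" if d: "d \<in> N'" and W: "face D W" and e: "ends_in d W" for d W
  proof -
    have n: "\<not> (p \<in> W \<and> q \<in> W)" using base[OF W _ _ e] d by blast
    obtain k l where [simp]: "d = (k, l)" by (cases d)
    have kl: "a \<le> k" "k < l" "l \<le> b" using d D'D(5) by auto
    obtain i j where ij: "i \<in> W" "j \<in> W" "i < j" "W \<subseteq> {i..j}" "(i, j) \<in> D"
      by (rule face_bounds[OF W])
    have "(i, j) \<noteq> (p, q)" using n ij by auto
    then have "(i, j) \<in> intv a b \<or> j \<le> a \<or> b \<le> i" using sep ij(5) by blast
    moreover have "i \<le> k" "l \<le> j" using e ij(4) by auto
    ultimately have "W \<subseteq> {a..b}" using kl ij(4) by fastforce
    then show ?thesis using fc n W by simp
  qed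
  have F3: "d \<in> N'" if W: "face D' W" and d: "d \<in> N" and e: "ends_in d W" for d W
  proof -
    obtain k l where [simp]: "d = (k, l)" by (cases d)
    have "k < l" using d A(1) by auto
    moreover have "k \<in> {a..b}" "l \<in> {a..b}" using e F1(2)[OF W] by auto
    moreover have "d \<noteq> (a, b)" using F1(3)[OF W] e d A(3) D'D(1) by auto
    ultimately show ?thesis using d by (simp add: N'_def)
  qed
  show ?thesis
    unfolding plant_def
  proof (intro conjI allI impI ballI)
    show "N' \<subseteq> intv a b" "D' \<subseteq> intv a b" "linked D' {a..b}" by (fact D'D link)+
    show "N' \<inter> D' = {}" using A(3) D'D by auto
    show "\<not> interlaced d e" if "d \<in> N' \<union> D'" "e \<in> N' \<union> D'" for d e
      using that A(4)[of d e] D'D by auto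
    show "\<exists>V. face D' V \<and> ends_in d V" if "d \<in> N'" for d
      using A(6)[of d] F2[OF that] that D'D(4) by blast
    show "\<exists>!d. d \<in> N' \<and> ends_in d W" if W: "face D' W" for W
      using A(7)[OF F1(1)[OF W]] F3[OF W] D'D(4) by blast
  qed
qed

text \<open>
  If no edge other than the base jumps over \<open>a\<close> or \<open>b\<close>, then moving every vertex to the nearest one
  in \<open>a, \<dots>, b\<close> maps each edge to an edge or a point, and the base to \<open>(a, b)\<close>.
\<close>

lemma linked_clamp:
  fixes D p q a b
  defines "D' \<equiv> (D - {(p, q)}) \<inter> intv a b"
  assumes "linked D {p..q}" and ab: "p \<le> a" "a \<le> b" "b \<le> q"
    and sep: "\<And>i j. (i, j) \<in> D \<Longrightarrow> (i, j) \<noteq> (p, q) \<Longrightarrow>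
      (i, j) \<in> intv a b \<or> (i < j \<and> j \<le> a) \<or> (b \<le> i \<and> i < j)"
    and base: "(p, q) \<in> D \<Longrightarrow> (a, b) \<in> (D' \<union> D'\<inverse>)\<^sup>*"
  shows "linked D' {a..b}"
proof (rule linked_map[OF assms(2), where f = "\<lambda>x. max a (min x b)"])
  fix i j assume ij: "(i, j) \<in> D"
  show "(max a (min i b), max a (min j b)) \<in> (D' \<union> D'\<inverse>)\<^sup>*"
  proof (cases "(i, j) = (p, q)")
    case True
    then show ?thesis using base ij ab by (auto simp: max_def min_def)
  next
    case False
    then consider "(i, j) \<in> intv a b" | "i < j" "j \<le> a" | "b \<le> i" "i < j" using sep ij by blast
    then show ?thesis
    proof cases
      case 1
      then have "(max a (min i b), max a (min j b)) \<in> D'"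
        using ij False by (auto simp: D'_def max_def min_def)
      then show ?thesis by auto
    qed (use ab in \<open>auto simp: max_def min_def\<close>)
  qed
qed (use ab in auto)

text \<open>
  A plant whose base is not a denominator splits at the farthest neighbour of its first vertex.
\<close>

lemma plant_cut:
  assumes P: "plant p q N D" and pq: "p < q" and nb: "(p, q) \<notin> D"
  obtains m N1 D1 N2 D2 where "p < m" "m < q" "plant p m N1 D1" "plant m q N2 D2"
    "N = N1 \<union> N2" "D = D1 \<union> D2"
proof -
  note A = plantD[OF P]
  let ?S = "{x. (p, x) \<in> D}"
  have "(p, q) \<in> (D \<union> D\<inverse>)\<^sup>*" using A(5) pq by (auto simp: linked_def)
  then obtain x where "(p, x) \<in> D \<union> D\<inverse>" using pq by (metis converse_rtranclE less_irrefl)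
  then have x: "x \<in> ?S" using A(2) by (auto dest!: subsetD[OF A(2)])
  have fin: "finite ?S" by (rule finite_subset[of _ "{..q}"]) (use A(2) in auto)
  define m where "m = Max ?S"
  have m: "(p, m) \<in> D" using Max_in[OF fin] x unfolding m_def by blast
  have mmax: "y \<le> m" if "(p, y) \<in> D" for y using Max_ge[OF fin] that unfolding m_def by blast
  have pm: "p < m" "m < q" using m A(2) nb by (auto simp: order.strict_iff_order)
  have sepD: "(i, j) \<in> intv p m \<or> (i, j) \<in> intv m q" if "(i, j) \<in> D" for i j
  proof -
    have "p \<le> i" "i < j" "j \<le> q" using that A(2) by auto
    moreover have "j \<le> m" if "i = p" using mmax \<open>(i, j) \<in> D\<close> that by simp
    moreover have "\<not> interlaced (i, j) (p, m)" using A(4) that m by blast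
    ultimately show ?thesis by (cases "i = p") auto
  qed
  have sepN: "((i, j) \<in> intv p m \<or> (i, j) \<in> intv m q) \<and> (i, j) \<noteq> (p, m) \<and> (i, j) \<noteq> (m, q)"
    if ij: "(i, j) \<in> N" for i j
  proof -
    obtain W k l where "(k, l) \<in> D" "k \<le> i" "i < j" "j \<le> l" "(k, l) \<noteq> (i, j)"
      by (rule numerator_below[OF P ij])
    then show ?thesis using sepD[of k l] by auto
  qed
  define R where "R = (\<lambda>a b. (D - {(p, q)}) \<inter> intv a b)"
  define M where "M = (\<lambda>a b. N \<inter> intv a b - {(a, b)})"
  have nobase: "\<not> (p \<in> W \<and> q \<in> W)" if W: "face D W" for W
  proof
    assume pq: "p \<in> W \<and> q \<in> W"
    obtain i j where ij: "i \<in> W" "j \<in> W" "i < j" "W \<subseteq> {i..j}" "(i, j) \<in> D"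
      by (rule face_bounds[OF W])
    then have "p \<le> i" "j \<le> q" using A(2) by auto
    then have "(i, j) = (p, q)" using ij pq by auto
    then show False using ij(5) nb by simp
  qed
  have "linked (R p m) {p..m}" unfolding R_def
  proof (rule linked_clamp[OF A(5)])
    fix i j assume "(i, j) \<in> D"
    then show "(i, j) \<in> intv p m \<or> i < j \<and> j \<le> p \<or> m \<le> i \<and> i < j" using sepD[of i j] by auto
  qed (use pm nb in auto)
  then have 1: "plant p m (M p m) (R p m)" unfolding R_def M_def
  proof (rule plant_restrict[OF P, rotated -1])
    fix i j assume "(i, j) \<in> D"
    then show "(i, j) \<in> intv p m \<or> j \<le> p \<or> m \<le> i" using sepD[of i j] by auto
  qed (use pm nobase in auto)
  have "linked (R m q) {m..q}" unfolding R_def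
  proof (rule linked_clamp[OF A(5)])
    fix i j assume "(i, j) \<in> D"
    then show "(i, j) \<in> intv m q \<or> i < j \<and> j \<le> m \<or> q \<le> i \<and> i < j" using sepD[of i j] by auto
  qed (use pm nb in auto)
  then have 2: "plant m q (M m q) (R m q)" unfolding R_def M_def
  proof (rule plant_restrict[OF P, rotated -1])
    fix i j assume "(i, j) \<in> D"
    then show "(i, j) \<in> intv m q \<or> j \<le> m \<or> q \<le> i" using sepD[of i j] by auto
  qed (use pm nobase in auto)
  have "N \<subseteq> intv p m \<union> intv m q" by (rule subrelI) (use sepN in blast)
  moreover have "(p, m) \<notin> N" "(m, q) \<notin> N" using sepN by blast+
  ultimately have "N = M p m \<union> M m q" unfolding M_def by blast
  moreover have "D \<subseteq> intv p m \<union> intv m q" by (rule subrelI) (use sepD in blast)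
  then have "D = R p m \<union> R m q" unfolding R_def using nb by blast
  ultimately show ?thesis using that[OF pm 1 2] by blast
qed

text \<open>A path given by its vertices, of which consecutive ones are joined, is connected.\<close>

lemma path_linked:
  fixes V :: "nat set"
  assumes V: "finite V" and e: "\<And>i j. i \<in> V \<Longrightarrow> j \<in> V \<Longrightarrow> i < j \<Longrightarrow> V \<inter> {i<..<j} = {} \<Longrightarrow> a \<le> i \<Longrightarrow>
    j \<le> b \<Longrightarrow> (i, j) \<in> R" and i: "i \<in> V" "a \<le> i"
  shows "j \<in> V \<Longrightarrow> i \<le> j \<Longrightarrow> j \<le> b \<Longrightarrow> (i, j) \<in> R\<^sup>*"
proof (induction j rule: less_induct)
  case (less j)
  show ?case
  proof (cases "i = j")
    case False
    let ?A = "V \<inter> {..<j}"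
    have f: "finite ?A" "i \<in> ?A" using V i less.prems False by auto
    define k where "k = Max ?A"
    have k: "k \<in> ?A" "i \<le> k" using f Max_in[of ?A] Max_ge[of ?A i] unfolding k_def by blast+
    have "w \<le> k" if "w \<in> ?A" for w using f that unfolding k_def by (simp add: Max_ge)
    then have "V \<inter> {k<..<j} = {}" by force
    then have "(k, j) \<in> R" using k less.prems i by (intro e) auto
    moreover have "(i, k) \<in> R\<^sup>*" using k less.prems by (intro less.IH) auto
    ultimately show ?thesis by simp
  qed simp
qed

text \<open>
  If no face of a plant contains its base as an edge, then the base is a bridge. Otherwise, the
  walk that starts at \<open>p\<close> and always jumps to the farthest neighbour would arrive at \<open>q\<close> and
  bound a face together with the base.
\<close>

lemma base_bridge:
  assumes P: "plant p q N D" and pq: "p < q" "(p, q) \<in> D"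
    and nf: "\<And>W. face D W \<Longrightarrow> \<not> (p \<in> W \<and> q \<in> W)"
  obtains m where "p \<le> m" "m < q" "\<And>i j. (i, j) \<in> D \<Longrightarrow> (i, j) \<noteq> (p, q) \<Longrightarrow> j \<le> m \<or> m + 1 \<le> i"
proof -
  note A = plantD[OF P]
  define D' where "D' = D - {(p, q)}"
  \<comment> \<open>\<open>Q m\<close>: a chordless path, over which no edge jumps, leads from \<open>p\<close> to \<open>m\<close>\<close>
  define Q where "Q = (\<lambda>m. m \<le> q \<and> (\<exists>V. finite V \<and> V \<subseteq> {p..m} \<and> p \<in> V \<and> m \<in> V
      \<and> (\<forall>i\<in>V. \<forall>j\<in>V. i < j \<longrightarrow> ((i, j) \<in> D' \<longleftrightarrow> V \<inter> {i<..<j} = {}))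
      \<and> (\<forall>(i, j)\<in>D'. \<forall>v\<in>V. \<not> (i < v \<and> v < j))))"
  have "Q p" unfolding Q_def D'_def using pq A(2) by (auto intro!: exI[of _ "{p}"])
  moreover have "\<And>y. Q y \<Longrightarrow> y \<le> q" by (simp add: Q_def)
  ultimately obtain m where m: "Q m" and mmax: "\<And>y. Q y \<Longrightarrow> y \<le> m"
    using GreatestI_nat[of Q p q] Greatest_le_nat[of Q _ q] by metis
  obtain V where V0: "finite V" "V \<subseteq> {p..m}" "p \<in> V" "m \<in> V"
    "\<forall>i\<in>V. \<forall>j\<in>V. i < j \<longrightarrow> ((i, j) \<in> D' \<longleftrightarrow> V \<inter> {i<..<j} = {})"
    "\<forall>(i, j)\<in>D'. \<forall>v\<in>V. \<not> (i < v \<and> v < j)"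
    using m unfolding Q_def by (elim conjE exE) (rule that)
  have V: "finite V" "V \<subseteq> {p..m}" "p \<in> V" "m \<in> V"
    "(i, j) \<in> D' \<longleftrightarrow> V \<inter> {i<..<j} = {}" if "i \<in> V" "j \<in> V" "i < j" for i j
    using V0(1-4) V0(5)[rule_format, OF that] by fast+
  have V6: "\<not> (i < v \<and> v < j)" if "(i, j) \<in> D'" "v \<in> V" for i j v
    using V0(6) that by blast
  note V = V0(1-4) V(5) V6
  have mq: "m \<noteq> q"
  proof
    assume [simp]: "m = q"
    have "V \<inter> {p<..<q} \<noteq> {}" using V(3-5) pq by (auto simp: D'_def)
    then obtain v where v: "v \<in> V" "p < v" "v < q" by auto
    have "{p, v, q} \<subseteq> V" using v V(3,4) by simp
    then have "card {p, v, q} \<le> card V" by (rule card_mono[OF V(1)])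
    then have c: "card V \<ge> 3" using v by simp
    have "(i, j) \<in> D \<longleftrightarrow> V \<inter> {i<..<j} = {} \<or> V \<subseteq> {i..j}" if ij: "i \<in> V" "j \<in> V" "i < j" for i j
    proof -
      have "p \<le> i" "j \<le> q" using V(2) ij by auto
      then have "V \<subseteq> {i..j} \<longleftrightarrow> (i, j) = (p, q)" using V(2-4) by auto
      then show ?thesis using V(5)[OF ij] pq by (auto simp: D'_def)
    qed
    then have "face D V" using c V(1) by (simp add: face_def)
    then show False using nf V(3,4) by simp
  qed
  have mle: "m \<le> q" using m by (simp add: Q_def)
  have up: "(m, w) \<notin> D'" for w
  proof
    assume "(m, w) \<in> D'"
    let ?S = "{x. (m, x) \<in> D'}"
    have fin: "finite ?S" by (rule finite_subset[of _ "{..q}"]) (use A(2) in \<open>auto simp: D'_def\<close>)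
    define w where "w = Max ?S"
    have w: "(m, w) \<in> D'" using Max_in[OF fin] \<open>(m, _) \<in> D'\<close> unfolding w_def by blast
    have wmax: "y \<le> w" if "(m, y) \<in> D'" for y using Max_ge[OF fin] that unfolding w_def by blast
    have mw: "m < w" "w \<le> q" using w A(2) by (auto simp: D'_def)
    have e1: "(i, j) \<in> D' \<longleftrightarrow> insert w V \<inter> {i<..<j} = {}"
      if ij: "i \<in> insert w V" "j \<in> insert w V" "i < j" for i j
    proof -
      have Vm: "v \<le> m" if "v \<in> V" for v using that V(2) by auto
      have i: "i \<in> V" using ij Vm[of j] mw by auto
      show ?thesis
      proof (cases "j = w")
        case False
        then have "j \<in> V" using ij by simp
        then have "w \<notin> {i<..<j}" using Vm[of j] mw by simp
        then show ?thesis using V(5)[OF i \<open>j \<in> V\<close> ij(3)] by auto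
      next
        case True
        show ?thesis
        proof (cases "i = m")
          case True
          then have "insert w V \<inter> {i<..<j} = {}" using Vm \<open>j = w\<close> by force
          then show ?thesis using w True \<open>j = w\<close> by simp
        next
          case False
          then have "m \<in> {i<..<j}" using Vm[OF i] mw True by auto
          then show ?thesis using V(4,6) by auto
        qed
      qed
    qed
    have e2: "\<not> (i < v \<and> v < j)" if ij: "(i, j) \<in> D'" and v: "v \<in> insert w V" for i j v
    proof (cases "v = w")
      case False then show ?thesis using V(6)[OF ij] v by simp
    next
      case True
      have "\<not> interlaced (i, j) (m, w)" using A(4) ij w unfolding D'_def by blast
      moreover have "\<not> (i < m \<and> m < j)" using V(6)[OF ij V(4)] .
      moreover have "j \<le> w" if "i = m" using wmax ij that by simp
      ultimately show ?thesis using True mw by (cases "i = m") auto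
    qed
    have e3: "insert w V \<subseteq> {p..w}" "finite (insert w V)" "p \<in> insert w V"
      using V(1-4) mw by (auto dest!: subsetD[OF V(2)])
    have e4: "\<forall>(i, j)\<in>D'. \<forall>v\<in>insert w V. \<not> (i < v \<and> v < j)"
    proof (rule ballI, clarify)
      fix i j v assume "(i, j) \<in> D'" "v \<in> insert w V" "i < v" "v < j"
      then show False using e2 by blast
    qed
    have "Q w" unfolding Q_def
      by (intro conjI exI[of _ "insert w V"] ballI impI mw(2) e3 e4 insertI1; rule e1)
    then show False using mmax mw by fastforce
  qed
  show ?thesis
  proof (rule that[of m])
    show "p \<le> m" "m < q" using V mq mle by auto
    fix i j assume ij: "(i, j) \<in> D" "(i, j) \<noteq> (p, q)"
    then have "(i, j) \<in> D'" by (simp add: D'_def)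
    then have "i \<noteq> m" "\<not> (i < m \<and> m < j)" using up V(4,6) by blast+
    then show "j \<le> m \<or> m + 1 \<le> i" by linarith
  qed
qed

text \<open>A plant whose base is a bridge consists of two plants on adjacent intervals.\<close>

lemma plant_unbridge:
  assumes P: "plant p q N D" and pq: "p < q" "(p, q) \<in> D"
    and nf: "\<And>W. face D W \<Longrightarrow> \<not> (p \<in> W \<and> q \<in> W)"
  obtains m N1 D1 N2 D2 where "p \<le> m" "m < q" "plant p m N1 D1" "plant (m + 1) q N2 D2"
    "N = N1 \<union> N2" "D = insert (p, q) (D1 \<union> D2)"
proof -
  note A = plantD[OF P]
  obtain m where m: "p \<le> m" "m < q"
    and sep: "\<And>i j. (i, j) \<in> D \<Longrightarrow> (i, j) \<noteq> (p, q) \<Longrightarrow> j \<le> m \<or> m + 1 \<le> i"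
    using base_bridge[OF P pq nf] by metis
  have sepD: "(i, j) \<in> intv p m \<or> (i, j) \<in> intv (m + 1) q" if "(i, j) \<in> D" "(i, j) \<noteq> (p, q)" for i j
    using sep[OF that] that(1) A(2) by auto
  have sepN: "((i, j) \<in> intv p m \<or> (i, j) \<in> intv (m + 1) q) \<and> (i, j) \<noteq> (p, m) \<and> (i, j) \<noteq> (m + 1, q)"
    if ij: "(i, j) \<in> N" for i j
  proof -
    obtain W k l where W: "face D W" "k \<in> W" "l \<in> W" "(k, l) \<in> D" "k \<le> i" "i < j" "j \<le> l" "(k, l) \<noteq> (i, j)"
      by (rule numerator_below[OF P ij])
    then have "(k, l) \<noteq> (p, q)" using nf by auto
    then show ?thesis using sepD[of k l] W by auto
  qed
  define R where "R = (\<lambda>a b. (D - {(p, q)}) \<inter> intv a b)"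
  define M where "M = (\<lambda>a b. N \<inter> intv a b - {(a, b)})"
  have "linked (R p m) {p..m}"
  proof (rule linked_map[OF A(5), where f = "\<lambda>x. if x \<le> m then x else p"])
    fix i j assume ij: "(i, j) \<in> D"
    show "(if i \<le> m then i else p, if j \<le> m then j else p) \<in> (R p m \<union> (R p m)\<inverse>)\<^sup>*"
    proof (cases "(i, j) = (p, q)")
      case False
      then show ?thesis using sepD[OF ij False] ij by (auto simp: R_def)
    qed (use m in auto)
  qed (use m in auto)
  then have 1: "plant p m (M p m) (R p m)" unfolding R_def M_def
  proof (rule plant_restrict[OF P, rotated -1])
    fix i j assume "(i, j) \<in> D" "(i, j) \<noteq> (p, q)"
    then show "(i, j) \<in> intv p m \<or> j \<le> p \<or> m \<le> i" using sepD[of i j] by auto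
  qed (use m nf in auto)
  have "linked (R (m + 1) q) {m + 1..q}"
  proof (rule linked_map[OF A(5), where f = "\<lambda>x. if x \<le> m then q else x"])
    fix i j assume ij: "(i, j) \<in> D"
    show "(if i \<le> m then q else i, if j \<le> m then q else j)
        \<in> (R (m + 1) q \<union> (R (m + 1) q)\<inverse>)\<^sup>*"
    proof (cases "(i, j) = (p, q)")
      case False
      then show ?thesis using sepD[OF ij False] ij by (auto simp: R_def)
    qed (use m in auto)
  qed (use m in auto)
  then have 2: "plant (m + 1) q (M (m + 1) q) (R (m + 1) q)" unfolding R_def M_def
  proof (rule plant_restrict[OF P, rotated -1])
    fix i j assume "(i, j) \<in> D" "(i, j) \<noteq> (p, q)"
    then show "(i, j) \<in> intv (m + 1) q \<or> j \<le> m + 1 \<or> q \<le> i" using sepD[of i j] by auto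
  qed (use m nf in auto)
  have "N \<subseteq> intv p m \<union> intv (m + 1) q" by (rule subrelI) (use sepN in blast)
  moreover have "(p, m) \<notin> N" "(m + 1, q) \<notin> N" using sepN by blast+
  ultimately have "N = M p m \<union> M (m + 1) q" unfolding M_def by blast
  moreover have "D - {(p, q)} \<subseteq> intv p m \<union> intv (m + 1) q"
    by (rule subrelI) (use sepD in blast)
  then have "D = insert (p, q) (R p m \<union> R (m + 1) q)" unfolding R_def using pq by blast
  ultimately show ?thesis using that[OF m 1 2] by blast
qed

text \<open>
  A plant whose base bounds a face with numerator \<open>(r, t)\<close> consists of plants between \<open>p\<close>, \<open>r\<close>, \<open>t\<close>
  and \<open>q\<close>. Each piece is connected, because the boundary path of the face replaces the base.
\<close>

lemma plant_open:
  assumes P: "plant p q N D" and pq: "p < q" "(p, q) \<in> D"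
    and V: "face D V" "p \<in> V" "q \<in> V"
  obtains r t N1 D1 N2 D2 N3 D3 where "p \<le> r" "r + 2 \<le> t" "t \<le> q" "(r, t) \<noteq> (p, q)"
    "plant p r N1 D1" "plant r t N2 D2" "plant t q N3 D3" "(r, t) \<notin> D2"
    "N = insert (r, t) (N1 \<union> N2 \<union> N3)" "D = insert (p, q) (D1 \<union> D2 \<union> D3)"
proof -
  note A = plantD[OF P]
  have Vs: "W \<subseteq> {p..q}" if W: "face D W" for W
    by (rule face_within[OF W A(2)])
  obtain r t where rt: "(r, t) \<in> N" "r \<in> V" "t \<in> V"
    and uniq: "\<And>d. d \<in> N \<Longrightarrow> ends_in d V \<Longrightarrow> d = (r, t)"
    using A(7)[OF V(1)] by (metis ends_in_def prod.collapse)
  have rtD: "(r, t) \<notin> D" "p \<le> r" "r < t" "t \<le> q" using rt(1) A(1,3) by auto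
  have rt2: "r + 2 \<le> t"
  proof (rule ccontr)
    assume "\<not> r + 2 \<le> t"
    then have "V \<inter> {r<..<t} = {}" by auto
    then show False using face_edge[OF V(1) rt(2,3) rtD(3)] rtD(1) by simp
  qed
  have rtpq: "(r, t) \<noteq> (p, q)" using pq(2) rtD(1) by auto
  have base_only: "(i, j) = (p, q)" if "(i, j) \<in> D" "V \<inter> {i<..<j} \<noteq> {}" "i \<in> V" "j \<in> V" for i j
  proof -
    have ij: "p \<le> i" "i < j" "j \<le> q" using that(1) A(2) by auto
    have "V \<subseteq> {i..j}" using face_edge[OF V(1) that(3,4) ij(2)] that(1,2) by blast
    then show ?thesis using V(2,3) ij by auto
  qed
  \<comment> \<open>a diagonal that jumps over a vertex of the base face ends in the base face\<close>
  have jump: "i \<in> V \<and> j \<in> V" if ij: "(i, j) \<in> N \<union> D" and v: "v \<in> V" "i < v" "v < j" for i j v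
  proof (intro conjI; rule ccontr)
    have b: "p \<le> i" "j \<le> q" using ij A(1,2) by auto
    assume iV: "i \<notin> V"
    have "p < i" using iV V(2) b by (metis le_neq_implies_less)
    then obtain a b where "a < i" "i < b" "b \<le> v" "(a, b) \<in> D"
      using face_gap[OF V(1,2) _ v(1,2) iV] by metis
    then show False using A(4)[of "(i, j)" "(a, b)"] ij v by auto
  next
    have b: "p \<le> i" "j \<le> q" using ij A(1,2) by auto
    assume jV: "j \<notin> V"
    have "j < q" using jV V(3) b by (metis le_neq_implies_less)
    then obtain a b where "v \<le> a" "a < j" "j < b" "(a, b) \<in> D"
      using face_gap[OF V(1) v(1,3) V(3) _ jV] by metis
    then show False using A(4)[of "(i, j)" "(a, b)"] ij v by auto
  qed
  have nsD: "\<not> (i < v \<and> v < j)" if "(i, j) \<in> D" "(i, j) \<noteq> (p, q)" "v \<in> V" for i j v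
  proof
    assume v: "i < v \<and> v < j"
    then have "i \<in> V \<and> j \<in> V" "V \<inter> {i<..<j} \<noteq> {}" using jump[of i j v] that by auto
    then show False using base_only[OF that(1)] that(2) by blast
  qed
  have nsN: "\<not> (i < v \<and> v < j)" if "(i, j) \<in> N" "v = r \<or> v = t" for i j v
  proof
    assume v: "i < v \<and> v < j"
    then have "i \<in> V \<and> j \<in> V" using jump[of i j v] that rt by blast
    then have "(i, j) = (r, t)" using uniq that(1) by simp
    then show False using v that(2) by auto
  qed
  have sep3: "(i, j) \<in> intv p r \<or> (i, j) \<in> intv r t \<or> (i, j) \<in> intv t q"
    if "p \<le> i" "i < j" "j \<le> q" "\<not> (i < r \<and> r < j)" "\<not> (i < t \<and> t < j)" for i j
    using that by auto
  have sepD: "i < j \<and> ((i, j) \<in> intv p r \<or> (i, j) \<in> intv r t \<or> (i, j) \<in> intv t q)"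
    if "(i, j) \<in> D" "(i, j) \<noteq> (p, q)" for i j
    using sep3[of i j] nsD[OF that rt(2)] nsD[OF that rt(3)] that(1) A(2) by auto
  have sepN: "(i, j) \<in> intv p r \<or> (i, j) \<in> intv r t \<or> (i, j) \<in> intv t q" if "(i, j) \<in> N" for i j
    using sep3[of i j] nsN[OF that, of r] nsN[OF that, of t] that(1) A(1) by auto
  have faceV: "W = V" if W: "face D W" "p \<in> W" "q \<in> W" for W
  proof -
    have VW: "V \<subseteq> W"
    proof
      fix v assume v: "v \<in> V"
      show "v \<in> W"
      proof (rule ccontr)
        assume vW: "v \<notin> W"
        have "v \<in> {p..q}" using v Vs[OF V(1)] by auto
        then have "p < v" "v < q" using vW W by (auto simp: order.strict_iff_order)
        then obtain a b where ab: "a < v" "v < b" "W \<inter> {a<..<b} = {}" "(a, b) \<in> D"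
          using face_gap[OF W(1,2) _ W(3) _ vW] by metis
        then have "(a, b) = (p, q)" using nsD v by blast
        moreover obtain w where "w \<in> W" "w \<noteq> p" "w \<noteq> q" by (rule face_third[OF W(1)])
        moreover have "w \<in> {p..q}" if "w \<in> W" for w using that Vs[OF W(1)] by auto
        ultimately show False using ab(3) by (auto simp: order.strict_iff_order)
      qed
    qed
    moreover have "W \<subseteq> V"
    proof
      fix v assume v: "v \<in> W"
      show "v \<in> V"
      proof (rule ccontr)
        assume vV: "v \<notin> V"
        have "v \<in> {p..q}" using v Vs[OF W(1)] by auto
        then have "p < v" "v < q" using vV V by (auto simp: order.strict_iff_order)
        then obtain a b where ab: "a \<in> V" "b \<in> V" "a < v" "v < b" "V \<inter> {a<..<b} = {}" "(a, b) \<in> D"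
          using face_gap[OF V(1,2) _ V(3) _ vV] by metis
        have "a \<in> W" "b \<in> W" using ab VW by auto
        then have "W \<inter> {a<..<b} = {} \<or> W \<subseteq> {a..b}" using face_edge[OF W(1), of a b] ab by auto
        then have "W \<subseteq> {a..b}" using v ab(3,4) by auto
        moreover have "a \<in> {p..q}" "b \<in> {p..q}" using ab Vs[OF V(1)] by auto
        ultimately have "a = p" "b = q" using W(2,3) by auto
        moreover obtain w where "w \<in> V" "w \<noteq> p" "w \<noteq> q" by (rule face_third[OF V(1)])
        moreover have "w \<in> {p..q}" if "w \<in> V" for w using that Vs[OF V(1)] by auto
        ultimately show False using ab(5) by (auto simp: order.strict_iff_order)
      qed
    qed
    ultimately show ?thesis by simp
  qed
  define R where "R = (\<lambda>a b. (D - {(p, q)}) \<inter> intv a b)"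
  define M where "M = (\<lambda>a b. N \<inter> intv a b - {(a, b)})"
  have piece: "plant a b (M a b) (R a b)"
    if ab: "a \<in> V" "b \<in> V" "a \<le> b" "(a, b) \<noteq> (p, q)" and rtab: "(r, t) \<notin> intv a b - {(a, b)}"
      and sep: "\<And>i j. (i, j) \<in> D \<Longrightarrow> (i, j) \<noteq> (p, q) \<Longrightarrow>
        (i, j) \<in> intv a b \<or> (i < j \<and> j \<le> a) \<or> (b \<le> i \<and> i < j)" for a b
  proof -
    have abpq: "p \<le> a" "b \<le> q" using ab Vs[OF V(1)] by auto
    have "(a, b) \<in> (R a b)\<^sup>*"
    proof (rule path_linked[OF face_finite[OF V(1)], where a = a and b = b])
      fix i j assume ij: "i \<in> V" "j \<in> V" "i < j" "V \<inter> {i<..<j} = {}" "a \<le> i" "j \<le> b"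
      then show "(i, j) \<in> R a b"
        using face_edge[OF V(1), of i j] ab(4) abpq by (auto simp: R_def)
    qed (use ab in auto)
    then have link: "(a, b) \<in> (R a b \<union> (R a b)\<inverse>)\<^sup>*" using rtrancl_mono[of "R a b"] by blast
    have "linked (R a b) {a..b}" unfolding R_def
    proof (rule linked_clamp[OF A(5)])
      fix i j assume "(i, j) \<in> D" "(i, j) \<noteq> (p, q)"
      then show "(i, j) \<in> intv a b \<or> i < j \<and> j \<le> a \<or> b \<le> i \<and> i < j" by (rule sep)
    qed (use abpq ab link in \<open>auto simp: R_def\<close>)
    then show ?thesis unfolding R_def M_def
    proof (rule plant_restrict[OF P, rotated -1])
      fix i j assume "(i, j) \<in> D" "(i, j) \<noteq> (p, q)"
      then show "(i, j) \<in> intv a b \<or> j \<le> a \<or> b \<le> i" using sep[of i j] by auto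
    next
      fix W d assume "face D W" "p \<in> W" "q \<in> W" "ends_in d W"
      then show "d \<notin> N \<inter> intv a b - {(a, b)}" using faceV[of W] uniq[of d] rtab by auto
    qed (use abpq ab in auto)
  qed
  have 1: "plant p r (M p r) (R p r)"
  proof (rule piece)
    show "(i, j) \<in> intv p r \<or> i < j \<and> j \<le> p \<or> r \<le> i \<and> i < j"
      if "(i, j) \<in> D" "(i, j) \<noteq> (p, q)" for i j using sepD[OF that] rtD by auto
  qed (use V rt rtD in auto)
  have 2: "plant r t (M r t) (R r t)"
  proof (rule piece)
    show "(i, j) \<in> intv r t \<or> i < j \<and> j \<le> r \<or> t \<le> i \<and> i < j"
      if "(i, j) \<in> D" "(i, j) \<noteq> (p, q)" for i j using sepD[OF that] rtD by auto
  qed (use V rt rtD rtpq in auto)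
  have 3: "plant t q (M t q) (R t q)"
  proof (rule piece)
    show "(i, j) \<in> intv t q \<or> i < j \<and> j \<le> t \<or> q \<le> i \<and> i < j"
      if "(i, j) \<in> D" "(i, j) \<noteq> (p, q)" for i j using sepD[OF that] rtD by auto
  qed (use V rt rtD in auto)
  have nN: "(p, r) \<notin> N" "(t, q) \<notin> N" using uniq[of "(p, r)"] uniq[of "(t, q)"] V rt rtD by auto
  have "N \<subseteq> intv p r \<union> intv r t \<union> intv t q" by (rule subrelI) (use sepN in blast)
  then have "N = insert (r, t) (M p r \<union> M r t \<union> M t q)"
    unfolding M_def using nN rt(1) by blast
  moreover have "D - {(p, q)} \<subseteq> intv p r \<union> intv r t \<union> intv t q"
    by (rule subrelI) (use sepD in blast)
  then have "D = insert (p, q) (R p r \<union> R r t \<union> R t q)" unfolding R_def using pq by blast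
  moreover have "(r, t) \<notin> R r t" using rtD by (simp add: R_def)
  ultimately show ?thesis using that[OF rtD(2) rt2 rtD(4) rtpq 1 2 3] by blast
qed

section \<open>Geometry of the regular polygon\<close>

text \<open>Twice the signed area of a triangle.\<close>

definition orient :: "complex \<Rightarrow> complex \<Rightarrow> complex \<Rightarrow> real" where
  "orient a b c = Im (cnj (b - a) * (c - a))"

lemma orient_coords:
  "orient a b c = (Re b - Re a) * (Im c - Im a) - (Im b - Im a) * (Re c - Re a)"
  by (simp add: orient_def algebra_simps)

lemma orient_rotate: "orient b c a = orient a b c"
  by (simp add: orient_coords algebra_simps)

lemma orient_swap: "orient a c b = - orient a b c"
  by (simp add: orient_coords algebra_simps)

lemma orient_degenerate [simp]: "orient a b a = 0" "orient a b b = 0"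
  by (simp_all add: orient_coords)

lemma orient_affine:
  "orient a b ((1 - u) *\<^sub>R c + u *\<^sub>R d) = (1 - u) * orient a b c + u * orient a b d"
  by (simp add: orient_coords algebra_simps)

lemma sin_sum_minus: "sin (2 * x) + sin (2 * y) - sin (2 * (x + y)) = 4 * sin x * sin y * sin (x + y :: real)"
proof -
  have c: "cos x ^ 2 = 1 - sin x ^ 2" "cos y ^ 2 = 1 - sin y ^ 2" by (simp_all add: cos_squared_eq)
  show ?thesis unfolding sin_double sin_add cos_add using c by algebra
qed

lemma orient_cis:
  "orient (cis \<alpha>) (cis \<beta>) (cis \<gamma>)
    = 4 * sin ((\<beta> - \<alpha>) / 2) * sin ((\<gamma> - \<beta>) / 2) * sin ((\<gamma> - \<alpha>) / 2)"
proof -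
  have "orient (cis \<alpha>) (cis \<beta>) (cis \<gamma>) = sin (\<beta> - \<alpha>) + sin (\<gamma> - \<beta>) - sin (\<gamma> - \<alpha>)"
    by (simp add: orient_coords sin_diff algebra_simps)
  moreover define x y where "x = (\<beta> - \<alpha>) / 2" and "y = (\<gamma> - \<beta>) / 2"
  moreover have "\<beta> - \<alpha> = 2 * x" "\<gamma> - \<beta> = 2 * y" "\<gamma> - \<alpha> = 2 * (x + y)" "(\<gamma> - \<alpha>) / 2 = x + y"
    by (simp_all add: x_def y_def field_simps)
  ultimately show ?thesis using sin_sum_minus[of x y] by metis
qed

lemma orient_vertex:
  assumes "i < j" "j < k" "k \<le> n"
  shows "orient (vertex n i) (vertex n j) (vertex n k) < 0"
proof -
  have neg: "sin ((- (2 * pi * real b / real (n + 1)) - - (2 * pi * real a / real (n + 1))) / 2) < 0"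
    if "a < b" "b \<le> n" for a b
  proof -
    define x where "x = pi * (real b - real a) / real (n + 1)"
    have "0 < x" using that by (simp add: x_def)
    moreover have "x < pi"
    proof -
      have "(real b - real a) / real (n + 1) < 1" using that by (simp add: field_simps)
      then have "pi * ((real b - real a) / real (n + 1)) < pi * 1"
        by (intro mult_strict_left_mono) auto
      then show ?thesis by (simp add: x_def)
    qed
    ultimately have "sin x > 0" by (rule sin_gt_zero)
    moreover have "(- (2 * pi * B / N) - - (2 * pi * A / N)) / 2 = - (pi * (B - A) / N)" for A B N :: real
      by (cases "N = 0") (simp_all add: field_simps)
    then have "(- (2 * pi * real b / real (n + 1)) - - (2 * pi * real a / real (n + 1))) / 2 = - x"
      unfolding x_def .
    ultimately show ?thesis by simp
  qed
  have "4 * (s * t * u) < 0" if "s < 0" "t < 0" "u < 0" for s t u :: real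
    using that mult_pos_neg[OF mult_neg_neg[OF that(1,2)] that(3)] by simp
  then show ?thesis
    unfolding vertex_def orient_cis using neg[of i j] neg[of j k] neg[of i k] assms
    by (simp only: mult.assoc)
qed

lemma norm_vertex [simp]: "norm (vertex n k) = 1"
  by (simp add: vertex_def)

lemma vertex_inj:
  assumes "i \<le> n" "j \<le> n" "n \<ge> 2" "vertex n i = vertex n j"
  shows "i = j"
proof (rule ccontr)
  assume "i \<noteq> j"
  have *: False if ij: "i < j" "j \<le> n" "vertex n i = vertex n j" for i j
  proof -
    obtain k where k: "k \<le> n" "k \<noteq> i" "k \<noteq> j"
    proof -
      have "card {i, j} < card {0..n}" using assms(3) ij by simp
      then have "\<not> {0..n} \<subseteq> {i, j}" using card_mono[of "{i, j}" "{0..n}"] by auto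
      then obtain k where "k \<in> {0..n}" "k \<notin> {i, j}" by blast
      then show ?thesis using that[of k] by simp
    qed
    have z: "orient (vertex n i) (vertex n j) (vertex n k) = 0"
      using ij(3) by (simp add: orient_coords)
    consider "k < i" | "i < k" "k < j" | "j < k" using k by linarith
    then show False
    proof cases
      case 1
      then show False using orient_vertex[of k i j n] ij z
        orient_rotate[of "vertex n i" "vertex n j" "vertex n k"] by simp
    next
      case 2
      then show False using orient_vertex[of i k j n] ij z
        orient_swap[of "vertex n i" "vertex n j" "vertex n k"] by simp
    next
      case 3
      then show False using orient_vertex[of i j k n] k ij z by simp
    qed
  qed
  show False using *[of i j] *[of j i] assms \<open>i \<noteq> j\<close> by (metis linorder_neqE_nat)
qed

text \<open>Points of the unit circle are extreme points of the disk.\<close>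

lemma hull_unit:
  assumes "S \<subseteq> cball 0 1" "z \<in> convex hull S" "norm z = 1"
  shows "z \<in> (S :: complex set)"
proof -
  have sub: "convex hull S \<subseteq> cball 0 1" using assms(1) by (simp add: hull_minimal)
  have le: "inner z x \<le> 1" if "x \<in> convex hull S" for x
    using norm_cauchy_schwarz[of z x] that sub assms(3) by (auto intro: order_trans)
  have eq: "x = z" if "x \<in> convex hull S" "inner z x = 1" for x
  proof -
    have "norm (x - z) ^ 2 = norm x ^ 2 - 2 * inner z x + norm z ^ 2"
      by (simp add: power2_norm_eq_inner inner_diff inner_commute)
    also have "\<dots> \<le> 0" using that sub assms(3) by (auto simp: power_le_one)
    finally show ?thesis by simp
  qed
  have "z extreme_point_of (convex hull S)"
  proof (rule extreme_point_of_Int_supporting_hyperplane_le)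
    show "convex hull S \<inter> {x. inner z x = 1} = {z}"
      using eq assms(2,3) by (auto simp: norm_eq_1)
  qed (rule le)
  then show ?thesis by (rule extreme_point_of_convex_hull)
qed

lemma vertex_in_hull:
  assumes "n \<ge> 2" "k \<le> n" "S \<subseteq> {0..n}"
  shows "vertex n k \<in> convex hull (vertex n ` S) \<longleftrightarrow> k \<in> S"
proof
  assume "vertex n k \<in> convex hull (vertex n ` S)"
  then have "vertex n k \<in> vertex n ` S" by (rule hull_unit[rotated]) auto
  then show "k \<in> S" using vertex_inj[OF assms(2) _ assms(1)] assms(3) by auto
qed (simp add: hull_inc)

lemma seg_subset_region:
  assumes "n \<ge> 2" "d \<in> diagonals n" "set ws \<subseteq> {0..n}"
  shows "seg n d \<subseteq> region n ws \<longleftrightarrow> ends_in d (set ws)"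
proof -
  have "seg n d \<subseteq> region n ws \<longleftrightarrow> vertex n (fst d) \<in> region n ws \<and> vertex n (snd d) \<in> region n ws"
    unfolding seg_def region_def by (auto intro: subsetD[OF closed_segment_subset])
  then show ?thesis
    using assms vertex_in_hull[OF assms(1) _ assms(3)]
    by (auto simp: region_def ends_in_def diagonals_def)
qed

lemma collinear_real:
  fixes a1 a2 x1 x2 y1 y2 z1 z2 b :: real
  assumes "a1 * x1 + a2 * x2 = b" "a1 * y1 + a2 * y2 = b" "a1 * z1 + a2 * z2 = b"
  shows "a1 * ((y1 - x1) * (z2 - x2) - (y2 - x2) * (z1 - x1)) = 0"
    "a2 * ((y1 - x1) * (z2 - x2) - (y2 - x2) * (z1 - x1)) = 0"
proof -
  have d: "a1 * (y1 - x1) = - (a2 * (y2 - x2))" "a1 * (z1 - x1) = - (a2 * (z2 - x2))"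
    using assms by (simp_all add: algebra_simps)
  have "a1 * ((y1 - x1) * (z2 - x2) - (y2 - x2) * (z1 - x1))
      = (a1 * (y1 - x1)) * (z2 - x2) - (y2 - x2) * (a1 * (z1 - x1))" by (simp add: algebra_simps)
  then show "a1 * ((y1 - x1) * (z2 - x2) - (y2 - x2) * (z1 - x1)) = 0" unfolding d by simp
  have "a2 * ((y1 - x1) * (z2 - x2) - (y2 - x2) * (z1 - x1))
      = (y1 - x1) * (a2 * (z2 - x2)) - (a2 * (y2 - x2)) * (z1 - x1)" by (simp add: algebra_simps)
  moreover have "a2 * (y2 - x2) = - (a1 * (y1 - x1))" "a2 * (z2 - x2) = - (a1 * (z1 - x1))"
    using d by simp_all
  ultimately show "a2 * ((y1 - x1) * (z2 - x2) - (y2 - x2) * (z1 - x1)) = 0" by simp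
qed

lemma collinear_orient:
  fixes a A B C :: complex
  assumes "a \<noteq> 0" "inner a A = b" "inner a B = b" "inner a C = b"
  shows "orient A B C = 0"
proof -
  have "Re a * Re A + Im a * Im A = b" "Re a * Re B + Im a * Im B = b" "Re a * Re C + Im a * Im C = b"
    using assms by (simp_all add: inner_complex_def)
  note e = this
  have "Re a * orient A B C = 0" "Im a * orient A B C = 0"
    unfolding orient_coords using collinear_real[OF e] by simp_all
  then show ?thesis using assms(1) by (auto simp: complex_eq_iff)
qed

text \<open>
  A point in the relative interior of two crossing segments of a convex set is in the interior: a
  supporting line at this point would have to contain all four end points.
\<close>

lemma interior_crossing:
  fixes A B C D :: complex
  assumes S: "convex S" "A \<in> S" "B \<in> S" "C \<in> S" "D \<in> S" and ABC: "orient A B C \<noteq> 0"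
    and u: "0 < u" "u < 1" "p = (1 - u) *\<^sub>R A + u *\<^sub>R C"
    and w: "0 < w" "w < 1" "p = (1 - w) *\<^sub>R B + w *\<^sub>R D"
  shows "p \<in> interior S"
proof (rule ccontr)
  assume ni: "p \<notin> interior S"
  have p: "p \<in> S" unfolding u(3) using S u by (intro convexD) auto
  have "\<exists>a. a \<noteq> 0 \<and> (\<forall>y\<in>S. inner a p \<le> inner a y)"
  proof (cases "interior S = {}")
    case True
    then obtain a b where "a \<noteq> 0" "S \<subseteq> {x. inner a x = b}"
      using empty_interior_subset_hyperplane[OF S(1)] by metis
    then have "inner a y = b" if "y \<in> S" for y using that by auto
    then show ?thesis using p \<open>a \<noteq> 0\<close> by (intro exI[of _ a]) simp
  next
    case False
    then have "p \<notin> rel_interior S" using ni rel_interior_nonempty_interior by blast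
    then show ?thesis using supporting_hyperplane_rel_boundary[OF S(1) p] by metis
  qed
  then obtain a where a: "a \<noteq> 0" "\<And>y. y \<in> S \<Longrightarrow> inner a p \<le> inner a y" by blast
  have eq: "inner a X = inner a p \<and> inner a Y = inner a p"
    if XY: "X \<in> S" "Y \<in> S" "p = (1 - v) *\<^sub>R X + v *\<^sub>R Y" "0 < v" "v < 1" for X Y v
  proof -
    have "(1 - v) * (inner a X - inner a p) + v * (inner a Y - inner a p) = 0"
      using arg_cong[OF XY(3), of "inner a"] by (simp add: inner_add_right algebra_simps)
    moreover have "(1 - v) * (inner a X - inner a p) \<ge> 0" "v * (inner a Y - inner a p) \<ge> 0"
      using a(2) XY by simp_all
    ultimately have "(1 - v) * (inner a X - inner a p) = 0" "v * (inner a Y - inner a p) = 0"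
      by linarith+
    then show ?thesis using XY by simp
  qed
  have "orient A B C = 0"
    using eq[OF S(2,4) u(3,1,2)] eq[OF S(3,5) w(3,1,2)] by (intro collinear_orient[OF a(1)]) auto
  then show False using ABC by simp
qed

lemma interlaced_cross:
  assumes "i < k" "k < j" "j < l" "l \<le> n"
  shows "seg n (i, j) \<inter> seg n (k, l) \<inter> interior (polygon n) \<noteq> {}"
proof -
  let ?A = "vertex n i" and ?B = "vertex n k" and ?C = "vertex n j" and ?D = "vertex n l"
  \<comment> \<open>the linear relation between four points of the plane, whose coefficients are triangle areas\<close>
  define \<alpha> \<beta> \<gamma> \<delta> where "\<alpha> = - orient ?B ?C ?D" and "\<beta> = - orient ?A ?C ?D"
    and "\<gamma> = - orient ?A ?B ?D" and "\<delta> = - orient ?A ?B ?C"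
  note defs = \<alpha>_def \<beta>_def \<gamma>_def \<delta>_def
  have pos: "\<alpha> > 0" "\<beta> > 0" "\<gamma> > 0" "\<delta> > 0"
    unfolding defs using assms by (simp_all add: orient_vertex)
  have s: "\<alpha> + \<gamma> = \<beta> + \<delta>" unfolding defs orient_coords by (simp add: algebra_simps)
  have e: "\<alpha> *\<^sub>R ?A + \<gamma> *\<^sub>R ?C = \<beta> *\<^sub>R ?B + \<delta> *\<^sub>R ?D"
    unfolding defs orient_coords complex_eq_iff by (simp add: algebra_simps)
  define u w where "u = \<gamma> / (\<alpha> + \<gamma>)" and "w = \<delta> / (\<beta> + \<delta>)"
  have u: "0 < u" "u < 1" "1 - u = \<alpha> / (\<alpha> + \<gamma>)" and w: "0 < w" "w < 1" "1 - w = \<beta> / (\<alpha> + \<gamma>)" "w = \<delta> / (\<alpha> + \<gamma>)"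
    using pos s by (auto simp: u_def w_def field_simps)
  define p where "p = (1 - u) *\<^sub>R ?A + u *\<^sub>R ?C"
  have p1: "p = (1 / (\<alpha> + \<gamma>)) *\<^sub>R (\<alpha> *\<^sub>R ?A + \<gamma> *\<^sub>R ?C)"
    unfolding p_def u(3) by (simp add: u_def scaleR_add_right)
  have p2: "p = (1 - w) *\<^sub>R ?B + w *\<^sub>R ?D"
    unfolding p1 e w(3) by (subst w(4)) (simp add: scaleR_add_right)
  have "p \<in> interior (polygon n)"
  proof (rule interior_crossing[OF _ _ _ _ _ _ u(1,2) p_def w(1,2) p2])
    show "?A \<in> polygon n" "?B \<in> polygon n" "?C \<in> polygon n" "?D \<in> polygon n"
      unfolding polygon_def using assms by (auto intro!: hull_inc)
    show "convex (polygon n)" by (simp add: polygon_def)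
    show "orient ?A ?B ?C \<noteq> 0" using orient_vertex[of i k j n] assms by simp
  qed
  moreover have "p \<in> seg n (i, j)"
    unfolding seg_def closed_segment_def using p_def u(1,2) by (auto intro!: exI[of _ u])
  moreover have "p \<in> seg n (k, l)"
    unfolding seg_def closed_segment_def using p2 w(1,2) by (auto intro!: exI[of _ w])
  ultimately show ?thesis by blast
qed

lemma interior_polygon_norm: "p \<in> interior (polygon n) \<Longrightarrow> norm p < 1"
proof -
  assume "p \<in> interior (polygon n)"
  moreover have "polygon n \<subseteq> cball 0 1" unfolding polygon_def by (rule hull_minimal) auto
  then have "interior (polygon n) \<subseteq> interior (cball 0 1)" by (rule interior_mono)
  ultimately have "p \<in> ball 0 1" by auto
  then show ?thesis by simp
qed

lemma orient_vertex_sign: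
  assumes "i < j" "j \<le> n" "k \<le> n"
  shows "i \<le> k \<Longrightarrow> k \<le> j \<Longrightarrow> orient (vertex n i) (vertex n j) (vertex n k) \<ge> 0"
    "\<not> (i < k \<and> k < j) \<Longrightarrow> orient (vertex n i) (vertex n j) (vertex n k) \<le> 0"
    "orient (vertex n i) (vertex n j) (vertex n k) = 0 \<longleftrightarrow> k = i \<or> k = j"
proof -
  let ?o = "orient (vertex n i) (vertex n j) (vertex n k)"
  consider "k = i \<or> k = j" | "k < i" | "i < k" "k < j" | "j < k" by linarith
  then have "(k = i \<or> k = j) \<and> ?o = 0 \<or> (i < k \<and> k < j) \<and> ?o > 0 \<or> (k < i \<or> j < k) \<and> ?o < 0"
  proof cases
    case 1 then show ?thesis by auto
  next
    case 2
    then show ?thesis using orient_vertex[of k i j n] assms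
        orient_rotate[of "vertex n i" "vertex n j" "vertex n k"] by simp
  next
    case 3
    then show ?thesis using orient_vertex[of i k j n] assms
        orient_swap[of "vertex n i" "vertex n j" "vertex n k"] by simp
  next
    case 4
    then show ?thesis using orient_vertex[of i j k n] assms by simp
  qed
  then show "i \<le> k \<Longrightarrow> k \<le> j \<Longrightarrow> ?o \<ge> 0" "\<not> (i < k \<and> k < j) \<Longrightarrow> ?o \<le> 0"
    "?o = 0 \<longleftrightarrow> k = i \<or> k = j" using assms(1) by auto
qed

text \<open>
  If the end points do not alternate, then the end points of the second diagonal lie on one side of
  the first one. A common point is then an end point, and hence is not in the interior.
\<close>

lemma crossing_iff_interlaced:
  assumes "d \<in> diagonals n" "e \<in> diagonals n"
  shows "crossing n d e \<longleftrightarrow> interlaced d e"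
proof
  obtain i j k l where [simp]: "d = (i, j)" "e = (k, l)" by (cases d, cases e)
  have le: "i < j" "j \<le> n" "k < l" "l \<le> n" using assms by (auto simp: diagonals_def)
  { assume "interlaced d e"
    then show "crossing n d e"
      using interlaced_cross[of i k j l n] interlaced_cross[of k i l j n] le
      by (auto simp: crossing_def) }
  assume "crossing n d e"
  then obtain p where p: "p \<in> seg n d" "p \<in> seg n e" "norm p < 1" and ne: "d \<noteq> e"
    using interior_polygon_norm by (auto simp: crossing_def)
  let ?s = "orient (vertex n i) (vertex n j)"
  obtain u where u: "p = (1 - u) *\<^sub>R vertex n i + u *\<^sub>R vertex n j"
    using p(1) by (auto simp: seg_def closed_segment_def)
  obtain w where w: "0 \<le> w" "w \<le> 1" "p = (1 - w) *\<^sub>R vertex n k + w *\<^sub>R vertex n l"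
    using p(2) by (auto simp: seg_def closed_segment_def)
  have w01: "w \<noteq> 0" "w \<noteq> 1" using w(3) p(3) by auto
  have "?s p = 0" unfolding u orient_affine by simp
  then have z: "(1 - w) * ?s (vertex n k) + w * ?s (vertex n l) = 0"
    unfolding w(3) orient_affine .
  show "interlaced d e"
  proof (rule ccontr)
    assume ni: "\<not> interlaced d e"
    have kl: "k \<le> n" "l \<le> n" using le by auto
    have "?s (vertex n k) \<ge> 0 \<and> ?s (vertex n l) \<ge> 0 \<or> ?s (vertex n k) \<le> 0 \<and> ?s (vertex n l) \<le> 0"
    proof (cases "i \<le> k \<and> l \<le> j")
      case True
      then show ?thesis
        using orient_vertex_sign(1)[OF le(1,2) kl(1)] orient_vertex_sign(1)[OF le(1,2) kl(2)] le by simp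
    next
      case False
      then have "\<not> (i < k \<and> k < j)" "\<not> (i < l \<and> l < j)" using ni le by auto
      then have "?s (vertex n k) \<le> 0" "?s (vertex n l) \<le> 0"
        using orient_vertex_sign(2)[OF le(1,2) kl(1)] orient_vertex_sign(2)[OF le(1,2) kl(2)] by simp_all
      then show ?thesis by simp
    qed
    then have "(1 - w) * ?s (vertex n k) = 0 \<and> w * ?s (vertex n l) = 0"
    proof
      assume "?s (vertex n k) \<ge> 0 \<and> ?s (vertex n l) \<ge> 0"
      then have "(1 - w) * ?s (vertex n k) \<ge> 0" "w * ?s (vertex n l) \<ge> 0" using w(1,2) by simp_all
      then show ?thesis using z by linarith
    next
      assume "?s (vertex n k) \<le> 0 \<and> ?s (vertex n l) \<le> 0"
      then have "(1 - w) * ?s (vertex n k) \<le> 0" "w * ?s (vertex n l) \<le> 0"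
        using w(1,2) by (simp_all add: mult_nonneg_nonpos)
      then show ?thesis using z by linarith
    qed
    then have "?s (vertex n k) = 0" "?s (vertex n l) = 0" using w01 by auto
    then have "k = i \<or> k = j" "l = i \<or> l = j"
      using orient_vertex_sign(3)[OF le(1,2) kl(1)] orient_vertex_sign(3)[OF le(1,2) kl(2)] by auto
    then show False using ne le by auto
  qed
qed

subsection \<open>Closed cycles and faces\<close>

lemma cycle_edgesI:
  "t < length ws \<Longrightarrow> (min (ws ! t) (ws ! ((t + 1) mod length ws)), max (ws ! t) (ws ! ((t + 1) mod length ws)))
    \<in> cycle_edges ws"
  unfolding cycle_edges_def by blast

lemma cycle_edges_rotate: "cycle_edges (rotate i ws) \<subseteq> cycle_edges ws"
proof
  fix e assume "e \<in> cycle_edges (rotate i ws)"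
  then obtain t where t: "t < length ws" "e = (min (rotate i ws ! t) (rotate i ws ! ((t + 1) mod length ws)),
      max (rotate i ws ! t) (rotate i ws ! ((t + 1) mod length ws)))"
    by (auto simp: cycle_edges_def)
  let ?m = "length ws"
  have "?m > 0" using t by auto
  then have "rotate i ws ! t = ws ! ((i + t) mod ?m)"
    "rotate i ws ! ((t + 1) mod ?m) = ws ! (((i + t) mod ?m + 1) mod ?m)"
    using t by (simp_all add: nth_rotate mod_simps add.assoc)
  moreover have "(i + t) mod ?m < ?m" using \<open>?m > 0\<close> by simp
  ultimately show "e \<in> cycle_edges ws" unfolding t(2) cycle_edges_def by auto
qed

lemma is_cycle_rotate: "is_cycle D ws \<Longrightarrow> is_cycle D (rotate i ws)"
  using cycle_edges_rotate[of i ws] by (auto simp: is_cycle_def)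

text \<open>
  In a cycle of non-crossing diagonals, all other vertices lie on one side of each edge: they are
  visited by a walk that cannot cross this edge.
\<close>

lemma cycle_edge_separates:
  assumes cyc: "is_cycle D ws" and nc: "\<And>d e. d \<in> D \<Longrightarrow> e \<in> D \<Longrightarrow> \<not> interlaced d e"
    and e: "(a, b) \<in> cycle_edges ws"
  shows "set ws \<inter> {a<..<b} = {} \<or> set ws \<subseteq> {a..b}"
proof -
  obtain i where i: "i < length ws" "a = min (ws ! i) (ws ! ((i + 1) mod length ws))"
    "b = max (ws ! i) (ws ! ((i + 1) mod length ws))"
    using e by (auto simp: cycle_edges_def)
  define xs where "xs = rotate i ws"
  let ?m = "length ws"
  have xs: "is_cycle D xs" "length xs = ?m" "set xs = set ws" "distinct xs" "?m \<ge> 3"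
    using is_cycle_rotate[OF cyc, of i] cyc by (auto simp: xs_def is_cycle_def)
  have "xs ! 0 = ws ! ((i + 0) mod ?m)" "xs ! 1 = ws ! ((i + 1) mod ?m)"
  proof -
    have l: "0 < ?m" "1 < ?m" using xs(5) by linarith+
    show "xs ! 0 = ws ! ((i + 0) mod ?m)" "xs ! 1 = ws ! ((i + 1) mod ?m)"
      unfolding xs_def by (rule nth_rotate[OF l(1)], rule nth_rotate[OF l(2)])
  qed
  then have ab: "a = min (xs ! 0) (xs ! 1)" "b = max (xs ! 0) (xs ! 1)" using i by simp_all
  have abD: "(a, b) \<in> D" using e cyc by (auto simp: is_cycle_def)
  have edge: "(min (xs ! t) (xs ! (t + 1)), max (xs ! t) (xs ! (t + 1))) \<in> D" if "t + 1 < ?m" for t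
  proof -
    have "(min (xs ! t) (xs ! (t + 1)), max (xs ! t) (xs ! (t + 1))) \<in> cycle_edges xs"
      using cycle_edgesI[of t xs] that xs(2) by simp
    then show ?thesis using xs(1) by (auto simp: is_cycle_def)
  qed
  have dist: "xs ! t \<noteq> a" "xs ! t \<noteq> b" if "2 \<le> t" "t < ?m" for t
  proof -
    have l: "0 < length xs" "1 < length xs" "t < length xs" using that xs(2) by linarith+
    have "xs ! t \<noteq> xs ! 0" "xs ! t \<noteq> xs ! 1"
      unfolding nth_eq_iff_index_eq[OF xs(4) l(3,1)] nth_eq_iff_index_eq[OF xs(4) l(3,2)]
      using that by auto
    then show "xs ! t \<noteq> a" "xs ! t \<noteq> b" unfolding ab by (simp_all add: min_def max_def)
  qed
  define P where "P = (\<lambda>z. a < z \<and> z < b)"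
  have stepP: "P (xs ! t) \<longleftrightarrow> P (xs ! (t + 1))" if t: "2 \<le> t" "t + 1 < ?m" for t
  proof -
    have key: "P u \<longleftrightarrow> P v"
      if "u \<le> v" "u \<noteq> a" "u \<noteq> b" "v \<noteq> a" "v \<noteq> b" "\<not> interlaced (u, v) (a, b)" for u v
      using that by (auto simp: P_def)
    have ni: "\<not> interlaced (min (xs ! t) (xs ! (t + 1)), max (xs ! t) (xs ! (t + 1))) (a, b)"
      by (rule nc[OF edge[OF t(2)] abD])
    have d: "xs ! t \<noteq> a" "xs ! t \<noteq> b" "xs ! (t + 1) \<noteq> a" "xs ! (t + 1) \<noteq> b"
      using dist[of t] dist[of "t + 1"] t by auto
    show ?thesis
    proof (cases "xs ! t \<le> xs ! (t + 1)")
      case True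
      then show ?thesis using key[OF True d] ni by (simp add: min_absorb1 max_absorb2 del: interlaced_iff)
    next
      case False
      then have le: "xs ! (t + 1) \<le> xs ! t" by simp
      then show ?thesis using key[OF le d(3,4,1,2)] ni by (simp add: min_absorb2 max_absorb1 del: interlaced_iff)
    qed
  qed
  have const: "P (xs ! t) \<longleftrightarrow> P (xs ! 2)" if "2 \<le> t" "t < ?m" for t
    using that
  proof (induction t rule: dec_induct)
    case (step t)
    have "P (xs ! t) = P (xs ! 2)" using step.prems by (intro step.IH) simp
    moreover have "P (xs ! t) = P (xs ! (t + 1))" using step by (intro stepP) simp_all
    ultimately show ?case by simp
  qed simp
  have mem: "z = xs ! 0 \<or> z = xs ! 1 \<or> (\<exists>t\<ge>2. t < ?m \<and> z = xs ! t)" if "z \<in> set ws" for z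
  proof -
    have "z \<in> set xs" using that xs(3) by simp
    then obtain t where "t < length xs" "xs ! t = z" unfolding in_set_conv_nth by (elim exE conjE)
    then have "t < ?m" "z = xs ! t" using xs(2) by simp_all
    moreover have "t = 0 \<or> t = 1 \<or> t \<ge> 2" by linarith
    ultimately show ?thesis by blast
  qed
  show ?thesis
  proof (cases "P (xs ! 2)")
    case True
    have "xs ! 0 \<in> {a..b}" "xs ! 1 \<in> {a..b}" by (auto simp: ab)
    moreover have "xs ! t \<in> {a..b}" if "2 \<le> t" "t < ?m" for t
      using const[OF that] True by (simp add: P_def)
    ultimately have "z \<in> {a..b}" if "z \<in> set ws" for z
      using mem[OF that] by blast
    then show ?thesis by auto
  next
    case False
    have "xs ! 0 \<notin> {a<..<b}" "xs ! 1 \<notin> {a<..<b}" by (auto simp: ab)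
    moreover have "xs ! t \<notin> {a<..<b}" if "2 \<le> t" "t < ?m" for t
      using const[OF that] False by (simp add: P_def)
    ultimately have "z \<notin> {a<..<b}" if "z \<in> set ws" for z
      using mem[OF that] by blast
    then show ?thesis by blast
  qed
qed

lemma cycle_two_neighbours:
  assumes cyc: "is_cycle D ws" and w: "w \<in> set ws"
  obtains x y where "x \<in> set ws" "y \<in> set ws" "x \<noteq> y" "x \<noteq> w" "y \<noteq> w"
    "(min w x, max w x) \<in> cycle_edges ws" "(min w y, max w y) \<in> cycle_edges ws"
proof -
  obtain i where i: "i < length ws" "w = ws ! i" using w by (auto simp: in_set_conv_nth)
  define xs where "xs = rotate i ws"
  let ?m = "length ws"
  have xs: "length xs = ?m" "set xs = set ws" "distinct xs" "?m \<ge> 3" "cycle_edges xs \<subseteq> cycle_edges ws"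
    using cyc cycle_edges_rotate[of i ws] by (auto simp: xs_def is_cycle_def)
  have "rotate i ws ! 0 = ws ! ((i + 0) mod length ws)" using i by (intro nth_rotate) auto
  then have w0: "w = xs ! 0" using i by (simp add: xs_def)
  have e1: "(min (xs ! 0) (xs ! 1), max (xs ! 0) (xs ! 1)) \<in> cycle_edges xs"
  proof -
    have "0 < length xs" "(0 + 1) mod length xs = 1" using xs(1,4) by auto
    then show ?thesis using cycle_edgesI[of 0 xs] by (simp del: length_greater_0_conv)
  qed
  have "?m - 1 + 1 = ?m" using xs(4) by linarith
  then have "(?m - 1 + 1) mod ?m = 0" by (simp only: mod_self)
  then have e2: "(min (xs ! (?m - 1)) (xs ! 0), max (xs ! (?m - 1)) (xs ! 0)) \<in> cycle_edges xs"
    using cycle_edgesI[of "?m - 1" xs] xs(1,4) by simp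
  show ?thesis
  proof (rule that[of "xs ! 1" "xs ! (?m - 1)"])
    show "xs ! 1 \<in> set ws" "xs ! (?m - 1) \<in> set ws" using xs(1,2,4) by (metis nth_mem diff_less
          less_le_trans zero_less_numeral zero_less_one one_less_numeral_iff semiring_norm(77))+
    show "xs ! 1 \<noteq> xs ! (?m - 1)" "xs ! 1 \<noteq> w" "xs ! (?m - 1) \<noteq> w"
    proof -
      have l: "0 < length xs" "1 < length xs" "?m - 1 < length xs" "(1::nat) \<noteq> ?m - 1" "?m - 1 \<noteq> 0"
        using xs(1,4) by linarith+
      show "xs ! 1 \<noteq> xs ! (?m - 1)" "xs ! 1 \<noteq> w" "xs ! (?m - 1) \<noteq> w"
        unfolding w0 nth_eq_iff_index_eq[OF xs(3) l(2,3)] nth_eq_iff_index_eq[OF xs(3) l(2,1)]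
          nth_eq_iff_index_eq[OF xs(3) l(3,1)] using l(4,5) by auto
    qed
    show "(min w (xs ! 1), max w (xs ! 1)) \<in> cycle_edges ws" using e1 xs(5) w0 by auto
    show "(min w (xs ! (?m - 1)), max w (xs ! (?m - 1))) \<in> cycle_edges ws"
      using e2 xs(5) w0 by (auto simp: min.commute max.commute)
  qed
qed

text \<open>
  So a cycle visits its vertices in their order around the polygon: a vertex has two neighbours in the
  cycle, and only the previous and the next vertex around the polygon qualify.
\<close>

lemma cycle_edges_iff:
  assumes cyc: "is_cycle D ws" and nc: "\<And>d e. d \<in> D \<Longrightarrow> e \<in> D \<Longrightarrow> \<not> interlaced d e"
    and ij: "i \<in> set ws" "j \<in> set ws" "i < j"
  shows "(i, j) \<in> cycle_edges ws \<longleftrightarrow> set ws \<inter> {i<..<j} = {} \<or> set ws \<subseteq> {i..j}"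
proof
  assume "(i, j) \<in> cycle_edges ws"
  then show "set ws \<inter> {i<..<j} = {} \<or> set ws \<subseteq> {i..j}" using cycle_edge_separates[OF cyc nc] by blast
next
  assume R: "set ws \<inter> {i<..<j} = {} \<or> set ws \<subseteq> {i..j}"
  obtain x y where xy: "x \<in> set ws" "y \<in> set ws" "x \<noteq> y" "x \<noteq> i" "y \<noteq> i"
    "(min i x, max i x) \<in> cycle_edges ws" "(min i y, max i y) \<in> cycle_edges ws"
    by (rule cycle_two_neighbours[OF cyc ij(1)])
  \<comment> \<open>\<open>j\<close> and one other vertex are the only two possible neighbours of \<open>i\<close>\<close>
  have sep: "set ws \<inter> {min i z<..<max i z} = {} \<or> set ws \<subseteq> {min i z..max i z}"
    if "z = x \<or> z = y" for z
    using cycle_edge_separates[OF cyc nc] xy(6,7) that by blast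
  have "x = j \<or> y = j"
  proof (rule ccontr)
    assume nj: "\<not> (x = j \<or> y = j)"
    have mem: "z \<in> set ws \<Longrightarrow> set ws \<inter> {u<..<v} = {} \<Longrightarrow> \<not> (u < z \<and> z < v)"
      "z \<in> set ws \<Longrightarrow> set ws \<subseteq> {u..v} \<Longrightarrow> u \<le> z \<and> z \<le> v" for z u v :: nat by auto
    note f = mem(1)[OF xy(1)] mem(1)[OF xy(2)] mem(1)[OF ij(1)] mem(1)[OF ij(2)]
      mem(2)[OF xy(1)] mem(2)[OF xy(2)] mem(2)[OF ij(1)] mem(2)[OF ij(2)]
    have sx: "(\<not> (min i x < y \<and> y < max i x) \<and> \<not> (min i x < j \<and> j < max i x))
        \<or> (min i x \<le> y \<and> y \<le> max i x \<and> min i x \<le> j \<and> j \<le> max i x)"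
      using sep[of x] f by blast
    have sy: "(\<not> (min i y < x \<and> x < max i y) \<and> \<not> (min i y < j \<and> j < max i y))
        \<or> (min i y \<le> x \<and> x \<le> max i y \<and> min i y \<le> j \<and> j \<le> max i y)"
      using sep[of y] f by blast
    have sj: "(\<not> (i < x \<and> x < j) \<and> \<not> (i < y \<and> y < j)) \<or> (i \<le> x \<and> x \<le> j \<and> i \<le> y \<and> y \<le> j)"
      using R f by blast
    show False using sx sy sj nj xy(3-5) ij(3) by (auto simp: min_def max_def split: if_splits)
  qed
  then show "(i, j) \<in> cycle_edges ws" using xy(6,7) ij(3) by (auto simp: min_def max_def)
qed

lemma closed_cycle_set:
  assumes n: "n \<ge> 2" and D: "D \<subseteq> diagonals n" and cc: "closed_cycle n D ws"
  shows "set ws \<subseteq> {0..n}"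
proof
  fix w assume "w \<in> set ws"
  then obtain x where "(min w x, max w x) \<in> cycle_edges ws"
    using cc unfolding closed_cycle_def by (metis cycle_two_neighbours)
  then have "(min w x, max w x) \<in> diagonals n"
    using cc D by (auto simp: closed_cycle_def is_cycle_def)
  then show "w \<in> {0..n}" by (auto simp: diagonals_def max_def split: if_splits)
qed

lemma closed_cycle_face:
  assumes n: "n \<ge> 2" and D: "D \<subseteq> diagonals n" and nc: "\<And>d e. d \<in> D \<Longrightarrow> e \<in> D \<Longrightarrow> \<not> interlaced d e"
    and cc: "closed_cycle n D ws"
  shows "face D (set ws)"
proof -
  have cyc: "is_cycle D ws" using cc by (simp add: closed_cycle_def)
  have s: "set ws \<subseteq> {0..n}" by (rule closed_cycle_set[OF n D cc])
  have "(i, j) \<in> D \<longleftrightarrow> (i, j) \<in> cycle_edges ws" if ij: "i \<in> set ws" "j \<in> set ws" for i j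
    using cc seg_subset_region[OF n _ s, of "(i, j)"] that D cyc
    by (auto simp: closed_cycle_def is_cycle_def)
  then show ?thesis
    unfolding face_def using cycle_edges_iff[OF cyc nc] cyc by (auto simp: is_cycle_def distinct_card)
qed

lemma face_closed_cycle:
  assumes n: "n \<ge> 2" and D: "D \<subseteq> diagonals n" and V: "face D V"
  obtains ws where "closed_cycle n D ws" "set ws = V"
proof -
  define ws where "ws = sorted_list_of_set V"
  let ?m = "length ws"
  have fin: "finite V" by (rule face_finite[OF V])
  have ws: "set ws = V" "distinct ws" "sorted_wrt (<) ws" "?m \<ge> 3"
    using fin V by (auto simp: ws_def face_def)
  have idx: "\<exists>r<?m. z = ws ! r" if "z \<in> V" for z
    using that unfolding ws(1)[symmetric] in_set_conv_nth by blast
  have lt: "s < t \<Longrightarrow> t < ?m \<Longrightarrow> ws ! s < ws ! t" for s t using ws(3) sorted_wrt_nth_less by blast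
  have D0: "D \<subseteq> intv 0 n" using D by (auto simp: diagonals_def)
  have s: "set ws \<subseteq> {0..n}" using face_within[OF V D0] ws(1) by simp
  have le: "ws ! s \<le> ws ! t" if "s \<le> t" "t < ?m" for s t
    using that lt[of s t] by (cases "s = t") simp_all
  have "cycle_edges ws \<subseteq> D"
  proof
    fix e assume "e \<in> cycle_edges ws"
    then obtain t where t: "t < ?m" "e = (min (ws ! t) (ws ! ((t + 1) mod ?m)), max (ws ! t) (ws ! ((t + 1) mod ?m)))"
      by (auto simp: cycle_edges_def)
    show "e \<in> D"
    proof (cases "t + 1 < ?m")
      case True
      then have e: "e = (ws ! t, ws ! (t + 1))" using t lt[of t "t + 1"] by (simp add: min_def max_def)
      have "z \<notin> {ws ! t<..<ws ! (t + 1)}" if zV: "z \<in> V" for z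
      proof -
        obtain r where r: "r < ?m" "z = ws ! r" using idx[OF zV] by blast
        show ?thesis
        proof (cases "r \<le> t")
          case True
          then have "z \<le> ws ! t" using r lt[of r t] t by (cases "r = t") auto
          then show ?thesis by simp
        next
          case False
          then have "ws ! (t + 1) \<le> z" using r lt[of "t + 1" r] by (cases "r = t + 1") auto
          then show ?thesis by simp
        qed
      qed
      then have "V \<inter> {ws ! t<..<ws ! (t + 1)} = {}" by blast
      then show ?thesis unfolding e using face_edge[OF V, of "ws ! t" "ws ! (t + 1)"] lt[of t "t + 1"] True t ws(1)
        by (metis lessI nth_mem Suc_eq_plus1)
    next
      case False
      then have "t + 1 = ?m" using t by linarith
      then have tm: "t = ?m - 1" "(t + 1) mod ?m = 0" by (simp, simp only: mod_self)
      have l0: "ws ! 0 < ws ! (?m - 1)" using lt[of 0 "?m - 1"] ws(4) by simp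
      then have e: "e = (ws ! 0, ws ! (?m - 1))" unfolding t(2) tm(2) unfolding tm(1) by (simp add: min_def max_def)
      have "z \<in> {ws ! 0..ws ! (?m - 1)}" if zV: "z \<in> V" for z
      proof -
        obtain r where r: "r < ?m" "z = ws ! r" using idx[OF zV] by blast
        have "ws ! 0 \<le> z" unfolding r(2) using r(1) by (intro le) linarith+
        moreover have "z \<le> ws ! (?m - 1)" unfolding r(2) using r(1) by (intro le) linarith+
        ultimately show ?thesis by simp
      qed
      then have "V \<subseteq> {ws ! 0..ws ! (?m - 1)}" by blast
      moreover have "ws ! 0 \<in> V" "ws ! (?m - 1) \<in> V"
        unfolding ws(1)[symmetric] using ws(4) by (auto intro!: nth_mem)
      ultimately show ?thesis unfolding e using face_edge[OF V _ _ l0] by blast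
    qed
  qed
  moreover have "d \<in> cycle_edges ws" if d: "d \<in> D" "ends_in d V" for d
  proof -
    obtain i j where [simp]: "d = (i, j)" by (cases d)
    obtain r where r: "r < ?m" "i = ws ! r" using d(2) idx by auto
    obtain t where t: "t < ?m" "j = ws ! t" using d(2) idx by auto
    have ij: "i < j" using d D by (auto simp: diagonals_def)
    have rt: "r < t" using ij r t lt[of t r] by (metis linorder_neqE_nat order_less_asym)
    have "V \<inter> {i<..<j} = {} \<or> V \<subseteq> {i..j}" using face_edge[OF V _ _ ij] d by simp
    then show ?thesis
    proof
      assume e: "V \<inter> {i<..<j} = {}"
      have "t = r + 1"
      proof (rule ccontr)
        assume "t \<noteq> r + 1"
        then have "r + 1 < t" using rt by simp
        then have "ws ! (r + 1) \<in> {i<..<j}" using lt[of r "r + 1"] lt[of "r + 1" t] r t by simp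
        moreover have "ws ! (r + 1) \<in> V" unfolding ws(1)[symmetric] using \<open>r + 1 < t\<close> t(1) by simp
        ultimately show False using e by blast
      qed
      then show ?thesis using cycle_edgesI[of r ws] r t ij by (simp add: min_def max_def)
    next
      assume e: "V \<subseteq> {i..j}"
      have "ws ! 0 \<in> V" "ws ! (?m - 1) \<in> V" unfolding ws(1)[symmetric] using ws(4) by (auto intro!: nth_mem)
      then have le: "i \<le> ws ! 0" "ws ! (?m - 1) \<le> j" using e by auto
      have "r = 0" using le(1) r lt[of 0 r] by (cases "r = 0") auto
      moreover have tm: "t = ?m - 1"
      proof (rule ccontr)
        assume "t \<noteq> ?m - 1"
        then have "t < ?m - 1" "?m - 1 < ?m" using t(1) ws(4) by linarith+
        then show False using lt[of t "?m - 1"] le(2) t(2) by simp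
      qed
      moreover have "t + 1 = ?m" using tm ws(4) by linarith
      then have "(t + 1) mod ?m = 0" by (simp only: mod_self)
      ultimately show ?thesis using cycle_edgesI[OF t(1)] r t(2) ij by (simp add: min_def max_def)
    qed
  qed
  ultimately have "closed_cycle n D ws"
    unfolding closed_cycle_def is_cycle_def using ws D seg_subset_region[OF n _ s] by auto
  then show ?thesis using that ws(1) by blast
qed

lemma connected_spanning_iff:
  assumes n: "n \<ge> 1" and D: "D \<subseteq> diagonals n"
  shows "connected_spanning n D \<longleftrightarrow> linked D {0..n}"
proof
  assume L: "linked D {0..n}"
  have "i \<in> fst ` D \<union> snd ` D" if i: "i \<in> {0..n}" for i
  proof -
    obtain j where j: "j \<in> {0..n}" "i \<noteq> j" using n by (metis atLeastAtMost_iff le0 le_refl not_one_le_zero)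
    then have "(i, j) \<in> (D \<union> D\<inverse>)\<^sup>*" using L i by (auto simp: linked_def)
    then obtain x where "(i, x) \<in> D \<union> D\<inverse>" using j by (metis converse_rtranclE)
    then show ?thesis by force
  qed
  moreover have "fst ` D \<union> snd ` D \<subseteq> {0..n}" using D by (force simp: diagonals_def)
  ultimately have "fst ` D \<union> snd ` D = {0..n}" by blast
  then show "connected_spanning n D" using L by (simp add: connected_spanning_def linked_def)
qed (simp add: connected_spanning_def linked_def)

lemma noncrossing_plant_iff:
  assumes n: "n \<ge> 2"
  shows "noncrossing_plant n N D \<longleftrightarrow> plant 0 n N D"
proof (cases "N \<subseteq> diagonals n \<and> D \<subseteq> diagonals n \<and> (\<forall>d\<in>N \<union> D. \<forall>e\<in>N \<union> D. \<not> interlaced d e)")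
  case True
  then have ND: "N \<subseteq> diagonals n" "D \<subseteq> diagonals n" "\<forall>d\<in>N \<union> D. \<forall>e\<in>N \<union> D. \<not> interlaced d e" by auto
  have nc: "\<not> interlaced d e" if "d \<in> D" "e \<in> D" for d e using ND(3) that by blast
  have i: "intv 0 n = diagonals n" by (auto simp: intv_def diagonals_def)
  have cr: "\<forall>d\<in>N \<union> D. \<forall>e\<in>N \<union> D. \<not> crossing n d e"
    using ND crossing_iff_interlaced[of _ n] by blast
  have seg: "seg n d \<subseteq> region n ws \<longleftrightarrow> ends_in d (set ws)" if "closed_cycle n D ws" "d \<in> N" for d ws
    using seg_subset_region[OF n _ closed_cycle_set[OF n ND(2) that(1)]] that(2) ND(1) by blast
  have 1: "(\<exists>ws. closed_cycle n D ws \<and> seg n d \<subseteq> region n ws) \<longleftrightarrow> (\<exists>V. face D V \<and> ends_in d V)"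
    if "d \<in> N" for d
    using seg[OF _ that] closed_cycle_face[OF n ND(2) nc] face_closed_cycle[OF n ND(2)] by metis
  have 2: "(\<forall>ws. closed_cycle n D ws \<longrightarrow> (\<exists>!d. d \<in> N \<and> seg n d \<subseteq> region n ws))
      \<longleftrightarrow> (\<forall>V. face D V \<longrightarrow> (\<exists>!d. d \<in> N \<and> ends_in d V))" (is "?L \<longleftrightarrow> ?R")
  proof
    assume L: ?L
    show ?R
    proof (intro allI impI)
      fix V assume "face D V"
      then obtain ws where ws: "closed_cycle n D ws" "set ws = V" using face_closed_cycle[OF n ND(2)] by metis
      have eq: "(d \<in> N \<and> seg n d \<subseteq> region n ws) \<longleftrightarrow> (d \<in> N \<and> ends_in d V)" for d
        using seg[OF ws(1)] ws(2) by blast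
      have "\<exists>!d. d \<in> N \<and> seg n d \<subseteq> region n ws" using L ws(1) by blast
      then show "\<exists>!d. d \<in> N \<and> ends_in d V" unfolding eq .
    qed
  next
    assume R: ?R
    show ?L
    proof (intro allI impI)
      fix ws assume ws: "closed_cycle n D ws"
      have eq: "(d \<in> N \<and> seg n d \<subseteq> region n ws) \<longleftrightarrow> (d \<in> N \<and> ends_in d (set ws))" for d
        using seg[OF ws] by blast
      have "\<exists>!d. d \<in> N \<and> ends_in d (set ws)"
        using R closed_cycle_face[OF n ND(2) nc ws] by blast
      then show "\<exists>!d. d \<in> N \<and> seg n d \<subseteq> region n ws" unfolding eq .
    qed
  qed
  have cs: "connected_spanning n D \<longleftrightarrow> linked D {0..n}"
    using connected_spanning_iff[OF _ ND(2)] n by simp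
  show ?thesis unfolding noncrossing_plant_def plant_def i cs 2 using 1 ND cr by blast
next
  case False
  have "\<not> noncrossing_plant n N D"
  proof
    assume P: "noncrossing_plant n N D"
    then have "N \<union> D \<subseteq> diagonals n" "\<forall>d\<in>N \<union> D. \<forall>e\<in>N \<union> D. \<not> crossing n d e"
      unfolding noncrossing_plant_def by blast+
    then show False using False crossing_iff_interlaced by blast
  qed
  moreover have "\<not> plant 0 n N D" using False by (auto simp: plant_def intv_def diagonals_def)
  ultimately show ?thesis by simp
qed

section \<open>Polynomial evaluation and substitution into rational functions\<close>

text \<open>Unital ring homomorphisms.\<close>

definition ring_hom1 :: "('a::comm_ring_1 \<Rightarrow> 'b::comm_ring_1) \<Rightarrow> bool" where
  "ring_hom1 h \<longleftrightarrow> h 1 = 1 \<and> (\<forall>x y. h (x + y) = h x + h y) \<and> (\<forall>x y. h (x * y) = h x * h y)"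

lemma ring_hom1_D:
  assumes "ring_hom1 h"
  shows "h 1 = 1" "h (x + y) = h x + h y" "h (x * y) = h x * h y" "h 0 = 0" "h (- x) = - h x"
    "h (x - y) = h x - h y" "h (x ^ n) = h x ^ n"
proof -
  show a: "h 1 = 1" "\<And>x y. h (x + y) = h x + h y" "\<And>x y. h (x * y) = h x * h y"
    using assms by (auto simp: ring_hom1_def)
  have "h 0 + h 0 = h 0" using a(2)[of 0 0] by simp
  then show z: "h 0 = 0" by simp
  have "h x + h (- x) = 0" for x using a(2)[of x "- x"] z by simp
  then show m: "h (- x) = - h x" for x by (simp add: add_eq_0_iff)
  show "h (x - y) = h x - h y" using a(2)[of x "- y"] m[of y] by simp
  show "h (x ^ n) = h x ^ n" by (induction n) (simp_all add: a)
qed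

lemma ring_hom1_sum: "ring_hom1 h \<Longrightarrow> h (sum f A) = (\<Sum>x\<in>A. h (f x))"
  by (induction A rule: infinite_finite_induct) (simp_all add: ring_hom1_D)

lemma ring_hom1_prod: "ring_hom1 h \<Longrightarrow> h (prod f A) = (\<Prod>x\<in>A. h (f x))"
  by (induction A rule: infinite_finite_induct) (simp_all add: ring_hom1_D)

lemma ring_hom1_comp: "ring_hom1 g \<Longrightarrow> ring_hom1 h \<Longrightarrow> ring_hom1 (\<lambda>x. g (h x))"
  by (simp add: ring_hom1_def)

lemma ring_hom1_field:
  fixes h :: "'a::field \<Rightarrow> 'b::field"
  assumes "ring_hom1 h"
  shows "h x = 0 \<longleftrightarrow> x = 0" "h (inverse x) = inverse (h x)" "h (x / y) = h x / h y"
proof -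
  have i: "h x * h (inverse x) = 1" if "x \<noteq> 0" for x
    using that ring_hom1_D(3)[OF assms, of x "inverse x"] ring_hom1_D(1)[OF assms] by simp
  show "h x = 0 \<longleftrightarrow> x = 0"
    using i[of x] ring_hom1_D(4)[OF assms] by (metis mult_zero_left zero_neq_one)
  show j: "h (inverse x) = inverse (h x)" for x
    using i[of x] ring_hom1_D(4)[OF assms] by (cases "x = 0") (auto simp: inverse_unique)
  show "h (x / y) = h x / h y"
    by (simp add: divide_inverse ring_hom1_D(3)[OF assms] j)
qed

text \<open>The value of a monomial.\<close>

definition mono_eval :: "(nat \<Rightarrow> 'a::comm_ring_1) \<Rightarrow> (nat \<Rightarrow>\<^sub>0 nat) \<Rightarrow> 'a" where
  "mono_eval s m = (\<Prod>k\<in>Poly_Mapping.keys m. s k ^ Poly_Mapping.lookup m k)"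

text \<open>Evaluation of a polynomial, with coefficients transported along \<open>c\<close>.\<close>

definition poly_eval :: "(rat \<Rightarrow> 'a::comm_ring_1) \<Rightarrow> (nat \<Rightarrow> 'a) \<Rightarrow> ratpoly \<Rightarrow> 'a" where
  "poly_eval c s p = (\<Sum>m\<in>Poly_Mapping.keys p. c (Poly_Mapping.lookup p m) * mono_eval s m)"

lemma mono_eval_superset:
  assumes "finite A" "Poly_Mapping.keys m \<subseteq> A"
  shows "mono_eval s m = (\<Prod>k\<in>A. s k ^ Poly_Mapping.lookup m k)"
  unfolding mono_eval_def using assms by (intro prod.mono_neutral_left) (auto simp: in_keys_iff)

lemma mono_eval_add: "mono_eval s (m + m') = mono_eval s m * mono_eval s m'"
proof -
  let ?A = "Poly_Mapping.keys m \<union> Poly_Mapping.keys m'"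
  have "mono_eval s (m + m') = (\<Prod>k\<in>?A. s k ^ Poly_Mapping.lookup (m + m') k)"
    by (rule mono_eval_superset) (use Poly_Mapping.keys_add[of m m'] in auto)
  also have "\<dots> = mono_eval s m * mono_eval s m'"
    by (simp add: mono_eval_superset[of ?A] lookup_add power_add prod.distrib)
  finally show ?thesis .
qed

lemma poly_eval_superset:
  assumes "finite A" "Poly_Mapping.keys p \<subseteq> A" "c 0 = 0"
  shows "poly_eval c s p = (\<Sum>m\<in>A. c (Poly_Mapping.lookup p m) * mono_eval s m)"
  unfolding poly_eval_def using assms by (intro sum.mono_neutral_left) (auto simp: in_keys_iff)

lemma poly_eval_add:
  assumes c: "ring_hom1 c"
  shows "poly_eval c s (p + q) = poly_eval c s p + poly_eval c s q"
proof -
  let ?A = "Poly_Mapping.keys p \<union> Poly_Mapping.keys q"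
  have c0: "c 0 = 0" by (rule ring_hom1_D(4)[OF c])
  have "poly_eval c s (p + q) = (\<Sum>m\<in>?A. c (Poly_Mapping.lookup (p + q) m) * mono_eval s m)"
    by (rule poly_eval_superset) (use Poly_Mapping.keys_add[of p q] c0 in auto)
  also have "\<dots> = poly_eval c s p + poly_eval c s q"
    by (simp add: poly_eval_superset[of ?A _ c] c0 lookup_add ring_hom1_D(2)[OF c]
        distrib_right sum.distrib)
  finally show ?thesis .
qed

lemma poly_eval_single:
  assumes "ring_hom1 c"
  shows "poly_eval c s (Poly_Mapping.single m a) = c a * mono_eval s m"
  using poly_eval_superset[of "{m}" "Poly_Mapping.single m a" c s] ring_hom1_D(4)[OF assms]
  by (cases "a = 0") simp_all

lemma ratpoly_sum_single:
  fixes p :: ratpoly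
  shows "p = (\<Sum>m\<in>Poly_Mapping.keys p. Poly_Mapping.single m (Poly_Mapping.lookup p m))"
  by (rule poly_mapping_eqI) (simp add: lookup_sum lookup_single when_def in_keys_iff)

lemma poly_eval_sum:
  assumes "ring_hom1 c"
  shows "poly_eval c s (sum f A) = (\<Sum>x\<in>A. poly_eval c s (f x))"
proof (induction A rule: infinite_finite_induct)
  case (insert x F) then show ?case by (simp add: poly_eval_add assms)
qed (simp_all add: poly_eval_def)

lemma ring_hom1_poly_eval:
  assumes c: "ring_hom1 c"
  shows "ring_hom1 (poly_eval c s)"
proof -
  have "poly_eval c s (p * q) = poly_eval c s p * poly_eval c s q" for p q
  proof -
    have "poly_eval c s (p * q) = poly_eval c s
       ((\<Sum>m\<in>Poly_Mapping.keys p. Poly_Mapping.single m (Poly_Mapping.lookup p m)) *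
        (\<Sum>m\<in>Poly_Mapping.keys q. Poly_Mapping.single m (Poly_Mapping.lookup q m)))"
      by (simp flip: ratpoly_sum_single)
    also have "\<dots> = poly_eval c s p * poly_eval c s q"
      unfolding sum_product poly_eval_sum[OF c] mult_single poly_eval_single[OF c]
        mono_eval_add ring_hom1_D(3)[OF c] poly_eval_def[of c s p] poly_eval_def[of c s q]
      by (simp add: ac_simps)
    finally show ?thesis .
  qed
  moreover have "poly_eval c s 1 = 1"
    using poly_eval_single[OF c, of s 0 1] ring_hom1_D(1)[OF c] by (simp add: mono_eval_def)
  ultimately show ?thesis by (simp add: ring_hom1_def poly_eval_add[OF c])
qed

text \<open>The variables as polynomials.\<close>

definition pvar :: "nat \<Rightarrow> ratpoly" where
  "pvar k = Poly_Mapping.single (Poly_Mapping.single k 1) 1"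

lemma poly_eval_pvar: "ring_hom1 c \<Longrightarrow> poly_eval c s (pvar k) = s k"
  by (simp add: pvar_def poly_eval_single ring_hom1_D mono_eval_def)

lemma poly_eval_const: "ring_hom1 c \<Longrightarrow> poly_eval c s (Poly_Mapping.single 0 a) = c a"
  by (simp add: poly_eval_single mono_eval_def)

lemma ring_hom1_const_poly: "ring_hom1 (\<lambda>a. Poly_Mapping.single 0 a :: ratpoly)"
  by (simp add: ring_hom1_def single_add mult_single flip: single_one)

lemma ring_hom1_Fract: "ring_hom1 (\<lambda>p. Fract p 1 :: ratfun)"
  by (simp add: ring_hom1_def One_fract_def)

lemma ring_hom1_rconst: "ring_hom1 rconst"
  unfolding rconst_def[abs_def] by (rule ring_hom1_comp[OF ring_hom1_Fract ring_hom1_const_poly])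

lemma poly_subst_eq: "poly_subst = poly_eval rconst"
  by (intro ext) (simp add: poly_subst_def poly_eval_def mono_eval_def)

lemma ring_hom1_poly_subst: "ring_hom1 (poly_subst s)"
  unfolding poly_subst_eq by (rule ring_hom1_poly_eval[OF ring_hom1_rconst])

lemma ring_hom1_of_poly_eval:
  assumes "ring_hom1 h"
  shows "h (poly_eval c s p) = poly_eval (\<lambda>a. h (c a)) (\<lambda>k. h (s k)) p"
  by (simp add: poly_eval_def ring_hom1_sum[OF assms] ring_hom1_D[OF assms] mono_eval_def
      ring_hom1_prod[OF assms])

text \<open>A ring homomorphism on polynomials is determined on constants and variables.\<close>

lemma ring_hom1_eq_poly_eval:
  assumes "ring_hom1 h"
  shows "h p = poly_eval (\<lambda>a. h (Poly_Mapping.single 0 a)) (\<lambda>k. h (pvar k)) p"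
proof -
  have mono: "Poly_Mapping.single m 1 = mono_eval pvar m" for m :: "nat \<Rightarrow>\<^sub>0 nat"
  proof -
    have pw: "pvar k ^ e = Poly_Mapping.single (Poly_Mapping.single k e) 1" for k e
      by (induction e) (simp_all add: pvar_def mult_single flip: single_add)
    have pr: "(\<Prod>x\<in>A. Poly_Mapping.single (f x) 1) = (Poly_Mapping.single (sum f A) 1 :: ratpoly)"
      if "finite A" for A and f :: "nat \<Rightarrow> nat \<Rightarrow>\<^sub>0 nat"
      using that by induction (simp_all add: mult_single)
    have "m = (\<Sum>k\<in>Poly_Mapping.keys m. Poly_Mapping.single k (Poly_Mapping.lookup m k))"
      by (rule poly_mapping_eqI) (simp add: lookup_sum lookup_single when_def in_keys_iff)
    then show ?thesis by (simp add: mono_eval_def pw pr)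
  qed
  have "p = (\<Sum>m\<in>Poly_Mapping.keys p.
      Poly_Mapping.single 0 (Poly_Mapping.lookup p m) * mono_eval pvar m)"
    by (subst ratpoly_sum_single) (simp add: mult_single flip: mono)
  then have "p = poly_eval (\<lambda>a. Poly_Mapping.single 0 a) pvar p"
    unfolding poly_eval_def .
  then have "h p = h (poly_eval (\<lambda>a. Poly_Mapping.single 0 a) pvar p)" by simp
  then show ?thesis by (simp add: ring_hom1_of_poly_eval[OF assms])
qed

subsection \<open>Substitution into rational functions\<close>

text \<open>
  Substitutions that do not annihilate any nonzero polynomial. They extend to field homomorphisms on
  rational functions.
\<close>

definition faithful_subst :: "(nat \<Rightarrow> ratfun) \<Rightarrow> bool" where
  "faithful_subst s \<longleftrightarrow> (\<forall>q. q \<noteq> 0 \<longrightarrow> poly_subst s q \<noteq> 0)"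

lemma rf_subst_Fract:
  assumes "faithful_subst s" "q \<noteq> 0"
  shows "rf_subst s (Fract p q) = poly_subst s p / poly_subst s q"
  unfolding rf_subst_def
proof (rule the_equality)
  show "\<exists>p' q'. Fract p q = Fract p' q' \<and> q' \<noteq> 0 \<and> poly_subst s q' \<noteq> 0 \<and>
      poly_subst s p / poly_subst s q = poly_subst s p' / poly_subst s q'"
    using assms by (auto simp: faithful_subst_def)
next
  fix y assume "\<exists>p' q'. Fract p q = Fract p' q' \<and> q' \<noteq> 0 \<and> poly_subst s q' \<noteq> 0 \<and>
      y = poly_subst s p' / poly_subst s q'"
  then obtain p' q' where *: "Fract p q = Fract p' q'" "q' \<noteq> 0" "poly_subst s q' \<noteq> 0"
    "y = poly_subst s p' / poly_subst s q'" by blast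
  then have "p * q' = p' * q" using assms(2) by (simp add: eq_fract)
  then have "poly_subst s p * poly_subst s q' = poly_subst s p' * poly_subst s q"
    by (metis ring_hom1_D(3) ring_hom1_poly_subst)
  then show "y = poly_subst s p / poly_subst s q"
    using *(3,4) assms by (simp add: faithful_subst_def frac_eq_eq)
qed

lemma
  assumes "faithful_subst s"
  shows ring_hom1_rf_subst: "ring_hom1 (rf_subst s)"
    and rf_subst_uvar: "rf_subst s (uvar k) = s k"
    and rf_subst_rconst: "rf_subst s (rconst a) = rconst a"
proof -
  note R = ring_hom1_D[OF ring_hom1_poly_subst]
  have nz: "poly_subst s q \<noteq> 0" if "q \<noteq> 0" for q using assms that by (simp add: faithful_subst_def)
  show "ring_hom1 (rf_subst s)"
    unfolding ring_hom1_def
  proof (intro conjI allI)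
    show "rf_subst s 1 = 1" by (simp add: One_fract_def rf_subst_Fract assms R)
    fix x y :: ratfun
    obtain p q where x: "x = Fract p q" "q \<noteq> 0" by (rule Fract_cases)
    obtain p' q' where y: "y = Fract p' q'" "q' \<noteq> 0" by (rule Fract_cases)
    show "rf_subst s (x + y) = rf_subst s x + rf_subst s y"
      using x y nz by (simp add: rf_subst_Fract assms R add_frac_eq)
    show "rf_subst s (x * y) = rf_subst s x * rf_subst s y"
      using x y nz by (simp add: rf_subst_Fract assms R)
  qed
  show "rf_subst s (uvar k) = s k"
    using poly_eval_pvar[OF ring_hom1_rconst, of s k] R(1)[of s]
    by (simp add: uvar_def rf_subst_Fract assms poly_subst_eq pvar_def)
  show "rf_subst s (rconst a) = rconst a"
    using poly_eval_const[OF ring_hom1_rconst, of s a] R(1)[of s]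
    by (simp add: rconst_def rf_subst_Fract assms poly_subst_eq)
qed

text \<open>
  A substitution by polynomials is faithful if it has a left inverse that is again a substitution
  by polynomials.
\<close>

lemma faithful_substI:
  fixes s :: "nat \<Rightarrow> ratpoly"
  assumes inv: "\<And>k. poly_eval (\<lambda>a. Poly_Mapping.single 0 a) t (s k) = pvar k"
  shows "faithful_subst (\<lambda>k. Fract (s k) 1)"
  unfolding faithful_subst_def
proof (intro allI impI)
  fix q :: ratpoly assume q: "q \<noteq> 0"
  let ?c = "\<lambda>a. Poly_Mapping.single 0 a :: ratpoly"
  note H = ring_hom1_poly_eval[OF ring_hom1_const_poly]
  have "poly_subst (\<lambda>k. Fract (s k) 1) q = Fract (poly_eval ?c s q) 1"
    by (simp add: poly_subst_eq ring_hom1_of_poly_eval[OF ring_hom1_Fract] rconst_def[abs_def])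
  moreover have "poly_eval ?c t (poly_eval ?c s q) = q"
    using ring_hom1_eq_poly_eval[of "\<lambda>p. p" q]
    by (simp add: ring_hom1_of_poly_eval[OF H] inv poly_eval_const[OF ring_hom1_const_poly]
        ring_hom1_def)
  then have "poly_eval ?c s q \<noteq> 0" using q ring_hom1_D(4)[OF H] by metis
  ultimately show "poly_subst (\<lambda>k. Fract (s k) 1) q \<noteq> 0"
    by (simp add: eq_fract Zero_fract_def)
qed

section \<open>The operad of rational functions\<close>

text \<open>Arities are written with the numeral \<open>1\<close>, which the simplifier should not turn into a successor.\<close>

declare One_nat_def [simp del]

text \<open>
  The two substitutions in the composite \<open>f \<circ>\<^sub>i g\<close>: \<open>outer_subst\<close> is applied to \<open>f\<close> and
  \<open>inner_subst\<close> to \<open>g\<close>, which has arity \<open>n\<close>.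
\<close>

definition outer_subst :: "nat \<Rightarrow> nat \<Rightarrow> ratfun \<Rightarrow> ratfun" where
  "outer_subst i n = rf_subst
     (\<lambda>k. if k < i then uvar k else if k = i then usum i (i + n - 1) else uvar (k + n - 1))"

definition inner_subst :: "nat \<Rightarrow> ratfun \<Rightarrow> ratfun" where
  "inner_subst i = rf_subst (\<lambda>k. uvar (k + i - 1))"

lemma Mould_comp:
  "op_comp Mould m n i f g = usum i (i + n - 1) * outer_subst i n f * inner_subst i g"
  by (simp add: Mould_def outer_subst_def inner_subst_def)

lemma uvar_eq_Fract: "uvar k = Fract (pvar k) 1"
  by (simp add: uvar_def pvar_def)

lemma faithful_outer:
  assumes "n \<ge> 1"
  shows "faithful_subst
     (\<lambda>k. if k < i then uvar k else if k = i then usum i (i + n - 1) else uvar (k + n - 1))"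
proof -
  let ?c = "\<lambda>a. Poly_Mapping.single 0 a :: ratpoly"
  let ?s = "\<lambda>k. if k < i then pvar k else if k = i then (\<Sum>j=i..i + n - 1. pvar j)
    else pvar (k + n - 1)"
  \<comment> \<open>a left inverse: the new variables other than \<open>u\<^sub>i\<close> are set to zero\<close>
  let ?t = "\<lambda>j. if j \<le> i then pvar j else if j < i + n then 0 else pvar (j + 1 - n)"
  note C = ring_hom1_const_poly
  have "faithful_subst (\<lambda>k. Fract (?s k) 1)"
  proof (rule faithful_substI)
    fix k
    have "(\<Sum>j=i..i + n - 1. ?t j) = (\<Sum>j=i..i + n - 1. if j = i then pvar j else 0)"
      by (rule sum.cong) (use assms in auto)
    also have "\<dots> = pvar i" using assms by (simp add: sum.delta)
    finally show "poly_eval ?c ?t (?s k) = pvar k"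
      using assms by (auto simp: poly_eval_sum[OF C] poly_eval_pvar[OF C])
  qed
  also have "(\<lambda>k. Fract (?s k) 1) =
    (\<lambda>k. if k < i then uvar k else if k = i then usum i (i + n - 1) else uvar (k + n - 1))"
    by (auto simp: fun_eq_iff uvar_eq_Fract usum_def ring_hom1_sum[OF ring_hom1_Fract])
  finally show ?thesis .
qed

lemma faithful_inner:
  assumes "i \<ge> 1"
  shows "faithful_subst (\<lambda>k. uvar (k + i - 1))"
proof -
  have "faithful_subst (\<lambda>k. Fract (pvar (k + i - 1)) 1)"
    by (rule faithful_substI[where t = "\<lambda>j. pvar (j + 1 - i)"])
      (use assms in \<open>simp add: poly_eval_pvar[OF ring_hom1_const_poly]\<close>)
  then show ?thesis by (simp add: uvar_eq_Fract)
qed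

lemma usum_split: "a \<le> b + 1 \<Longrightarrow> b \<le> c \<Longrightarrow> usum a c = usum a b + usum (b + 1) c"
  unfolding usum_def
  by (subst sum.union_disjoint[symmetric]) (auto intro!: sum.cong)

lemma usum_single [simp]: "usum a a = uvar a"
  by (simp add: usum_def)

lemma usum_shift: "(\<Sum>k=a..b. uvar (k + d)) = usum (a + d) (b + d)"
  unfolding usum_def by (rule sum.reindex_bij_witness[of _ "\<lambda>j. j - d" "\<lambda>j. j + d"]) auto

lemma outer_subst_simps:
  assumes "n \<ge> 1"
  shows "ring_hom1 (outer_subst i n)" "outer_subst i n (rconst c) = rconst c"
    "k < i \<Longrightarrow> outer_subst i n (uvar k) = uvar k"
    "outer_subst i n (uvar i) = usum i (i + n - 1)"
    "k > i \<Longrightarrow> outer_subst i n (uvar k) = uvar (k + n - 1)"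
  unfolding outer_subst_def
  by (simp_all add: ring_hom1_rf_subst rf_subst_rconst rf_subst_uvar faithful_outer[OF assms])

lemma inner_subst_simps:
  assumes "i \<ge> 1"
  shows "ring_hom1 (inner_subst i)" "inner_subst i (rconst c) = rconst c"
    "inner_subst i (uvar k) = uvar (k + i - 1)"
  unfolding inner_subst_def
  using faithful_inner[OF assms]
  by (simp_all only: ring_hom1_rf_subst rf_subst_rconst rf_subst_uvar)

lemma outer_subst_usum:
  assumes "n \<ge> 1"
  shows "b < i \<Longrightarrow> outer_subst i n (usum a b) = usum a b"
    "i < a \<Longrightarrow> outer_subst i n (usum a b) = usum (a + n - 1) (b + n - 1)"
    "a \<le> i \<Longrightarrow> i \<le> b \<Longrightarrow> outer_subst i n (usum a b) = usum a (b + n - 1)"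
proof -
  note S = outer_subst_simps[OF assms]
  show lo: "outer_subst i n (usum a b) = usum a b" if "b < i" for a b
    unfolding usum_def ring_hom1_sum[OF S(1)] using that by (intro sum.cong) (auto simp: S)
  show hi: "outer_subst i n (usum a b) = usum (a + n - 1) (b + n - 1)" if "i < a" for a b
  proof -
    have "outer_subst i n (usum a b) = (\<Sum>k=a..b. uvar (k + (n - 1)))"
      unfolding usum_def ring_hom1_sum[OF S(1)] using that assms
      by (intro sum.cong) (auto simp: S)
    then show ?thesis using assms usum_shift[of "n - 1" a b] by simp
  qed
  show "outer_subst i n (usum a b) = usum a (b + n - 1)" if ab: "a \<le> i" "i \<le> b"
  proof -
    have 1: "usum a b = (if a < i then usum a (i - 1) else 0) + uvar i + usum (i + 1) b"
      using ab usum_split[of a "i - 1" b] usum_split[of i i b] by (cases "a = i") auto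
    have 2: "usum a (b + n - 1) = (if a < i then usum a (i - 1) else 0) + usum i (i + n - 1)
        + usum (i + n) (b + n - 1)"
      using ab assms usum_split[of a "i - 1" "b + n - 1"]
        usum_split[of i "i + n - 1" "b + n - 1"] by (cases "a = i") auto
    show ?thesis
      unfolding 1 2 ring_hom1_D(2)[OF S(1)] S(4) using assms
      by (auto simp: lo hi ring_hom1_D(4)[OF S(1)])
  qed
qed

lemma inner_subst_usum:
  assumes "i \<ge> 1"
  shows "inner_subst i (usum a b) = usum (a + i - 1) (b + i - 1)"
proof -
  have "inner_subst i (usum a b) = (\<Sum>k=a..b. uvar (k + (i - 1)))"
    unfolding usum_def ring_hom1_sum[OF inner_subst_simps(1)[OF assms]] using assms
    by (intro sum.cong) (auto simp: inner_subst_simps[OF assms])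
  then show ?thesis using assms usum_shift[of "i - 1" a b] by simp
qed

subsection \<open>The spaces of rational functions in finitely many variables\<close>

lemma Mould_set_iff:
  "f \<in> op_set Mould n \<longleftrightarrow>
    n \<ge> 1 \<and> (\<exists>p q. f = Fract p q \<and> q \<noteq> 0 \<and> pvars p \<subseteq> {1..n} \<and> pvars q \<subseteq> {1..n})"
  by (auto simp: Mould_def)

lemma pvars_add: "pvars (p + q) \<subseteq> pvars p \<union> pvars q"
  unfolding pvars_def using Poly_Mapping.keys_add[of p q] by blast

lemma pvars_mult: "pvars (p * q) \<subseteq> pvars p \<union> pvars q"
proof
  fix k assume "k \<in> pvars (p * q)"
  then obtain m where m: "m \<in> Poly_Mapping.keys (p * q)" "k \<in> Poly_Mapping.keys m"
    by (auto simp: pvars_def)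
  then obtain a b where ab: "m = a + b" "a \<in> Poly_Mapping.keys p" "b \<in> Poly_Mapping.keys q"
    using keys_mult[of p q] by auto
  then have "k \<in> Poly_Mapping.keys a \<union> Poly_Mapping.keys b"
    using m(2) Poly_Mapping.keys_add[of a b] by auto
  then show "k \<in> pvars p \<union> pvars q" using ab by (auto simp: pvars_def)
qed

lemma Mould_closed:
  assumes n: "n \<ge> 1"
  shows "rconst c \<in> op_set Mould n" "k \<in> {1..n} \<Longrightarrow> uvar k \<in> op_set Mould n"
    "f \<in> op_set Mould n \<Longrightarrow> g \<in> op_set Mould n \<Longrightarrow> f + g \<in> op_set Mould n"
    "f \<in> op_set Mould n \<Longrightarrow> g \<in> op_set Mould n \<Longrightarrow> f * g \<in> op_set Mould n"
    "f \<in> op_set Mould n \<Longrightarrow> g \<in> op_set Mould n \<Longrightarrow> f / g \<in> op_set Mould n"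
proof -
  have c: "pvars (Poly_Mapping.single 0 c) = {}" for c :: rat
    by (cases "c = 0") (auto simp: pvars_def)
  have 1: "pvars (1::ratpoly) = {}" using c[of 1] by simp
  have 0: "pvars (0::ratpoly) = {}" by (simp add: pvars_def)
  have mk: "Fract a b \<in> op_set Mould n" if "b \<noteq> 0" "pvars a \<subseteq> {1..n}" "pvars b \<subseteq> {1..n}" for a b
    unfolding Mould_set_iff using n that by blast
  show "rconst c \<in> op_set Mould n"
    by (simp add: rconst_def mk c 1)
  show "uvar k \<in> op_set Mould n" if "k \<in> {1..n}"
  proof -
    have "pvars (pvar k) \<subseteq> {1..n}" using that by (auto simp: pvars_def pvar_def)
    then show ?thesis by (simp add: uvar_eq_Fract mk 1)
  qed
  assume f: "f \<in> op_set Mould n" and g: "g \<in> op_set Mould n"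
  obtain p q where f: "f = Fract p q" "q \<noteq> 0" "pvars p \<subseteq> {1..n}" "pvars q \<subseteq> {1..n}"
    using f Mould_set_iff by blast
  obtain p' q' where g: "g = Fract p' q'" "q' \<noteq> 0" "pvars p' \<subseteq> {1..n}" "pvars q' \<subseteq> {1..n}"
    using g Mould_set_iff by blast
  note M = pvars_mult[THEN order_trans] pvars_add[THEN order_trans]
  have fg: "f + g = Fract (p * q' + p' * q) (q * q')" "f * g = Fract (p * p') (q * q')"
    using f g by simp_all
  show "f + g \<in> op_set Mould n" "f * g \<in> op_set Mould n"
    unfolding fg using f g by (simp_all add: mk M)
  show "f / g \<in> op_set Mould n"
  proof (cases "p' = 0")
    case True
    then have "f / g = Fract 0 1" using g by (simp add: fract_collapse)
    then show ?thesis by (simp add: mk 0 1)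
  next
    case False
    have "f / g = Fract (p * q') (q * p')" using f g by simp
    then show ?thesis using f g False by (simp add: mk M)
  qed
qed

lemma Mould_sum_closed:
  assumes n: "n \<ge> 1"
  shows "(\<And>x. x \<in> A \<Longrightarrow> f x \<in> op_set Mould n) \<Longrightarrow> sum f A \<in> op_set Mould n"
    "(\<And>x. x \<in> A \<Longrightarrow> f x \<in> op_set Mould n) \<Longrightarrow> prod f A \<in> op_set Mould n"
  using Mould_closed(1)[OF n, of 0] Mould_closed(1)[OF n, of 1]
  by (induction A rule: infinite_finite_induct)
    (auto simp: Mould_closed[OF n] ring_hom1_D[OF ring_hom1_rconst])

lemma Mould_power_closed:
  assumes n: "n \<ge> 1" and "f \<in> op_set Mould n"
  shows "f ^ k \<in> op_set Mould n"
  using Mould_closed(1)[OF n, of 1] assms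
  by (induction k) (auto simp: Mould_closed[OF n] ring_hom1_D[OF ring_hom1_rconst])

lemma usum_in_Mould: "1 \<le> a \<Longrightarrow> b \<le> n \<Longrightarrow> n \<ge> 1 \<Longrightarrow> usum a b \<in> op_set Mould n"
  unfolding usum_def by (intro Mould_sum_closed Mould_closed) auto

lemma poly_hom_eq:
  fixes h :: "ratfun \<Rightarrow> ratfun"
  assumes h: "ring_hom1 h" and c: "\<And>a. h (rconst a) = rconst a"
  shows "h (Fract p 1) = poly_eval rconst (\<lambda>k. h (uvar k)) p"
  using ring_hom1_eq_poly_eval[OF ring_hom1_comp[OF h ring_hom1_Fract], of p] c
  by (simp add: rconst_def[symmetric] uvar_eq_Fract[symmetric])

lemma poly_eval_cong:
  "(\<And>k. k \<in> pvars p \<Longrightarrow> s k = t k) \<Longrightarrow> poly_eval c s p = poly_eval c t p"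
  unfolding poly_eval_def mono_eval_def pvars_def
  by (intro sum.cong arg_cong2[of _ _ _ _ "(*)"] prod.cong) (auto intro!: arg_cong2[of _ _ _ _ "(^)"])

lemma Fract_eq_quotient: "q \<noteq> 0 \<Longrightarrow> Fract p q = (Fract p 1 / Fract q 1 :: ratfun)"
  by simp

text \<open>A homomorphism on \<open>Mould(n)\<close> is determined by its values on the variables.\<close>

lemma Mould_hom_eq:
  fixes g h :: "ratfun \<Rightarrow> ratfun"
  assumes "ring_hom1 g" "ring_hom1 h" "\<And>a. g (rconst a) = rconst a" "\<And>a. h (rconst a) = rconst a"
    and "\<And>k. k \<in> {1..n} \<Longrightarrow> g (uvar k) = h (uvar k)" and "f \<in> op_set Mould n"
  shows "g f = h f"
proof -
  obtain p q where f: "f = Fract p q" "q \<noteq> 0" "pvars p \<subseteq> {1..n}" "pvars q \<subseteq> {1..n}"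
    using assms(6) Mould_set_iff by blast
  have "g (Fract p 1) = h (Fract p 1)" if "pvars p \<subseteq> {1..n}" for p
    unfolding poly_hom_eq[OF assms(1,3)] poly_hom_eq[OF assms(2,4)]
    using that by (intro poly_eval_cong assms(5)) auto
  then show ?thesis
    using f(3,4) unfolding f(1) Fract_eq_quotient[OF f(2), of p] ring_hom1_field(3)[OF assms(1)]
      ring_hom1_field(3)[OF assms(2)] by metis
qed

lemma Mould_hom_closed:
  fixes h :: "ratfun \<Rightarrow> ratfun"
  assumes N: "N \<ge> 1" and h: "ring_hom1 h" "\<And>a. h (rconst a) = rconst a"
    and "\<And>k. k \<in> {1..n} \<Longrightarrow> h (uvar k) \<in> op_set Mould N" and "f \<in> op_set Mould n"
  shows "h f \<in> op_set Mould N"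
proof -
  obtain p q where f: "f = Fract p q" "q \<noteq> 0" "pvars p \<subseteq> {1..n}" "pvars q \<subseteq> {1..n}"
    using assms(5) Mould_set_iff by blast
  have "h (Fract p 1) \<in> op_set Mould N" if "pvars p \<subseteq> {1..n}" for p
    unfolding poly_hom_eq[OF h] poly_eval_def mono_eval_def using that
    by (intro Mould_sum_closed Mould_closed Mould_power_closed N assms(4)) (auto simp: pvars_def)
  then show ?thesis
    using f(3,4) unfolding f(1) Fract_eq_quotient[OF f(2), of p] ring_hom1_field(3)[OF h(1)]
    by (intro Mould_closed(5)[OF N])
qed

lemma uvar_nonzero [simp]: "uvar k \<noteq> 0"
proof -
  have "pvar k \<noteq> 0" using poly_eval_pvar[OF ring_hom1_rconst, of "\<lambda>_. 1" k]
    by (auto simp: poly_eval_def)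
  then show ?thesis by (simp add: uvar_eq_Fract eq_fract Zero_fract_def)
qed

lemma ring_hom1_id: "ring_hom1 (\<lambda>x. x)"
  by (simp add: ring_hom1_def)

lemma ns_operad_Mould: "ns_operad Mould"
proof
  show "op_set Mould 0 = {}" by (simp add: Mould_def)
  have unit: "op_unit Mould = 1 / uvar 1" by (simp add: Mould_def)
  show "op_unit Mould \<in> op_set Mould 1"
    unfolding unit using Mould_closed(1)[of 1 1]
    by (intro Mould_closed) (auto simp: ring_hom1_D[OF ring_hom1_rconst])
next
  fix x y m n i assume x: "x \<in> op_set Mould m" and y: "y \<in> op_set Mould n"
    and i: "1 \<le> i" "i \<le> (m::nat)"
  have mn: "m \<ge> 1" "n \<ge> 1" using x y by (auto simp: Mould_def)
  note S = outer_subst_simps[OF mn(2)] and T = inner_subst_simps[OF i(1)]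
  have N: "m + n - 1 \<ge> 1" using mn by simp
  show "op_comp Mould m n i x y \<in> op_set Mould (m + n - 1)"
    unfolding Mould_comp
  proof (intro Mould_closed[OF N] Mould_hom_closed[OF N S(1) S(2) _ x]
      Mould_hom_closed[OF N T(1) T(2) _ y] usum_in_Mould)
    fix k assume k: "k \<in> {1..m}"
    consider "k < i" | "k = i" | "k > i" by linarith
    then show "outer_subst i n (uvar k) \<in> op_set Mould (m + n - 1)"
      using k mn i by cases (auto simp: S intro!: Mould_closed usum_in_Mould)
  next
    fix k assume "k \<in> {1..n}"
    then show "inner_subst i (uvar k) \<in> op_set Mould (m + n - 1)"
      using i mn by (auto simp: T intro!: Mould_closed)
  qed (use i mn in auto)
next
  fix x n assume x: "x \<in> op_set Mould n"
  then have n: "n \<ge> 1" by (auto simp: Mould_def)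
  have "inner_subst 1 x = x"
    by (rule Mould_hom_eq[OF _ ring_hom1_id _ _ _ x]) (simp_all add: inner_subst_simps)
  moreover have "outer_subst 1 n (1 / uvar 1) = 1 / usum 1 n"
    using n by (simp add: ring_hom1_field(3)[OF outer_subst_simps(1)] outer_subst_simps
        ring_hom1_D[OF outer_subst_simps(1)])
  moreover have "usum 1 n \<noteq> 0"
  proof -
    have "outer_subst 1 n (uvar 1) \<noteq> 0"
      using ring_hom1_field(1)[OF outer_subst_simps(1)[OF n], of 1 "uvar 1"] by simp
    then show ?thesis using n by (simp add: outer_subst_simps)
  qed
  ultimately show "op_comp Mould 1 n 1 (op_unit Mould) x = x"
    by (simp add: Mould_comp) (simp add: Mould_def)
next
  fix x m i assume x: "x \<in> op_set Mould m" and i: "1 \<le> i" "i \<le> (m::nat)"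
  have o: "(1::nat) \<le> 1" by simp
  have "outer_subst i 1 x = x"
  proof (rule Mould_hom_eq[OF _ ring_hom1_id _ _ _ x])
    fix k
    consider "k < i" | "k = i" | "k > i" by linarith
    then show "outer_subst i 1 (uvar k) = uvar k" by cases (auto simp: outer_subst_simps)
  qed (simp_all add: outer_subst_simps)
  moreover have "inner_subst i (1 / uvar 1) = 1 / uvar i"
    using i by (simp add: ring_hom1_field(3)[OF inner_subst_simps(1)] inner_subst_simps
        ring_hom1_D[OF inner_subst_simps(1)])
  ultimately show "op_comp Mould m 1 i x (op_unit Mould) = x"
    by (simp add: Mould_comp) (simp add: Mould_def)
next
  fix x y z l m n i j
  assume x: "x \<in> op_set Mould l" and y: "y \<in> op_set Mould m" and z: "z \<in> op_set Mould n"
    and i: "1 \<le> i" "i \<le> (l::nat)" and j: "1 \<le> j" "j \<le> (m::nat)"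
  have n: "n \<ge> 1" and m: "m \<ge> 1" using y z by (auto simp: Mould_def)
  have ij: "i + j - 1 \<ge> 1" and mn: "m + n - 1 \<ge> 1" using i j n by auto
  note S = outer_subst_simps and T = inner_subst_simps
  note H = S(1)[OF n] S(1)[OF m] S(1)[OF mn] T(1)[OF i(1)] T(1)[OF j(1)] T(1)[OF ij]
  note C = ring_hom1_comp[OF H(1) H(2)] ring_hom1_comp[OF H(1) H(4)]
    ring_hom1_comp[OF H(4) H(1)] ring_hom1_comp[OF H(4) H(5)]
  have xx: "outer_subst (i + j - 1) n (outer_subst i m x) = outer_subst i (m + n - 1) x"
  proof (rule Mould_hom_eq[OF C(1) H(3) _ _ _ x])
    fix k
    consider "k < i" | "k = i" | "k > i" by linarith
    then show "outer_subst (i + j - 1) n (outer_subst i m (uvar k))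
        = outer_subst i (m + n - 1) (uvar k)"
      using i j n m mn by cases (simp_all add: S outer_subst_usum add.assoc)
  qed (simp_all add: S n m mn)
  have yy: "outer_subst (i + j - 1) n (inner_subst i y) = inner_subst i (outer_subst j n y)"
  proof (rule Mould_hom_eq[OF C(2) C(3) _ _ _ y])
    fix k
    consider "k < j" | "k = j" | "k > j" by linarith
    then show "outer_subst (i + j - 1) n (inner_subst i (uvar k))
        = inner_subst i (outer_subst j n (uvar k))"
    proof cases
      case 2
      have e: "k + i - 1 = i + j - 1" "j + n - 1 + i - 1 = i + j - 1 + n - 1" "j + i - 1 = i + j - 1"
        using 2 i j n by auto
      have "outer_subst (i + j - 1) n (inner_subst i (uvar k)) = usum (i + j - 1) (i + j - 1 + n - 1)"
        by (simp only: T(3)[OF i(1)] e S(4)[OF n])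
      moreover have "inner_subst i (outer_subst j n (uvar k)) = usum (i + j - 1) (i + j - 1 + n - 1)"
        by (simp only: 2 S(4)[OF n] inner_subst_usum[OF i(1)] e)
      ultimately show ?thesis by simp
    next
      case 3
      have e: "k + i - 1 + n - 1 = k + n - 1 + i - 1" "k + i - 1 > i + j - 1" using 3 i j n by auto
      show ?thesis by (simp only: T(3)[OF i(1)] S(5)[OF n e(2)] S(5)[OF n 3] e(1))
    qed (use i j n in \<open>simp_all add: S T\<close>)
  qed (simp_all add: S T n i)
  have zz: "inner_subst (i + j - 1) z = inner_subst i (inner_subst j z)"
    by (rule Mould_hom_eq[OF H(6) C(4) _ _ _ z])
      (use i j ij in \<open>simp_all add: T ac_simps\<close>)
  have u1: "outer_subst (i + j - 1) n (usum i (i + m - 1)) = usum i (i + (m + n - 1) - 1)"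
    using i j n m by (simp add: outer_subst_usum add.assoc)
  have u2: "inner_subst i (usum j (j + n - 1)) = usum (i + j - 1) (i + j - 1 + n - 1)"
    using i j n m by (simp add: inner_subst_usum ac_simps)
  show "op_comp Mould (l + m - 1) n (i + j - 1) (op_comp Mould l m i x y) z
        = op_comp Mould l (m + n - 1) i x (op_comp Mould m n j y z)"
    unfolding Mould_comp ring_hom1_D(3)[OF H(1)] ring_hom1_D(3)[OF H(4)] xx yy zz u1 u2
    by (simp only: mult.assoc mult.commute mult.left_commute)
next
  fix x y z l m n i k
  assume x: "x \<in> op_set Mould l" and y: "y \<in> op_set Mould m" and z: "z \<in> op_set Mould n"
    and i: "1 \<le> i" and k: "i < k" "k \<le> (l::nat)"
  have n: "n \<ge> 1" and m: "m \<ge> 1" using y z by (auto simp: Mould_def)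
  have k1: "k \<ge> 1" and km: "k + m - 1 \<ge> 1" using k m by auto
  note S = outer_subst_simps and T = inner_subst_simps
  note H = S(1)[OF n] S(1)[OF m] T(1)[OF i(1)] T(1)[OF k1] T(1)[OF km]
  note C = ring_hom1_comp[OF H(1) H(2)] ring_hom1_comp[OF H(2) H(1)]
    ring_hom1_comp[OF H(1) H(3)] ring_hom1_comp[OF H(2) H(4)]
  have xx: "outer_subst (k + m - 1) n (outer_subst i m x) = outer_subst i m (outer_subst k n x)"
  proof (rule Mould_hom_eq[OF C(1) C(2) _ _ _ x])
    fix j
    consider "j < i" | "j = i" | "j > i" "j < k" | "j = k" | "j > k" by linarith
    then show "outer_subst (k + m - 1) n (outer_subst i m (uvar j))
        = outer_subst i m (outer_subst k n (uvar j))"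
    proof cases
      case 3
      have e: "j + m - 1 < k + m - 1" using 3 m by simp
      show ?thesis by (simp only: S(5)[OF m 3(1)] S(3)[OF n e] S(3)[OF n 3(2)])
    next
      case 4
      have e: "i < k" "j + m - 1 = k + m - 1" "k + n - 1 + m - 1 = k + m - 1 + n - 1"
        using 4 k m n by auto
      show ?thesis by (simp only: 4 S(5)[OF m e(1)] S(4)[OF n] outer_subst_usum(2)[OF m e(1)] e)
    next
      case 5
      have e: "i < j" "k + m - 1 < j + m - 1" "i < j + n - 1"
        "j + m - 1 + n - 1 = j + n - 1 + m - 1" using 5 k m n by auto
      show ?thesis by (simp only: S(5)[OF m e(1)] S(5)[OF n e(2)] S(5)[OF n 5] S(5)[OF m e(3)] e(4))
    qed (use i k n m in \<open>simp_all add: S outer_subst_usum\<close>)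
  qed (simp_all add: S n m)
  have yy: "outer_subst (k + m - 1) n (inner_subst i y) = inner_subst i y"
  proof (rule Mould_hom_eq[OF C(3) H(3) _ _ _ y])
    fix j assume j: "j \<in> {1..m}"
    have e: "j + i - 1 < k + m - 1" using j i k by auto
    show "outer_subst (k + m - 1) n (inner_subst i (uvar j)) = inner_subst i (uvar j)"
      by (simp only: T(3)[OF i(1)] S(3)[OF n e])
  qed (simp_all only: S(2)[OF n] T(2)[OF i(1)])
  have zz: "outer_subst i m (inner_subst k z) = inner_subst (k + m - 1) z"
  proof (rule Mould_hom_eq[OF C(4) H(5) _ _ _ z])
    fix j assume j: "j \<in> {1..n}"
    have e: "j + k - 1 > i" "j + k - 1 + m - 1 = j + (k + m - 1) - 1" using j i k m by auto
    show "outer_subst i m (inner_subst k (uvar j)) = inner_subst (k + m - 1) (uvar j)"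
      by (simp only: T(3)[OF k1] T(3)[OF km] S(5)[OF m e(1)] e(2))
  qed (simp_all only: S(2)[OF m] T(2)[OF k1] T(2)[OF km])
  have u1: "outer_subst (k + m - 1) n (usum i (i + m - 1)) = usum i (i + m - 1)"
    using i k n m by (simp add: outer_subst_usum)
  have u2: "outer_subst i m (usum k (k + n - 1)) = usum (k + m - 1) (k + m - 1 + n - 1)"
  proof -
    have e: "k + n - 1 + m - 1 = k + m - 1 + n - 1" using m n k by auto
    show ?thesis by (simp only: outer_subst_usum(2)[OF m k(1)] e)
  qed
  show "op_comp Mould (l + m - 1) n (k + m - 1) (op_comp Mould l m i x y) z
        = op_comp Mould (l + n - 1) m i (op_comp Mould l n k x z) y"
    unfolding Mould_comp ring_hom1_D(3)[OF H(1)] ring_hom1_D(3)[OF H(2)] xx yy zz u1 u2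
    by (simp only: mult.assoc mult.commute mult.left_commute)
qed

section \<open>Rational functions of trees\<close>

text \<open>
  The function of a tree whose leaves are the sides between the vertices \<open>p, \<dots>, p + size1 t\<close>. The
  two subtrees of a node meet at the vertex \<open>m\<close>, the last vertex is \<open>q\<close>, and \<open>gen_factor\<close> is the
  contribution of the generator at the node.
\<close>

fun gen_factor :: "ncp_gen \<Rightarrow> nat \<Rightarrow> nat \<Rightarrow> nat \<Rightarrow> ratfun" where
  "gen_factor GenA p m q = usum (m + 1) q / usum (p + 1) q"
| "gen_factor GenB p m q = usum (p + 1) m / usum (p + 1) q"
| "gen_factor GenC p m q = 1"

fun tree_fun :: "nat \<Rightarrow> ncp_gen tree \<Rightarrow> ratfun" where
  "tree_fun p Leaf = 1 / uvar (p + 1)"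
| "tree_fun p (Node l g r) = tree_fun p l * tree_fun (p + size1 l) r
     * gen_factor g p (p + size1 l) (p + size1 l + size1 r)"

lemma size1_ge1: "size1 t \<ge> 1"
  using size1_ge0[of t] by linarith

lemma size1_graft: "1 \<le> i \<Longrightarrow> i \<le> size1 s \<Longrightarrow> size1 (graft s i t) = size1 s + size1 t - 1"
proof (induction s arbitrary: i)
  case (Node l g r)
  then show ?case using size1_ge1[of l] size1_ge1[of r] by auto
qed simp

lemma usum_nonzero:
  assumes "a \<le> b"
  shows "usum a b \<noteq> 0"
proof -
  have n: "b - a + 1 \<ge> 1" by simp
  have "outer_subst a (b - a + 1) (uvar a) \<noteq> 0"
    using ring_hom1_field(1)[OF outer_subst_simps(1)[OF n], of a "uvar a"] by simp
  then show ?thesis using assms outer_subst_simps(4)[OF n, of a] by simp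
qed

lemma tree_fun_inner: "inner_subst (j + 1) (tree_fun p t) = tree_fun (p + j) t"
proof (induction t arbitrary: p)
  case Leaf
  have j: "j + 1 \<ge> 1" by simp
  show ?case
    by (simp add: ring_hom1_field(3)[OF inner_subst_simps(1)[OF j]] inner_subst_simps[OF j]
        ring_hom1_D[OF inner_subst_simps(1)[OF j]] add.assoc)
next
  case (Node l g r)
  have j: "j + 1 \<ge> 1" by simp
  note H = inner_subst_simps(1)[OF j]
  have "inner_subst (j + 1) (gen_factor g p m q) = gen_factor g (p + j) (m + j) (q + j)" for p m q
    by (cases g) (simp_all add: ring_hom1_field(3)[OF H] ring_hom1_D[OF H] inner_subst_usum[OF j]
        add.assoc)
  moreover have "p + j + size1 l = p + size1 l + j" "p + size1 l + j + size1 r = p + size1 l + size1 r + j"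
    by simp_all
  ultimately show ?case by (simp only: tree_fun.simps ring_hom1_D(3)[OF H] Node)
qed

lemma tree_fun_outer_below:
  assumes "n \<ge> 1"
  shows "q + size1 t < P \<Longrightarrow> outer_subst P n (tree_fun q t) = tree_fun q t"
proof (induction t arbitrary: q)
  case Leaf
  note H = outer_subst_simps(1)[OF assms]
  show ?case using Leaf
    by (simp add: ring_hom1_field(3)[OF H] outer_subst_simps[OF assms] ring_hom1_D[OF H])
next
  case (Node l g r)
  note H = outer_subst_simps(1)[OF assms]
  have "outer_subst P n (gen_factor g q m k) = gen_factor g q m k" if "m < P" "k < P" for m k
    using that by (cases g)
      (simp_all add: ring_hom1_field(3)[OF H] ring_hom1_D[OF H] outer_subst_usum[OF assms])
  then show ?case using Node by (simp add: ring_hom1_D(3)[OF H])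
qed

lemma tree_fun_outer_above:
  assumes "n \<ge> 1"
  shows "P \<le> q \<Longrightarrow> outer_subst P n (tree_fun q t) = tree_fun (q + n - 1) t"
proof (induction t arbitrary: q)
  case Leaf
  note H = outer_subst_simps(1)[OF assms]
  show ?case using Leaf assms
    by (simp add: ring_hom1_field(3)[OF H] outer_subst_simps[OF assms] ring_hom1_D[OF H])
next
  case (Node l g r)
  note H = outer_subst_simps(1)[OF assms]
  have e: "q + n - 1 + 1 = q + 1 + n - 1" "q + size1 l + n - 1 = q + n - 1 + size1 l"
    "q + size1 l + size1 r + n - 1 = q + n - 1 + size1 l + size1 r"
    "m + n - 1 + 1 = m + 1 + n - 1" for m using assms by auto
  have "outer_subst P n (gen_factor g q m k)
      = gen_factor g (q + n - 1) (m + n - 1) (k + n - 1)" if "P \<le> m" for m k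
  proof -
    have c: "P < q + 1" "P < m + 1" using that Node.prems by auto
    show ?thesis
      by (cases g) (simp_all only: ring_hom1_field(3)[OF H] ring_hom1_D[OF H] gen_factor.simps
          e(1,4) outer_subst_usum(2)[OF assms c(1)] outer_subst_usum(2)[OF assms c(2)])
  qed
  from this[of "q + size1 l" "q + size1 l + size1 r"] Node.IH(1)[of q] Node.IH(2)[of "q + size1 l"]
    Node.prems show ?case by (simp only: tree_fun.simps ring_hom1_D(3)[OF H] e(2,3) trans_le_add1)
qed

text \<open>Grafting of trees becomes composition of rational functions.\<close>

lemma tree_fun_graft:
  assumes "1 \<le> i" "i \<le> size1 s"
  shows "tree_fun p (graft s i t) = usum (p + i) (p + i + size1 t - 1)
     * outer_subst (p + i) (size1 t) (tree_fun p s) * tree_fun (p + i - 1) t"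
  using assms
proof (induction s arbitrary: p i)
  case Leaf
  note n = size1_ge1[of t]
  note H = outer_subst_simps(1)[OF n]
  have "i = 1" using Leaf by (simp add: size1_ge1)
  moreover have "usum (p + 1) (p + 1 + size1 t - 1) \<noteq> 0" using n by (intro usum_nonzero) simp
  moreover have "outer_subst (p + 1) (size1 t) (1 / uvar (p + 1))
      = 1 / usum (p + 1) (p + 1 + size1 t - 1)"
    by (simp only: ring_hom1_field(3)[OF H] ring_hom1_D(1)[OF H] outer_subst_simps(4)[OF n])
  ultimately show ?case by simp
next
  case (Node l g r)
  let ?n = "size1 t" and ?m = "size1 l" and ?k = "size1 r"
  note n = size1_ge1[of t]
  note H = outer_subst_simps(1)[OF n]
  show ?case
  proof (cases "i \<le> ?m")
    case True
    have e: "p + ?m + ?n - 1 = p + (?m + ?n - 1)" "p + ?m + ?k + ?n - 1 = p + (?m + ?n - 1) + ?k"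
      "p + ?m + 1 + ?n - 1 = p + (?m + ?n - 1) + 1"
      using n by auto
    have c: "p + 1 \<le> p + i" "p + i \<le> p + ?m" "p + i \<le> p + ?m + ?k" "p + i < p + ?m + 1"
      using True Node.prems by auto
    note U = outer_subst_usum(3)[OF n c(1) c(2)] outer_subst_usum(3)[OF n c(1) c(3)]
      outer_subst_usum(2)[OF n c(4)]
    have "outer_subst (p + i) ?n (gen_factor g p (p + ?m) (p + ?m + ?k))
       = gen_factor g p (p + (?m + ?n - 1)) (p + (?m + ?n - 1) + ?k)"
      by (cases g)
        (simp_all only: gen_factor.simps ring_hom1_field(3)[OF H] ring_hom1_D[OF H] U e)
    moreover have "outer_subst (p + i) ?n (tree_fun (p + ?m) r) = tree_fun (p + (?m + ?n - 1)) r"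
      using tree_fun_outer_above[OF n, of "p + i" "p + ?m" r] c e(1) by simp
    moreover have "tree_fun p (graft (Node l g r) i t) = tree_fun p (graft l i t)
      * tree_fun (p + (?m + ?n - 1)) r * gen_factor g p (p + (?m + ?n - 1)) (p + (?m + ?n - 1) + ?k)"
      using True Node.prems by (simp add: size1_graft)
    ultimately show ?thesis
      using Node.IH(1)[of i p] True Node.prems(1)
      by (simp only: tree_fun.simps ring_hom1_D(3)[OF H] mult.assoc mult.commute mult.left_commute)
  next
    case False
    define j where "j = i - ?m"
    have j: "1 \<le> j" "j \<le> ?k" "i = ?m + j" using False Node.prems by (auto simp: j_def)
    have e: "p + ?m + ?k + ?n - 1 = p + ?m + (?k + ?n - 1)" using n by auto
    have c: "p + 1 \<le> p + i" "p + ?m + 1 \<le> p + i" "p + i \<le> p + ?m + ?k" "p + ?m < p + i"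
      using j by auto
    note U = outer_subst_usum(3)[OF n c(1) c(3)] outer_subst_usum(3)[OF n c(2) c(3)]
      outer_subst_usum(1)[OF n c(4)]
    have "outer_subst (p + i) ?n (gen_factor g p (p + ?m) (p + ?m + ?k))
       = gen_factor g p (p + ?m) (p + ?m + (?k + ?n - 1))"
      by (cases g)
        (simp_all only: gen_factor.simps ring_hom1_field(3)[OF H] ring_hom1_D[OF H] U e)
    moreover have "outer_subst (p + i) ?n (tree_fun p l) = tree_fun p l"
      using tree_fun_outer_below[OF n c(4)] .
    moreover have "tree_fun p (graft (Node l g r) i t) = tree_fun p l
      * tree_fun (p + ?m) (graft r j t) * gen_factor g p (p + ?m) (p + ?m + (?k + ?n - 1))"
      using j size1_ge1[of l] by (simp add: size1_graft)
    moreover have "p + ?m + j = p + i" using j by simp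
    ultimately show ?thesis
      using Node.IH(2)[of j "p + ?m"] j(1,2)
      by (simp only: tree_fun.simps ring_hom1_D(3)[OF H] mult.assoc mult.commute mult.left_commute)
  qed
qed

lemma tree_fun_comp:
  assumes "1 \<le> i" "i \<le> size1 s"
  shows "tree_fun 0 (graft s i t) = op_comp Mould m (size1 t) i (tree_fun 0 s) (tree_fun 0 t)"
  using tree_fun_graft[OF assms, of 0 t] tree_fun_inner[of "i - 1" 0 t] assms
  by (simp add: Mould_comp)

lemma tree_fun_Mould: "p + size1 t \<le> n \<Longrightarrow> tree_fun p t \<in> op_set Mould n"
proof (induction t arbitrary: p)
  case Leaf
  then show ?case using Mould_closed(1)[of n 1]
    by (auto intro!: Mould_closed simp: ring_hom1_D[OF ring_hom1_rconst])
next
  case (Node l g r)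
  have n: "n \<ge> 1" using Node.prems size1_ge1[of l] by simp
  have "gen_factor g p (p + size1 l) (p + size1 l + size1 r) \<in> op_set Mould n"
    using n Node.prems Mould_closed(1)[of n 1]
    by (cases g) (auto intro!: Mould_closed usum_in_Mould simp: ring_hom1_D[OF ring_hom1_rconst])
  then show ?case using Node n by (auto intro!: Mould_closed)
qed

section \<open>Exponents of the linear forms\<close>

text \<open>The exponents of a single linear form.\<close>

definition delta :: "'a \<Rightarrow> 'a \<Rightarrow> int" where
  "delta d e = (if e = d then 1 else 0)"

text \<open>The exponents of \<open>gen_factor\<close> and of \<open>tree_fun\<close>.\<close>

fun gen_expo :: "ncp_gen \<Rightarrow> nat \<Rightarrow> nat \<Rightarrow> nat \<Rightarrow> nat \<times> nat \<Rightarrow> int" where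
  "gen_expo GenA p m q d = delta (m, q) d - delta (p, q) d"
| "gen_expo GenB p m q d = delta (p, m) d - delta (p, q) d"
| "gen_expo GenC p m q d = 0"

fun expo :: "nat \<Rightarrow> ncp_gen tree \<Rightarrow> nat \<times> nat \<Rightarrow> int" where
  "expo p Leaf d = - delta (p, p + 1) d"
| "expo p (Node l g r) d = expo p l d + expo (p + size1 l) r d
     + gen_expo g p (p + size1 l) (p + size1 l + size1 r) d"

lemma finite_diagonals [simp]: "finite (diagonals n)"
  by (rule finite_subset[of _ "{..n} \<times> {..n}"]) (auto simp: diagonals_def)

lemma diag_form_nonzero: "fst d < snd d \<Longrightarrow> diag_form d \<noteq> 0"
  by (simp add: diag_form_def usum_nonzero)

lemma prod_powi_delta:
  assumes "finite A" "d \<in> A"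
  shows "(\<Prod>e\<in>A. (f e :: 'b :: field) powi delta d e) = f d"
proof -
  have "(\<Prod>e\<in>A. f e powi delta d e) = (\<Prod>e\<in>A. if e = d then f e else 1)"
    by (rule prod.cong) (auto simp: delta_def)
  then show ?thesis using assms by simp
qed

lemma prod_powi_add:
  assumes "\<And>d. d \<in> A \<Longrightarrow> f d \<noteq> (0 :: 'b :: field)"
  shows "(\<Prod>d\<in>A. f d powi (e d + e' d)) = (\<Prod>d\<in>A. f d powi e d) * (\<Prod>d\<in>A. f d powi e' d)"
  using assms by (simp add: power_int_add prod.distrib[symmetric])

lemma prod_powi_uminus:
  "(\<Prod>d\<in>A. (f d :: 'b :: field) powi (- e d)) = inverse (\<Prod>d\<in>A. f d powi e d)"
  by (simp add: power_int_minus prod_inversef[symmetric] o_def)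

lemma tree_fun_eq_prod:
  "p + size1 t \<le> n \<Longrightarrow> tree_fun p t = (\<Prod>d\<in>diagonals n. diag_form d powi expo p t d)"
proof (induction t arbitrary: p)
  case Leaf
  then have "(p, p + 1) \<in> diagonals n" by (auto simp: diagonals_def)
  then show ?case
    by (simp add: prod_powi_uminus prod_powi_delta) (simp add: diag_form_def field_simps)
next
  case (Node l g r)
  let ?m = "p + size1 l" and ?q = "p + size1 l + size1 r"
  have nz: "diag_form d \<noteq> 0" if "d \<in> diagonals n" for d
    using that by (auto simp: diagonals_def intro!: diag_form_nonzero)
  have d: "(p, ?m) \<in> diagonals n" "(?m, ?q) \<in> diagonals n" "(p, ?q) \<in> diagonals n"
    using Node.prems size1_ge1[of l] size1_ge1[of r] by (auto simp: diagonals_def)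
  have "gen_factor g p ?m ?q = (\<Prod>d\<in>diagonals n. diag_form d powi gen_expo g p ?m ?q d)"
  proof -
    have "(\<Prod>c\<in>diagonals n. diag_form c powi (delta d c - delta d' c)) = diag_form d / diag_form d'"
      if "d \<in> diagonals n" "d' \<in> diagonals n" for d d'
      using that by (simp only: diff_conv_add_uminus prod_powi_add[OF nz] prod_powi_uminus
          prod_powi_delta finite_diagonals divide_inverse)
    then show ?thesis using d by (cases g) (simp_all add: diag_form_def)
  qed
  then show ?case using Node by (simp add: prod_powi_add[OF nz])
qed

text \<open>
  The linear forms of distinct diagonals are multiplicatively independent: with
  \<open>u\<^sub>k = h k - h (k - 1)\<close>, the form of the diagonal \<open>(i, j)\<close> takes the value \<open>h j - h i\<close>. A function
  \<open>h\<close> that is injective except for \<open>h i = h j\<close> kills this one form and no other.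
\<close>

lemma sum_pvar_potential:
  fixes h :: "nat \<Rightarrow> rat"
  assumes "i \<le> j"
  shows "poly_eval (\<lambda>a. a) (\<lambda>k. h k - h (k - 1)) (\<Sum>k=i+1..j. pvar k) = h j - h i"
proof -
  have "poly_eval (\<lambda>a. a) (\<lambda>k. h k - h (k - 1)) (\<Sum>k=i+1..j. pvar k)
      = (\<Sum>k=i+1..j. h k - h (k - 1))"
    by (simp add: poly_eval_sum poly_eval_pvar ring_hom1_def)
  also have "\<dots> = h j - h i" using sum_telescope''[OF assms, of h]
    by (simp add: One_nat_def)
  finally show ?thesis .
qed

lemma diag_forms_independent:
  assumes eq: "(\<Prod>d\<in>diagonals n. diag_form d powi e d) = (\<Prod>d\<in>diagonals n. diag_form d powi e' d)"
    and d: "d \<in> diagonals n"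
  shows "e d = e' d"
proof -
  define L where "L = (\<lambda>d. \<Sum>k=fst d+1..snd d. pvar k)"
  have L: "diag_form d = Fract (L d) 1" for d
    by (simp add: diag_form_def L_def usum_def uvar_eq_Fract ring_hom1_sum[OF ring_hom1_Fract])
  have nz: "diag_form d \<noteq> 0" if "d \<in> diagonals n" for d
    using that by (auto simp: diagonals_def intro!: diag_form_nonzero)
  let ?D = "diagonals n"
  have le: "f d \<le> g d" if fg: "(\<Prod>d\<in>?D. diag_form d powi f d) = (\<Prod>d\<in>?D. diag_form d powi g d)"
    for f g
  proof (rule ccontr)
    assume "\<not> f d \<le> g d"
    define F where "F = (\<lambda>d. f d - g d)"
    have F: "F d > 0" using \<open>\<not> f d \<le> g d\<close> by (simp add: F_def)
    have pw: "x powi k = x ^ nat k / x ^ nat (- k)" if "x \<noteq> 0" for x :: ratfun and k :: int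
      using that by (cases "k \<ge> 0") (simp_all add: power_int_def power_inverse divide_inverse)
    have "(\<Prod>d\<in>?D. diag_form d powi F d) * (\<Prod>d\<in>?D. diag_form d powi g d)
        = (\<Prod>d\<in>?D. diag_form d powi g d)"
      using fg by (simp add: F_def prod_powi_add[OF nz, symmetric])
    moreover have "(\<Prod>d\<in>?D. diag_form d powi g d) \<noteq> 0" using nz by simp
    ultimately have "(\<Prod>d\<in>?D. diag_form d powi F d) = 1" by simp
    then have "(\<Prod>d\<in>?D. diag_form d ^ nat (F d)) / (\<Prod>d\<in>?D. diag_form d ^ nat (- F d)) = 1"
      using nz by (simp add: pw prod_dividef)
    then have "(\<Prod>d\<in>?D. diag_form d ^ nat (F d)) = (\<Prod>d\<in>?D. diag_form d ^ nat (- F d))"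
      by (auto simp: divide_eq_1_iff)
    then have "Fract (\<Prod>d\<in>?D. L d ^ nat (F d)) 1 = Fract (\<Prod>d\<in>?D. L d ^ nat (- F d)) 1"
      by (simp add: ring_hom1_prod[OF ring_hom1_Fract] ring_hom1_D(7)[OF ring_hom1_Fract] L)
    then have PQ: "(\<Prod>d\<in>?D. L d ^ nat (F d)) = (\<Prod>d\<in>?D. L d ^ nat (- F d))"
      by (simp add: eq_fract)
    obtain i j where ij: "d = (i, j)" "i < j" using d by (cases d) (auto simp: diagonals_def)
    define h where "h = (\<lambda>k. if k = j then of_nat i else of_nat k :: rat)"
    define ev where "ev = poly_eval (\<lambda>a. a) (\<lambda>k. h k - h (k - 1))"
    have ev: "ring_hom1 ev" unfolding ev_def by (intro ring_hom1_poly_eval) (simp add: ring_hom1_def)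
    have evL: "ev (L d) = h (snd d) - h (fst d)" if "d \<in> ?D" for d
      unfolding ev_def L_def using that by (intro sum_pvar_potential) (auto simp: diagonals_def)
    have evP: "(\<Prod>d\<in>?D. ev (L d) ^ nat (F d)) = (\<Prod>d\<in>?D. ev (L d) ^ nat (- F d))"
      using arg_cong[OF PQ, of ev] by (simp add: ring_hom1_prod[OF ev] ring_hom1_D(7)[OF ev])
    have "ev (L d) = 0" using evL[OF d] ij by (simp add: h_def)
    then have "(\<Prod>d\<in>?D. ev (L d) ^ nat (F d)) = 0"
      using d F by (auto intro!: bexI[of _ d])
    moreover have "(\<Prod>d\<in>?D. ev (L d) ^ nat (- F d)) \<noteq> 0"
    proof -
      have "ev (L c) ^ nat (- F c) \<noteq> 0" if c: "c \<in> ?D" for c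
      proof (cases "c = d")
        case False
        then have "h (snd c) \<noteq> h (fst c)"
          using c ij by (cases c) (auto simp: h_def diagonals_def)
        then show ?thesis using evL[OF c] by simp
      qed (use F in simp)
      then show ?thesis by simp
    qed
    ultimately show False using evP by simp
  qed
  show ?thesis using le[OF eq] le[OF eq[symmetric]] by simp
qed

lemma expo_support:
  "expo p t d \<noteq> 0 \<Longrightarrow> p \<le> fst d \<and> fst d < snd d \<and> snd d \<le> p + size1 t"
proof (induction t arbitrary: p)
  case Leaf
  then show ?case by (auto simp: delta_def split: if_splits)
next
  case (Node l g r)
  have "p \<le> fst d \<and> fst d < snd d \<and> snd d \<le> p + size1 l + size1 r"
    if "gen_expo g p (p + size1 l) (p + size1 l + size1 r) d \<noteq> 0"
    using that size1_ge1[of l] size1_ge1[of r] by (cases g) (auto simp: delta_def split: if_splits)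
  moreover have "expo p l d \<noteq> 0 \<or> expo (p + size1 l) r d \<noteq> 0
      \<or> gen_expo g p (p + size1 l) (p + size1 l + size1 r) d \<noteq> 0"
    using Node.prems by auto
  ultimately show ?case using Node.IH(1)[of p] Node.IH(2)[of "p + size1 l"]
    by (simp only: size1.simps) linarith
qed

lemma tree_fun_eq_iff:
  assumes "size1 s = size1 t"
  shows "tree_fun p s = tree_fun p t \<longleftrightarrow> expo p s = expo p t"
proof
  assume "expo p s = expo p t"
  then show "tree_fun p s = tree_fun p t"
    using assms by (simp add: tree_fun_eq_prod[of p _ "p + size1 t"])
next
  assume eq: "tree_fun p s = tree_fun p t"
  show "expo p s = expo p t"
  proof
    fix d
    show "expo p s d = expo p t d"
    proof (cases "d \<in> diagonals (p + size1 t)")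
      case True
      show ?thesis
        by (rule diag_forms_independent[OF _ True])
          (use eq assms in \<open>simp add: tree_fun_eq_prod[of p _ "p + size1 t"]\<close>)
    next
      case False
      then show ?thesis
        using expo_support[of p s d] expo_support[of p t d] assms
        by (cases d) (metis (mono_tags, lifting) case_prod_conv diagonals_def fst_conv mem_Collect_eq
          snd_conv)
    qed
  qed
qed

lemma expo_shift: "expo (p + k) t (i + k, j + k) = expo p t (i, j)"
proof (induction t arbitrary: p)
  case (Node l g r)
  have "gen_expo g (p + k) (m + k) (q + k) (i + k, j + k) = gen_expo g p m q (i, j)" for m q
    by (cases g) (simp_all add: delta_def)
  from this[of "p + size1 l" "p + size1 l + size1 r"] show ?case
    using Node.IH(1)[of p] Node.IH(2)[of "p + size1 l"] by (simp add: add_ac)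
qed (simp add: delta_def)

section \<open>Congruence of trees and normal forms\<close>

text \<open>Congruence of trees modulo the four relations, in the appropriate arity.\<close>

definition tcong :: "ncp_gen tree \<Rightarrow> ncp_gen tree \<Rightarrow> bool" where
  "tcong s t \<longleftrightarrow> op_cong free_operad ncp_rels (size1 s) s t"

lemma free_operad_simps [simp]:
  "op_set free_operad n = {t. size1 t = n}" "op_unit free_operad = Leaf"
  "op_comp free_operad m n i s t = graft s i t"
  by (simp_all add: free_operad_def)

lemma op_cong_size: "op_cong free_operad R n s t \<Longrightarrow> size1 s = n \<and> size1 t = n"
  by (induction rule: op_cong.induct) (auto simp: size1_graft)

lemma op_cong_tcong: "op_cong free_operad ncp_rels n s t \<longleftrightarrow> size1 s = n \<and> tcong s t"
  unfolding tcong_def using op_cong_size by metis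

lemma tcong_refl [simp]: "tcong s s"
  by (simp add: tcong_def op_cong.refl)

lemma tcong_sym: "tcong s t \<Longrightarrow> tcong t s"
  using op_cong.sym op_cong_size unfolding tcong_def by metis

lemma tcong_trans [trans]: "tcong s t \<Longrightarrow> tcong t u \<Longrightarrow> tcong s u"
  using op_cong.trans op_cong_size unfolding tcong_def by metis

lemma tcong_size: "tcong s t \<Longrightarrow> size1 s = size1 t"
  using op_cong_size unfolding tcong_def by metis

lemma tcong_graft:
  assumes "tcong s s'" "tcong t t'" "1 \<le> i" "i \<le> size1 s"
  shows "tcong (graft s i t) (graft s' i t')"
  using op_cong.comp[of free_operad ncp_rels "size1 s" s s' "size1 t" t t' i] assms
  by (simp add: tcong_def size1_graft)

lemma Node_eq_graft: "Node l g r = graft (graft (corolla g) 2 r) 1 l"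
  by (simp add: corolla_def One_nat_def)

lemma tcong_Node:
  assumes "tcong l l'" "tcong r r'"
  shows "tcong (Node l g r) (Node l' g r')"
  unfolding Node_eq_graft
  by (intro tcong_graft assms tcong_refl) (auto simp: corolla_def One_nat_def)

lemma tcong_rel:
  assumes "(3, s, t) \<in> ncp_rels" "size1 s = 3" "size1 t = 3"
  shows "tcong (graft (graft (graft s 3 z) 2 y) 1 x) (graft (graft (graft t 3 z) 2 y) 1 x)"
proof -
  have "tcong s t" unfolding tcong_def using assms by (auto intro: op_cong.rel)
  then show ?thesis using size1_ge1[of z] size1_ge1[of y] assms
    by (intro tcong_graft tcong_refl) (simp_all add: size1_graft)
qed

lemma tcong_ab: "tcong (Node x GenA (Node y GenB z)) (Node (Node x GenA y) GenB z)"
  using tcong_rel[of "graft (corolla GenA) 2 (corolla GenB)" "graft (corolla GenB) 1 (corolla GenA)" z y x]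
  by (simp add: ncp_rels_def corolla_def One_nat_def Let_def)

lemma tcong_cc: "tcong (Node (Node x GenC y) GenC z) (Node x GenC (Node y GenC z))"
  using tcong_rel[of "graft (corolla GenC) 1 (corolla GenC)" "graft (corolla GenC) 2 (corolla GenC)" z y x]
  by (simp add: ncp_rels_def corolla_def One_nat_def Let_def)

lemma tcong_ac: "tcong (Node (Node x GenC y) GenA z) (Node x GenA (Node y GenA z))"
  using tcong_rel[of "graft (corolla GenA) 1 (corolla GenC)" "graft (corolla GenA) 2 (corolla GenA)" z y x]
  by (simp add: ncp_rels_def corolla_def One_nat_def Let_def)

lemma tcong_bc: "tcong (Node x GenB (Node y GenC z)) (Node (Node x GenB y) GenB z)"
  using tcong_rel[of "graft (corolla GenB) 2 (corolla GenC)" "graft (corolla GenB) 1 (corolla GenB)" z y x]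
  by (simp add: ncp_rels_def corolla_def One_nat_def Let_def)

lemma op_cong_tree_fun:
  "op_cong free_operad ncp_rels n s t \<Longrightarrow> tree_fun 0 s = tree_fun 0 t"
proof (induction rule: op_cong.induct)
  case (rel n x y)
  have "expo 0 x = expo 0 y"
    using rel(1) by (auto simp: ncp_rels_def corolla_def One_nat_def Let_def fun_eq_iff)
  then show ?case using rel by (simp add: tree_fun_eq_iff)
next
  case (comp m x x' n y y' i)
  then show ?case
    using tree_fun_comp[of i x y] tree_fun_comp[of i x' y'] op_cong_size by fastforce
qed auto

lemma expo_zero_imp: "expo 0 s = expo 0 t \<Longrightarrow> expo p s = expo p t"
proof
  fix d :: "nat \<times> nat" assume e: "expo 0 s = expo 0 t"
  obtain i j where [simp]: "d = (i, j)" by (cases d)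
  show "expo p s d = expo p t d"
  proof (cases "p \<le> i \<and> p \<le> j")
    case True
    then show ?thesis
      using e expo_shift[of 0 p s "i - p" "j - p"] expo_shift[of 0 p t "i - p" "j - p"] by simp
  next
    case False
    then have "\<not> (p \<le> i \<and> i < j)" by auto
    then show ?thesis using expo_support[of p s d] expo_support[of p t d] by fastforce
  qed
qed

lemma tcong_expo: "tcong s t \<Longrightarrow> expo p s = expo p t"
  using op_cong_tree_fun[of "size1 s" s t] tree_fun_eq_iff[of s t 0] tcong_size[of s t]
    expo_zero_imp unfolding tcong_def by blast

subsection \<open>Normal forms\<close>

text \<open>
  In an algebra over the presented operad, \<open>c\<close> is an associative product and \<open>a\<close> and \<open>b\<close> are
  commuting left and right actions of it; \<open>right_act (left_act x k) y\<close> is \<open>x \<cdot> k \<cdot> y\<close>, where \<open>None\<close>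
  stands for an absent factor, of size \<open>0\<close> and with zero exponents.
\<close>

fun left_act :: "ncp_gen tree option \<Rightarrow> ncp_gen tree \<Rightarrow> ncp_gen tree" where
  "left_act None k = k"
| "left_act (Some x) k = Node x GenA k"

fun right_act :: "ncp_gen tree \<Rightarrow> ncp_gen tree option \<Rightarrow> ncp_gen tree" where
  "right_act k None = k"
| "right_act k (Some y) = Node k GenB y"

fun osize :: "ncp_gen tree option \<Rightarrow> nat" where
  "osize None = 0"
| "osize (Some x) = size1 x"

fun oexpo :: "nat \<Rightarrow> ncp_gen tree option \<Rightarrow> nat \<times> nat \<Rightarrow> int" where
  "oexpo p None d = 0"
| "oexpo p (Some x) d = expo p x d"

text \<open>Trees with the product \<open>c\<close> at the root.\<close>

definition is_prod :: "ncp_gen tree \<Rightarrow> bool" where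
  "is_prod t \<longleftrightarrow> (\<exists>l r. t = Node l GenC r)"

lemma size1_acts: "size1 (right_act (left_act x k) y) = osize x + size1 k + osize y"
  by (cases x; cases y) auto

lemma expo_acts:
  fixes x y k p
  defines "r \<equiv> p + osize x" and "t \<equiv> p + osize x + size1 k"
  shows "expo p (right_act (left_act x k) y) d = oexpo p x d + expo r k d + oexpo t y d
    + delta (r, t) d - delta (p, t + osize y) d"
  by (cases x; cases y) (auto simp: r_def t_def add_ac)

lemma act_normal_form:
  "\<exists>x k y. tcong s (right_act (left_act x k) y) \<and> (k = Leaf \<or> is_prod k)"
proof (induction s)
  case Leaf
  show ?case by (rule exI[of _ None], rule exI[of _ Leaf], rule exI[of _ None]) simp
next
  case (Node l g r)
  show ?case
  proof (cases g)
    case GenC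
    then show ?thesis
      by (intro exI[of _ None] exI[of _ "Node l g r"]) (auto simp: is_prod_def intro!: exI[of _ None])
  next
    case GenA
    obtain x k y where r: "tcong r (right_act (left_act x k) y)" "k = Leaf \<or> is_prod k"
      using Node.IH by blast
    have "\<exists>x'. tcong (Node l GenA (left_act x k)) (left_act x' k)" for l
    proof (cases x)
      case None then show ?thesis by (intro exI[of _ "Some l"]) simp
    next
      case (Some x1)
      then show ?thesis using tcong_sym[OF tcong_ac[of l x1 k]]
        by (intro exI[of _ "Some (Node l GenC x1)"]) simp
    qed
    then obtain x' where x': "tcong (Node l GenA (left_act x k)) (left_act x' k)" by blast
    have "tcong (Node l g r) (Node l GenA (right_act (left_act x k) y))"
      unfolding GenA by (intro tcong_Node r tcong_refl)
    also have "tcong \<dots> (right_act (left_act x' k) y)"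
    proof (cases y)
      case None then show ?thesis using x' by simp
    next
      case (Some y1)
      have "tcong (Node l GenA (Node (left_act x k) GenB y1)) (Node (Node l GenA (left_act x k)) GenB y1)"
        by (rule tcong_ab)
      also have "tcong \<dots> (Node (left_act x' k) GenB y1)" by (intro tcong_Node x' tcong_refl)
      finally show ?thesis using Some by simp
    qed
    finally show ?thesis using r(2) by blast
  next
    case GenB
    obtain x k y where l: "tcong l (right_act (left_act x k) y)" "k = Leaf \<or> is_prod k"
      using Node.IH by blast
    have "tcong (Node l g r) (Node (right_act (left_act x k) y) GenB r)"
      unfolding GenB by (intro tcong_Node l tcong_refl)
    also have "\<exists>y'. tcong \<dots> (right_act (left_act x k) y')"
    proof (cases y)
      case None then show ?thesis by (intro exI[of _ "Some r"]) simp
    next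
      case (Some y1)
      then show ?thesis using tcong_sym[OF tcong_bc[of "left_act x k" y1 r]]
        by (intro exI[of _ "Some (Node y1 GenC r)"]) simp
    qed
    then obtain y' where "tcong (Node (right_act (left_act x k) y) GenB r) (right_act (left_act x k) y')"
      by blast
    finally show ?thesis using l(2) by blast
  qed
qed

lemma prod_normal_form:
  "\<exists>s t. tcong (Node l GenC r) (Node s GenC t) \<and> \<not> is_prod s"
proof (induction l arbitrary: r)
  case Leaf
  show ?case by (intro exI[of _ Leaf] exI[of _ r]) (simp add: is_prod_def)
next
  case (Node l1 g l2)
  show ?case
  proof (cases "g = GenC")
    case True
    obtain s t where "tcong (Node l1 GenC (Node l2 GenC r)) (Node s GenC t)" "\<not> is_prod s"
      using Node.IH(1) by blast
    then show ?thesis using tcong_trans[OF tcong_cc[of l1 l2 r]] True by blast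
  next
    case False
    then show ?thesis by (intro exI[of _ "Node l1 g l2"] exI[of _ r]) (simp add: is_prod_def)
  qed
qed

text \<open>The exponent of the base tells products from other trees.\<close>

lemma expo_base: "expo p t (p, p + size1 t) = (if is_prod t then 0 else - 1)"
proof (cases t)
  case Leaf then show ?thesis by (simp add: is_prod_def delta_def)
next
  case (Node l g r)
  have "expo p l (p, p + size1 t) = 0" "expo (p + size1 l) r (p, p + size1 t) = 0"
    using expo_support[of p l "(p, p + size1 t)"] expo_support[of "p + size1 l" r "(p, p + size1 t)"]
      Node size1_ge1[of l] size1_ge1[of r] by fastforce+
  then show ?thesis using Node size1_ge1[of l] size1_ge1[of r]
    by (cases g) (auto simp: is_prod_def delta_def)
qed

section \<open>Trees and plants\<close>

text \<open>The exponents of the function with numerators \<open>N\<close> and denominators \<open>D\<close>.\<close>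

definition chi :: "'a set \<Rightarrow> 'a set \<Rightarrow> 'a \<Rightarrow> int" where
  "chi N D d = of_bool (d \<in> N) - of_bool (d \<in> D)"

lemma chi_union:
  assumes "N1 \<inter> N2 = {}" "D1 \<inter> D2 = {}"
  shows "chi (N1 \<union> N2) (D1 \<union> D2) d = chi N1 D1 d + chi N2 D2 d"
  using assms by (auto simp: chi_def)

lemma chi_insert_denominator:
  "b \<notin> D \<Longrightarrow> chi N (insert b D) d = chi N D d - delta b d"
  by (auto simp: chi_def delta_def)

lemma chi_insert:
  "a \<notin> N \<Longrightarrow> b \<notin> D \<Longrightarrow> chi (insert a N) (insert b D) d = chi N D d + delta a d - delta b d"
  by (auto simp: chi_def delta_def)

lemma intv_disjoint: "m \<le> m' \<Longrightarrow> intv p m \<inter> intv m' q = {}"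
  by (auto simp: intv_def)

text \<open>
  The outer path is needed in the induction: it becomes the boundary of the new face when the
  pieces of a normal form are closed by the base.
\<close>

lemma tree_to_plant:
  "\<exists>N D V. plant p (p + size1 s) N D \<and> outer_path D p (p + size1 s) V \<and> expo p s = chi N D"
proof (induction "size1 s" arbitrary: s p rule: less_induct)
  case less
  have opt: "\<exists>N D V. plant p (p + osize x) N D \<and> outer_path D p (p + osize x) V \<and> oexpo p x = chi N D"
    if "osize x < size1 s" for x p
  proof (cases x)
    case None
    then show ?thesis using plant_trivial outer_path_trivial
      by (intro exI[of _ "{}"] exI[of _ "{p}"]) (auto simp: fun_eq_iff chi_def)
  next
    case (Some y)
    have "oexpo p x = expo p y" using Some by (auto simp: fun_eq_iff)
    then show ?thesis using less[of y p] that Some by simp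
  qed
  obtain x k y where nf: "tcong s (right_act (left_act x k) y)" "k = Leaf \<or> is_prod k"
    using act_normal_form by blast
  have size: "size1 s = osize x + size1 k + osize y" using tcong_size[OF nf(1)] size1_acts by simp
  define r t q where "r = p + osize x" and "t = r + size1 k" and "q = t + osize y"
  have q: "p + size1 s = q" using size by (simp add: r_def t_def q_def)
  have ex: "expo p s d = oexpo p x d + expo r k d + oexpo t y d + delta (r, t) d - delta (p, q) d" for d
    using expo_acts[of p x k y d] tcong_expo[OF nf(1)] by (simp add: r_def t_def q_def)
  have le: "p \<le> r" "r < t" "t \<le> q" using size1_ge1[of k] by (auto simp: r_def t_def q_def)
  show ?case
  proof (cases "x = None \<and> y = None")
    case True
    then have es: "expo p s = expo p k" "size1 s = size1 k" using nf tcong_expo tcong_size by auto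
    show ?thesis
    proof (cases "k = Leaf")
      case True
      have "outer_path {(p, p + 1)} p (p + 1) {p, p + 1}" by (rule outer_path_base) auto
      moreover have "expo p k = chi {} {(p, p + 1)}"
        using True by (auto simp: fun_eq_iff chi_def delta_def)
      ultimately show ?thesis using plant_side[of p] es True by auto
    next
      case False
      then obtain a b where k: "k = Node a GenC b" using nf(2) by (auto simp: is_prod_def)
      let ?m = "p + size1 a" and ?q = "p + size1 a + size1 b"
      obtain N1 D1 V1 where 1: "plant p ?m N1 D1" "outer_path D1 p ?m V1" "expo p a = chi N1 D1"
        using less[of a p] k es size1_ge1[of b] by auto
      obtain N2 D2 V2 where 2: "plant ?m ?q N2 D2" "outer_path D2 ?m ?q V2" "expo ?m b = chi N2 D2"
        using less[of b ?m] k es size1_ge1[of a] by auto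
      have P: "plant p ?q (N1 \<union> N2) (D1 \<union> D2)" by (rule plant_glue[OF 1(1) 2(1)]) auto
      have sub: "N1 \<subseteq> intv p ?m" "D1 \<subseteq> intv p ?m" "N2 \<subseteq> intv ?m ?q" "D2 \<subseteq> intv ?m ?q"
        using plantD(1,2)[OF 1(1)] plantD(1,2)[OF 2(1)] by auto
      have V: "outer_path (D1 \<union> D2) p ?q (V1 \<union> V2)"
        by (rule outer_path_glue[OF 1(2) 2(2)]) (use sub in auto)
      have dj: "N1 \<inter> N2 = {}" "D1 \<inter> D2 = {}" using sub intv_disjoint[of ?m ?m p ?q] by blast+
      have "expo p k = chi (N1 \<union> N2) (D1 \<union> D2)"
        using 1(3) 2(3) k by (auto simp: fun_eq_iff chi_union[OF dj])
      then show ?thesis using P V es k by (auto simp: add.assoc)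
    qed
  next
    case False
    then have sm: "osize x < size1 s" "osize y < size1 s" "size1 k < size1 s"
      using size size1_ge1[of k] size1_ge1[of "the x"] size1_ge1[of "the y"] by (cases x; cases y; force)+
    have rtpq: "(r, t) \<noteq> (p, q)" using sm(3) size by (auto simp: r_def t_def q_def)
    obtain N1 D1 V1 where 1: "plant p r N1 D1" "outer_path D1 p r V1" "oexpo p x = chi N1 D1"
      using opt[OF sm(1), of p] unfolding r_def by blast
    obtain N3 D3 V3 where 3: "plant t q N3 D3" "outer_path D3 t q V3" "oexpo t y = chi N3 D3"
      using opt[OF sm(2), of t] unfolding q_def by blast
    have sub: "N1 \<subseteq> intv p r" "D1 \<subseteq> intv p r" "N3 \<subseteq> intv t q" "D3 \<subseteq> intv t q"
      using plantD(1,2)[OF 1(1)] plantD(1,2)[OF 3(1)] by auto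
    show ?thesis
    proof (cases "k = Leaf")
      case True
      then have t: "t = r + 1" by (simp add: t_def)
      have P: "plant p q (N1 \<union> N3) (insert (p, q) (D1 \<union> D3))"
        by (rule plant_bridge[OF 1(1)]) (use 3 t le in auto)
      have V: "outer_path (insert (p, q) (D1 \<union> D3)) p q {p, q}"
        using le by (intro outer_path_base) auto
      have dj: "N1 \<inter> N3 = {}" "D1 \<inter> D3 = {}" using sub intv_disjoint[of r t p q] le by auto
      have "(p, q) \<notin> intv p r" "(p, q) \<notin> intv t q" using le by auto
      then have nb: "(p, q) \<notin> D1 \<union> D3" using sub by blast
      have "expo p s = chi (N1 \<union> N3) (insert (p, q) (D1 \<union> D3))"
        using 1(3) 3(3) t True
        by (auto simp: fun_eq_iff ex chi_union[OF dj] chi_insert_denominator[OF nb])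
      then show ?thesis using P V q by auto
    next
      case False
      then have kp: "is_prod k" using nf(2) by simp
      obtain N2 D2 V2 where 2: "plant r t N2 D2" "outer_path D2 r t V2" "expo r k = chi N2 D2"
        using less[of k r] sm(3) unfolding t_def by blast
      have sub2: "N2 \<subseteq> intv r t" "D2 \<subseteq> intv r t" using plantD(1,2)[OF 2(1)] by auto
      have rtN: "(r, t) \<notin> N2" by (rule base_not_numerator[OF 2(1)])
      have rtD: "(r, t) \<notin> D2"
        using expo_base[of r k] kp 2(3) rtN by (auto simp: t_def chi_def)
      let ?N = "N1 \<union> (N2 \<union> N3)" and ?D = "D1 \<union> (D2 \<union> D3)"
      have P23: "plant r q (N2 \<union> N3) (D2 \<union> D3)" by (rule plant_glue[OF 2(1) 3(1)]) (use le in auto)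
      have P: "plant p q ?N ?D" by (rule plant_glue[OF 1(1) P23]) (use le in auto)
      have "outer_path (D2 \<union> D3) r q (V2 \<union> V3)"
        by (rule outer_path_glue[OF 2(2) 3(2)]) (use sub sub2 le in auto)
      then have V: "outer_path ?D p q (V1 \<union> (V2 \<union> V3))"
        by (rule outer_path_glue[OF 1(2)]) (use sub plantD(2)[OF P23] le in auto)
      have pq: "(p, q) \<notin> intv p r" "(p, q) \<notin> intv r t" "(p, q) \<notin> intv t q"
        "(r, t) \<notin> intv p r" "(r, t) \<notin> intv t q" using le rtpq by auto
      have C: "plant p q (insert (r, t) ?N) (insert (p, q) ?D)"
      proof (rule plant_close[OF P V])
        show "r \<in> V1 \<union> (V2 \<union> V3)" "t \<in> V1 \<union> (V2 \<union> V3)" using 2(2) by (auto simp: outer_path_def)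
        show "(p, q) \<notin> ?D" "(r, t) \<notin> ?D" using pq sub sub2 rtD by blast+
        show "\<not> (i < r \<and> r < j) \<and> \<not> (i < t \<and> t < j)" if "(i, j) \<in> ?N \<union> ?D" for i j
        proof -
          have "(i, j) \<in> intv p r \<or> (i, j) \<in> intv r t \<or> (i, j) \<in> intv t q"
            using that sub sub2 by blast
          then show ?thesis using le by auto
        qed
      qed (use le rtpq in auto)
      have V': "outer_path (insert (p, q) ?D) p q {p, q}" using le by (intro outer_path_base) auto
      have "intv p r \<inter> intv r t = {}" "intv p r \<inter> intv t q = {}" "intv r t \<inter> intv t q = {}"
        using le by (auto intro!: intv_disjoint)
      then have dj: "N2 \<inter> N3 = {}" "D2 \<inter> D3 = {}" "N1 \<inter> (N2 \<union> N3) = {}" "D1 \<inter> (D2 \<union> D3) = {}"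
        using sub sub2 by blast+
      have nb: "(p, q) \<notin> ?D" "(r, t) \<notin> ?N" using pq sub sub2 rtN by blast+
      have "expo p s = chi (insert (r, t) ?N) (insert (p, q) ?D)"
        by (auto simp: fun_eq_iff ex chi_insert[OF nb(2,1)] chi_union[OF dj(1,2)]
            chi_union[OF dj(3,4)] 1(3) 2(3) 3(3))
      then show ?thesis using C V' q by auto
    qed
  qed
qed

lemma plant_to_tree:
  "plant p q N D \<Longrightarrow> p < q \<Longrightarrow> \<exists>t. size1 t = q - p \<and> expo p t = chi N D"
proof (induction "q - p" arbitrary: p q N D rule: less_induct)
  case less
  have opt: "\<exists>x. osize x = q' - p' \<and> oexpo p' x = chi N' D'"
    if P: "plant p' q' N' D'" "p' \<le> q'" "q' - p' < q - p" for p' q' N' D'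
  proof (cases "p' = q'")
    case True
    then have "N' = {}" "D' = {}" using plant_empty P by auto
    then show ?thesis using True by (intro exI[of _ None]) (auto simp: fun_eq_iff chi_def)
  next
    case False
    then obtain x where x: "size1 x = q' - p'" "expo p' x = chi N' D'" using less.hyps[of q' p'] P by auto
    have "oexpo p' (Some x) = expo p' x" by (auto simp: fun_eq_iff)
    then show ?thesis using x by (intro exI[of _ "Some x"]) simp
  qed
  note P = less.prems(1) and pq = less.prems(2)
  show ?case
  proof (cases "(p, q) \<in> D")
    case False
    obtain m N1 D1 N2 D2 where m: "p < m" "m < q" and P1: "plant p m N1 D1" and P2: "plant m q N2 D2"
      and ND: "N = N1 \<union> N2" "D = D1 \<union> D2" using plant_cut[OF P pq False] by metis
    have lt: "m - p < q - p" "q - m < q - p" using m by auto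
    obtain s where s: "size1 s = m - p" "expo p s = chi N1 D1" using less.hyps[OF lt(1) P1 m(1)] by blast
    obtain t where t: "size1 t = q - m" "expo m t = chi N2 D2" using less.hyps[OF lt(2) P2 m(2)] by blast
    have dj: "N1 \<inter> N2 = {}" "D1 \<inter> D2 = {}"
      using plantD(1,2)[OF P1] plantD(1,2)[OF P2] intv_disjoint[of m m p q] by blast+
    have "expo p (Node s GenC t) = chi N D"
      using s t m by (auto simp: fun_eq_iff ND chi_union[OF dj])
    then show ?thesis using s t m by (intro exI[of _ "Node s GenC t"]) auto
  next
    case True
    show ?thesis
    proof (cases "q = p + 1")
      case [simp]: True
      have side: "intv p q = {(p, p + 1)}" by (auto simp: intv_def)
      have "D = {(p, p + 1)}" using plantD(2)[OF P] \<open>(p, q) \<in> D\<close> unfolding side by auto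
      moreover have "N = {}" using plantD(1,3)[OF P] \<open>(p, q) \<in> D\<close> unfolding side by auto
      ultimately show ?thesis by (intro exI[of _ Leaf]) (auto simp: fun_eq_iff chi_def delta_def)
    next
      case q2: False
      show ?thesis
      proof (cases "\<exists>W. face D W \<and> p \<in> W \<and> q \<in> W")
        case False
        then obtain m N1 D1 N2 D2 where m: "p \<le> m" "m < q" and P1: "plant p m N1 D1"
          and P2: "plant (m + 1) q N2 D2" and ND: "N = N1 \<union> N2" "D = insert (p, q) (D1 \<union> D2)"
          using plant_unbridge[OF P pq True] by metis
        have lt: "m - p < q - p" "q - (m + 1) < q - p" "m + 1 \<le> q" using m by auto
        obtain x where x: "osize x = m - p" "oexpo p x = chi N1 D1" using opt[OF P1 m(1) lt(1)] by blast
        obtain y where y: "osize y = q - (m + 1)" "oexpo (m + 1) y = chi N2 D2"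
          using opt[OF P2 lt(3,2)] by blast
        let ?t = "right_act (left_act x Leaf) y"
        have dj: "N1 \<inter> N2 = {}" "D1 \<inter> D2 = {}"
          using plantD(1,2)[OF P1] plantD(1,2)[OF P2] intv_disjoint[of m "m + 1" p q] by auto
        have "(p, q) \<notin> intv p m" "(p, q) \<notin> intv (m + 1) q" using m by auto
        then have nb: "(p, q) \<notin> D1 \<union> D2" using plantD(2)[OF P1] plantD(2)[OF P2] by blast
        have "expo p ?t d = oexpo p x d + oexpo (m + 1) y d - delta (p, q) d" for d
          using expo_acts[of p x Leaf y d] x y m by simp
        then have "expo p ?t = chi N D"
          using x y by (simp add: fun_eq_iff ND chi_union[OF dj] chi_insert_denominator[OF nb])
        then show ?thesis using x y m by (intro exI[of _ ?t]) (auto simp: size1_acts)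
      next
        case f: True
        then obtain r t N1 D1 N2 D2 N3 D3 where rt: "p \<le> r" "r + 2 \<le> t" "t \<le> q" "(r, t) \<noteq> (p, q)"
          and P1: "plant p r N1 D1" and P2: "plant r t N2 D2" and P3: "plant t q N3 D3"
          and rtD: "(r, t) \<notin> D2"
          and ND: "N = insert (r, t) (N1 \<union> N2 \<union> N3)" "D = insert (p, q) (D1 \<union> D2 \<union> D3)"
          using plant_open[OF P pq True] by metis
        have lt: "r - p < q - p" "t - r < q - p" "q - t < q - p" using rt by auto
        have rt': "r < t" using rt by simp
        obtain x where x: "osize x = r - p" "oexpo p x = chi N1 D1" using opt[OF P1 rt(1) lt(1)] by blast
        obtain y where y: "osize y = q - t" "oexpo t y = chi N3 D3" using opt[OF P3 rt(3) lt(3)] by blast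
        obtain k where k: "size1 k = t - r" "expo r k = chi N2 D2" using less.hyps[OF lt(2) P2 rt'] by blast
        let ?t = "right_act (left_act x k) y"
        have rtN: "(r, t) \<notin> N2" by (rule base_not_numerator[OF P2])
        have "intv p r \<inter> intv r t = {}" "intv p r \<inter> intv t q = {}" "intv r t \<inter> intv t q = {}"
          using rt by (auto intro!: intv_disjoint)
        then have dj: "N1 \<inter> N2 = {}" "D1 \<inter> D2 = {}" "(N1 \<union> N2) \<inter> N3 = {}" "(D1 \<union> D2) \<inter> D3 = {}"
          using plantD(1,2)[OF P1] plantD(1,2)[OF P2] plantD(1,2)[OF P3] by blast+
        have "(p, q) \<notin> intv p r" "(p, q) \<notin> intv r t" "(p, q) \<notin> intv t q"
          "(r, t) \<notin> intv p r" "(r, t) \<notin> intv t q" using rt by auto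
        then have nb: "(p, q) \<notin> D1 \<union> D2 \<union> D3" "(r, t) \<notin> N1 \<union> N2 \<union> N3"
          using plantD(1,2)[OF P1] plantD(1,2)[OF P2] plantD(1,2)[OF P3] rtN by blast+
        have "expo p ?t d = oexpo p x d + expo r k d + oexpo t y d + delta (r, t) d - delta (p, q) d" for d
          using expo_acts[of p x k y d] x y k rt by simp
        then have "expo p ?t = chi N D"
          using x y k by (simp add: fun_eq_iff ND chi_insert[OF nb(2,1)] chi_union[OF dj(1,2)]
            chi_union[OF dj(3,4)])
        then show ?thesis using x y k rt by (intro exI[of _ ?t]) (auto simp: size1_acts)
      qed
    qed
  qed
qed

section \<open>Trees with the same exponents are congruent\<close>

text \<open>The sum of the exponents of all diagonals between the vertices \<open>i\<close> and \<open>j\<close>.\<close>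

definition weight :: "(nat \<times> nat \<Rightarrow> int) \<Rightarrow> nat \<Rightarrow> nat \<Rightarrow> int" where
  "weight e i j = (\<Sum>d\<in>intv i j. e d)"

lemma osize_eq_0 [simp]: "osize x = 0 \<longleftrightarrow> x = None"
proof (cases x)
  case (Some t) then show ?thesis using size1_ge1[of t] by simp
qed simp

lemma finite_intv [simp]: "finite (intv p q)"
  by (rule finite_subset[of _ "{..q} \<times> {..q}"]) (auto simp: intv_def)

lemma weight_clip:
  assumes "\<And>d. e d \<noteq> 0 \<Longrightarrow> d \<in> intv a b"
  shows "weight e i j = weight e (max i a) (min j b)"
proof -
  have "intv (max i a) (min j b) = intv i j \<inter> intv a b" by (auto simp: intv_def)
  then show ?thesis unfolding weight_def
    by (auto intro!: sum.mono_neutral_right assms)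
qed

lemma weight_empty:
  assumes "j \<le> i"
  shows "weight e i j = 0"
proof -
  have "intv i j = {}" using assms by (auto simp: intv_def)
  then show ?thesis by (simp add: weight_def)
qed

lemma weight_add: "weight (\<lambda>d. e d + f d) i j = weight e i j + weight f i j"
  by (simp add: weight_def sum.distrib)

lemma weight_diff: "weight (\<lambda>d. e d - f d) i j = weight e i j - weight f i j"
  by (simp add: weight_def sum_subtractf)

lemma weight_delta: "weight (delta (a, b)) i j = of_bool (i \<le> a \<and> a < b \<and> b \<le> j)"
  by (simp add: weight_def delta_def)

lemma weight_uminus: "weight (\<lambda>d. - e d) i j = - weight e i j"
  by (simp add: weight_def sum_negf)

lemma expo_intv: "expo p t d \<noteq> 0 \<Longrightarrow> d \<in> intv p (p + size1 t)"
  using expo_support[of p t d] by (cases d) auto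

lemma weight_gen_expo:
  assumes "p < m" "m < q"
  shows "weight (gen_expo g p m q) i j \<ge> (if i \<le> p \<and> q \<le> j then - 1 else 0)"
    "i \<le> p \<Longrightarrow> q \<le> j \<Longrightarrow> g \<noteq> GenC \<Longrightarrow> weight (gen_expo g p m q) i j = 0"
    "weight (gen_expo GenC p m q) i j = 0"
proof -
  show z: "weight (gen_expo GenC p m q) i j = 0" by (simp add: weight_def)
  have "gen_expo g p m q = (\<lambda>d. delta (m, q) d - delta (p, q) d)" if "g = GenA" for g
    using that by (auto simp: fun_eq_iff)
  moreover have "gen_expo g p m q = (\<lambda>d. delta (p, m) d - delta (p, q) d)" if "g = GenB" for g
    using that by (auto simp: fun_eq_iff)
  ultimately have "weight (gen_expo GenA p m q) i j = of_bool (i \<le> m \<and> q \<le> j) - of_bool (i \<le> p \<and> q \<le> j)"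
    "weight (gen_expo GenB p m q) i j = of_bool (i \<le> p \<and> m \<le> j) - of_bool (i \<le> p \<and> q \<le> j)"
    using assms by (simp_all add: weight_diff weight_delta)
  then show "weight (gen_expo g p m q) i j \<ge> (if i \<le> p \<and> q \<le> j then - 1 else 0)"
    "i \<le> p \<Longrightarrow> q \<le> j \<Longrightarrow> g \<noteq> GenC \<Longrightarrow> weight (gen_expo g p m q) i j = 0"
    using assms z by (cases g; auto)+
qed

text \<open>
  The exponents between two vertices sum up to at least minus their distance, with equality for
  the end vertices.
\<close>

lemma weight_expo_aux:
  "(\<forall>i j. p \<le> i \<longrightarrow> i \<le> j \<longrightarrow> j \<le> p + size1 t \<longrightarrow> weight (expo p t) i j \<ge> int i - int j) \<and>
   weight (expo p t) p (p + size1 t) = - int (size1 t)"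
proof (induction t arbitrary: p)
  case Leaf
  have e: "expo p Leaf = (\<lambda>d. - delta (p, p + 1) d)" by (simp add: fun_eq_iff)
  show ?case unfolding e weight_uminus weight_delta by auto
next
  case (Node l g r)
  let ?m = "p + size1 l" and ?q = "p + size1 l + size1 r"
  have pm: "p < ?m" "?m < ?q" using size1_ge1[of l] size1_ge1[of r] by auto
  have e: "expo p (Node l g r) = (\<lambda>d. (expo p l d + expo ?m r d) + gen_expo g p ?m ?q d)"
    by (simp add: fun_eq_iff)
  have w: "weight (expo p (Node l g r)) i j = weight (expo p l) (max i p) (min j ?m)
      + weight (expo ?m r) (max i ?m) (min j ?q) + weight (gen_expo g p ?m ?q) i j" for i j
    unfolding e weight_add using weight_clip[of "expo p l" p ?m i j, OF expo_intv]
      weight_clip[of "expo ?m r" ?m ?q i j, OF expo_intv] by simp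
  have "weight (gen_expo g p ?m ?q) p ?q = 0"
    using weight_gen_expo(2)[OF pm, where g = g and i = p and j = ?q]
      weight_gen_expo(3)[OF pm, of p ?q] by (cases "g = GenC") auto
  then have full: "weight (expo p (Node l g r)) p ?q = - int (size1 (Node l g r))"
    using Node.IH(1)[of p] Node.IH(2)[of ?m] unfolding w using pm by (simp add: max_def min_def)
  have "weight (expo p (Node l g r)) i j \<ge> int i - int j" if ij: "p \<le> i" "i \<le> j" "j \<le> ?q" for i j
  proof (cases "i = p \<and> j = ?q")
    case True
    then show ?thesis using full by simp
  next
    case False
    then have g: "weight (gen_expo g p ?m ?q) i j \<ge> 0"
      using weight_gen_expo(1)[OF pm, where g = g and i = i and j = j] ij by (auto split: if_splits)
    have l: "weight (expo p l) (max i p) (min j ?m) \<ge> (if i \<le> ?m then int i - int (min j ?m) else 0)"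
    proof (cases "i \<le> ?m")
      case True
      then show ?thesis using Node.IH(1)[of p] ij by (simp add: max_def)
    next
      case False
      then have "weight (expo p l) (max i p) (min j ?m) = 0" by (intro weight_empty) auto
      then show ?thesis using False by simp
    qed
    have r: "weight (expo ?m r) (max i ?m) (min j ?q) \<ge> (if ?m \<le> j then int (max i ?m) - int j else 0)"
    proof (cases "?m \<le> j")
      case True
      then show ?thesis using Node.IH(2)[of ?m] ij by (simp add: min_def)
    next
      case False
      then have "weight (expo ?m r) (max i ?m) (min j ?q) = 0" by (intro weight_empty) auto
      then show ?thesis using False by simp
    qed
    show ?thesis using g l r ij unfolding w by (auto split: if_splits simp: max_def min_def)
  qed
  then show ?case using full by (simp add: add.assoc del: expo.simps)
qed

lemma weight_expo:
  "p \<le> i \<Longrightarrow> i \<le> j \<Longrightarrow> j \<le> p + size1 t \<Longrightarrow> weight (expo p t) i j \<ge> int i - int j"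
  "weight (expo p t) p (p + size1 t) = - int (size1 t)"
  using weight_expo_aux[of p t] by blast+

lemma oexpo_intv: "oexpo p x d \<noteq> 0 \<Longrightarrow> d \<in> intv p (p + osize x)"
  using expo_intv by (cases x) auto

lemma weight_clip_expo:
  "weight (expo p t) i j = weight (expo p t) (max i p) (min j (p + size1 t))"
  by (rule weight_clip) (rule expo_intv)

lemma weight_clip_oexpo:
  "weight (oexpo p x) i j = weight (oexpo p x) (max i p) (min j (p + osize x))"
  by (rule weight_clip) (rule oexpo_intv)

lemma oexpo_Some: "oexpo p (Some x) = expo p x" and oexpo_None: "oexpo p None = (\<lambda>d. 0)"
  by (auto simp: fun_eq_iff)

lemma weight_oexpo:
  "p \<le> i \<Longrightarrow> i \<le> j \<Longrightarrow> j \<le> p + osize x \<Longrightarrow> weight (oexpo p x) i j \<ge> int i - int j"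
  "weight (oexpo p x) p (p + osize x) = - int (osize x)"
proof -
  have z: "weight (\<lambda>d. 0) i j = 0" for i j by (simp add: weight_def)
  show "p \<le> i \<Longrightarrow> i \<le> j \<Longrightarrow> j \<le> p + osize x \<Longrightarrow> weight (oexpo p x) i j \<ge> int i - int j"
    "weight (oexpo p x) p (p + osize x) = - int (osize x)"
    using weight_expo by (cases x; simp add: oexpo_Some oexpo_None z)+
qed

text \<open>
  The exponents of a normal form determine the position of its core: given two normal forms with the
  same exponents, the core \<open>(r', t')\<close> of the second lies inside the core \<open>(r, t)\<close> of the first. It is
  a side, or has exponent one, so it cannot jump over \<open>r\<close> or \<open>t\<close>. If it were outside \<open>(r, t)\<close>,
  then the interval between the core of the second normal form and the far end of the base would have
  the minimal weight by the second normal form, and more by the first one, because it contains \<open>(r, t)\<close>.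
\<close>

lemma core_position:
  assumes core: "k = Leaf \<or> is_prod k" "k' = Leaf \<or> is_prod k'"
    and nt: "\<not> (x = None \<and> y = None)" "\<not> (x' = None \<and> y' = None)"
    and r: "r = p + osize x" "r' = p + osize x'" and t: "t = r + size1 k" "t' = r' + size1 k'"
    and q: "q = t + osize y" "q = t' + osize y'"
    and eq: "\<And>d. oexpo p x d + expo r k d + oexpo t y d + delta (r, t) d - delta (p, q) d
      = oexpo p x' d + expo r' k' d + oexpo t' y' d + delta (r', t') d - delta (p, q) d"
  shows "r \<le> r' \<and> t' \<le> t"
proof -
  define e where "e = (\<lambda>d. oexpo p x d + expo r k d + oexpo t y d + delta (r, t) d - delta (p, q) d)"
  have e': "e = (\<lambda>d. oexpo p x' d + expo r' k' d + oexpo t' y' d + delta (r', t') d - delta (p, q) d)"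
    using eq by (simp add: e_def fun_eq_iff)
  have le: "p \<le> r" "r < t" "t \<le> q" "p \<le> r'" "r' < t'" "t' \<le> q"
    using r t q size1_ge1[of k] size1_ge1[of k'] by auto
  have "osize x > 0 \<or> osize y > 0" "osize x' > 0 \<or> osize y' > 0"
    using nt osize_eq_0 by (metis gr0I)+
  then have ne: "(r, t) \<noteq> (p, q)" "(r', t') \<noteq> (p, q)" using r q by auto
  have w: "weight e i j = weight (oexpo p x) (max i p) (min j r) + weight (expo r k) (max i r) (min j t)
     + weight (oexpo t y) (max i t) (min j q) + of_bool (i \<le> r \<and> t \<le> j) - of_bool (i \<le> p \<and> q \<le> j)" for i j
    unfolding e_def weight_add weight_diff weight_delta
    using weight_clip_oexpo[of p x i j, folded r(1)]
      weight_clip_expo[of r k i j, folded t(1)]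
      weight_clip_oexpo[of t y i j, folded q(1)] le by simp
  have w': "weight e i j = weight (oexpo p x') (max i p) (min j r') + weight (expo r' k') (max i r') (min j t')
     + weight (oexpo t' y') (max i t') (min j q) + of_bool (i \<le> r' \<and> t' \<le> j) - of_bool (i \<le> p \<and> q \<le> j)" for i j
    unfolding e' weight_add weight_diff weight_delta
    using weight_clip_oexpo[of p x' i j, folded r(2)]
      weight_clip_expo[of r' k' i j, folded t(2)]
      weight_clip_oexpo[of t' y' i j, folded q(2)] le by simp
  have full: "weight (oexpo p x) p r = int p - int r" "weight (expo r k) r t = int r - int t"
    "weight (oexpo t y) t q = int t - int q" "weight (oexpo p x') p r' = int p - int r'"
    "weight (oexpo t' y') t' q = int t' - int q"
  proof -
    have "int (osize x) = int r - int p" "int (size1 k) = int t - int r" "int (osize y) = int q - int t"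
      "int (osize x') = int r' - int p" "int (osize y') = int q - int t'" using r t q by auto
    then show "weight (oexpo p x) p r = int p - int r" "weight (expo r k) r t = int r - int t"
      "weight (oexpo t y) t q = int t - int q" "weight (oexpo p x') p r' = int p - int r'"
      "weight (oexpo t' y') t' q = int t' - int q"
      using weight_oexpo(2)[of p x, folded r(1)] weight_expo(2)[of r k, folded t(1)]
        weight_oexpo(2)[of t y, folded q(1)] weight_oexpo(2)[of p x', folded r(2)]
        weight_oexpo(2)[of t' y', folded q(2)] by simp_all
  qed
  have no1: "\<not> t' \<le> r"
  proof
    assume a: "t' \<le> r"
    have "weight e t' q = int t' - int q"
      unfolding w' using a le full by (simp add: weight_empty)
    moreover have "weight (oexpo p x) t' r \<ge> int t' - int r"
      using weight_oexpo(1)[of p t' r x] a le r by simp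
    then have "weight e t' q \<ge> int t' - int q + 1"
      unfolding w using a le full by (simp add: weight_empty max_def min_def)
    ultimately show False by simp
  qed
  have no2: "\<not> t \<le> r'"
  proof
    assume a: "t \<le> r'"
    have "weight e p r' = int p - int r'"
      unfolding w' using a le full by (simp add: weight_empty)
    moreover have "weight (oexpo t y) t r' \<ge> int t - int r'"
      using weight_oexpo(1)[of t t r' y] a le q by simp
    then have "weight e p r' \<ge> int p - int r' + 1"
      unfolding w using a le full by (simp add: weight_empty max_def min_def)
    ultimately show False by simp
  qed
  have "(r', t') \<in> intv p r \<or> (r', t') \<in> intv r t \<or> (r', t') \<in> intv t q"
  proof (cases "k' = Leaf")
    case True
    then have "t' = r' + 1" using t by simp
    then show ?thesis using le by auto
  next
    case False
    have "oexpo p x' (r', t') = 0" "oexpo t' y' (r', t') = 0"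
      using oexpo_intv[of p x' "(r', t')"] oexpo_intv[of t' y' "(r', t')"] le r by auto
    moreover have "expo r' k' (r', t') = 0" using expo_base[of r' k'] False core(2) t by simp
    ultimately have "e (r', t') = 1" unfolding e' using ne by (simp add: delta_def)
    then have "oexpo p x (r', t') \<noteq> 0 \<or> expo r k (r', t') \<noteq> 0 \<or> oexpo t y (r', t') \<noteq> 0 \<or> (r', t') = (r, t)"
      unfolding e_def using ne by (auto simp: delta_def split: if_splits)
    then show ?thesis
      using oexpo_intv[of p x "(r', t')"] expo_intv[of r k "(r', t')"] oexpo_intv[of t y "(r', t')"] r t q le
      by auto
  qed
  then show ?thesis using no1 no2 by auto
qed

text \<open>Faithfulness: trees with the same exponents have the same normal form.\<close>

lemma tree_expo_inj:
  "size1 s = size1 t \<Longrightarrow> expo p s = expo p t \<Longrightarrow> tcong s t"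
proof (induction "size1 s" arbitrary: s t p rule: less_induct)
  case less
  have base: "is_prod s \<longleftrightarrow> is_prod t"
    using expo_base[of p s] expo_base[of p t] less.prems by (auto split: if_splits)
  show ?case
  proof (cases "is_prod s")
    case True
    then obtain s1 s2 where s: "tcong s (Node s1 GenC s2)" "\<not> is_prod s1"
      using prod_normal_form unfolding is_prod_def[of s] by metis
    obtain t1 t2 where t: "tcong t (Node t1 GenC t2)" "\<not> is_prod t1"
      using prod_normal_form base True unfolding is_prod_def[of t] by metis
    define m m' q where "m = p + size1 s1" and "m' = p + size1 t1" and "q = p + size1 s"
    have q: "q = m + size1 s2" "q = m' + size1 t2"
      using tcong_size[OF s(1)] tcong_size[OF t(1)] less.prems(1) by (auto simp: q_def m_def m'_def)
    have e: "expo p s1 d + expo m s2 d = expo p t1 d + expo m' t2 d" for d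
      using fun_cong[OF tcong_expo[OF s(1), of p], of d] fun_cong[OF tcong_expo[OF t(1), of p], of d]
        fun_cong[OF less.prems(2), of d] by (simp add: m_def m'_def)
    have le: "p < m" "m < q" "p < m'" "m' < q"
      using size1_ge1[of s1] size1_ge1[of s2] size1_ge1[of t1] size1_ge1[of t2] q by (auto simp: m_def m'_def)
    have z: "expo m s2 (p, j) = 0" "expo m' t2 (p, j) = 0" for j
      using expo_intv[of m s2 "(p, j)"] expo_intv[of m' t2 "(p, j)"] le by auto
    have "expo p s1 (p, m) = - 1" "expo p t1 (p, m') = - 1"
      using expo_base[of p s1] expo_base[of p t1] s t by (auto simp: m_def m'_def)
    then have "expo p t1 (p, m) \<noteq> 0" "expo p s1 (p, m') \<noteq> 0"
      using e[of "(p, m)"] e[of "(p, m')"] z by auto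
    then have "m \<le> m'" "m' \<le> m"
      using expo_intv[of p t1 "(p, m)"] expo_intv[of p s1 "(p, m')"] by (auto simp: m_def m'_def)
    then have mm: "m' = m" by simp
    have dj: "\<not> (d \<in> intv p m \<and> d \<in> intv m q)" for d using intv_disjoint[of m m p q] by blast
    have 1: "expo p s1 = expo p t1"
    proof
      fix d show "expo p s1 d = expo p t1 d"
        using e[of d] dj[of d] expo_intv[of p s1 d] expo_intv[of p t1 d] expo_intv[of m s2 d]
          expo_intv[of m t2 d] q mm unfolding m_def[symmetric] m'_def[symmetric] by (metis add_cancel_right_right)
    qed
    then have 2: "expo m s2 = expo m t2" using e mm by (auto simp: fun_eq_iff)
    have "tcong s1 t1" by (rule less.hyps[OF _ _ 1])
        (use le mm in \<open>auto simp: q_def m_def m'_def\<close>)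
    moreover have "tcong s2 t2" by (rule less.hyps[OF _ _ 2])
        (use le mm q in \<open>auto simp: q_def\<close>)
    ultimately have "tcong (Node s1 GenC s2) (Node t1 GenC t2)" by (rule tcong_Node)
    then show ?thesis using s(1) t(1) tcong_trans tcong_sym by metis
  next
    case False
    show ?thesis
    proof (cases "size1 s = 1")
      case True
      have lf: "z = Leaf" if "size1 z = 1" for z :: "ncp_gen tree"
        using that size1_ge1[of "left z"] size1_ge1[of "right z"] by (cases z) auto
      then have "s = Leaf" "t = Leaf" using True less.prems(1) by simp_all
      then show ?thesis by simp
    next
      case s1: False
      obtain x k y where s: "tcong s (right_act (left_act x k) y)" "k = Leaf \<or> is_prod k"
        using act_normal_form by blast
      obtain x' k' y' where t: "tcong t (right_act (left_act x' k') y')" "k' = Leaf \<or> is_prod k'"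
        using act_normal_form by blast
      have nt: "\<not> (x = None \<and> y = None)" if s: "tcong s (right_act (left_act x k) y)" "k = Leaf \<or> is_prod k"
        and "\<not> is_prod s" "size1 s \<noteq> 1" for s x k y
      proof
        assume "x = None \<and> y = None"
        then have "tcong s k" using s by simp
        then have "expo 0 s = expo 0 k" "size1 s = size1 k" using tcong_expo tcong_size by auto
        then have "\<not> is_prod k" using expo_base[of 0 s] expo_base[of 0 k] that(3) by (auto split: if_splits)
        then show False using s(2) that(4) \<open>size1 s = size1 k\<close> by simp
      qed
      have n: "\<not> (x = None \<and> y = None)" "\<not> (x' = None \<and> y' = None)"
        using nt[OF s False s1] nt[OF t] False base s1 less.prems(1) by auto
      define r r' T T' q where "r = p + osize x" and "r' = p + osize x'" and "T = r + size1 k"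
        and "T' = r' + size1 k'" and "q = T + osize y"
      have q': "q = T' + osize y'"
        using tcong_size[OF s(1)] tcong_size[OF t(1)] less.prems(1) size1_acts
        by (simp add: q_def T_def T'_def r_def r'_def)
      have e: "oexpo p x d + expo r k d + oexpo T y d + delta (r, T) d - delta (p, q) d
        = oexpo p x' d + expo r' k' d + oexpo T' y' d + delta (r', T') d - delta (p, q) d" for d
        using fun_cong[OF tcong_expo[OF s(1), of p], of d] fun_cong[OF tcong_expo[OF t(1), of p], of d]
          fun_cong[OF less.prems(2), of d] expo_acts[of p x k y d] expo_acts[of p x' k' y' d] q'
        unfolding q_def T_def T'_def r_def r'_def by simp
      have "r \<le> r' \<and> T' \<le> T"
        by (rule core_position[OF s(2) t(2) n r_def r'_def T_def T'_def q_def q' e])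
      moreover have "r' \<le> r \<and> T \<le> T'"
        by (rule core_position[OF t(2) s(2) n(2,1) r'_def r_def T'_def T_def q' q_def e[symmetric]])
      ultimately have rT: "r' = r" "T' = T" by auto
      have le: "p \<le> r" "r < T" "T \<le> q"
        using size1_ge1[of k] by (auto simp: q_def T_def r_def)
      have e3: "oexpo p x d + expo r k d + oexpo T y d = oexpo p x' d + expo r k' d + oexpo T y' d" for d
        using e[of d] rT by simp
      have dj: "\<not> (d \<in> intv p r \<and> d \<in> intv r T)" "\<not> (d \<in> intv p r \<and> d \<in> intv T q)"
        "\<not> (d \<in> intv r T \<and> d \<in> intv T q)" for d
        using intv_disjoint[of r r p T] intv_disjoint[of r T p q] intv_disjoint[of T T r q] le by auto
      have z: "d \<notin> intv p r \<Longrightarrow> oexpo p x d = 0" "d \<notin> intv p r \<Longrightarrow> oexpo p x' d = 0"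
        "d \<notin> intv r T \<Longrightarrow> expo r k d = 0" "d \<notin> intv r T \<Longrightarrow> expo r k' d = 0"
        "d \<notin> intv T q \<Longrightarrow> oexpo T y d = 0" "d \<notin> intv T q \<Longrightarrow> oexpo T y' d = 0" for d
        using oexpo_intv[of p x d] oexpo_intv[of p x' d] expo_intv[of r k d] expo_intv[of r k' d]
          oexpo_intv[of T y d] oexpo_intv[of T y' d] rT q'
        unfolding r_def[symmetric] r'_def[symmetric] T_def[symmetric] T'_def[symmetric] q_def[symmetric]
        by (metis T'_def r'_def)+
      have parts: "oexpo p x d = oexpo p x' d \<and> expo r k d = expo r k' d \<and> oexpo T y d = oexpo T y' d" for d
      proof -
        consider "d \<in> intv p r" | "d \<in> intv r T" | "d \<in> intv T q"
          | "d \<notin> intv p r" "d \<notin> intv r T" "d \<notin> intv T q" by blast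
        then show ?thesis using e3[of d] z[of d] dj[of d] by cases auto
      qed
      have sz: "size1 s = osize x + size1 k + osize y" using tcong_size[OF s(1)] size1_acts by simp
      have kk: "size1 k = size1 k'" "osize x = osize x'" "osize y = osize y'"
        using rT q' by (auto simp: q_def T_def r_def r'_def T'_def)
      have ox: "size1 z < size1 s" if "x = Some z \<or> y = Some z" for z
        using that sz size1_ge1[of k] by auto
      have sk: "size1 k < size1 s"
      proof -
        have "osize x > 0 \<or> osize y > 0" using n(1) by (cases x; cases y) auto
        then show ?thesis using sz by auto
      qed
      have "expo r k = expo r k'" using parts by auto
      then have k: "tcong k k'" using less.hyps[OF sk kk(1)] by blast
      have cx: "tcong (left_act x k) (left_act x' k')"
      proof (cases x)
        case None
        then have "x' = None" using kk(2) osize_eq_0 by metis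
        then show ?thesis using None k by simp
      next
        case (Some z)
        then obtain z' where z': "x' = Some z'" using kk(2) size1_ge1[of z] by (cases x') auto
        have "expo p z = expo p z'" using parts Some z' by (auto simp: fun_eq_iff)
        moreover have "size1 z < size1 s" using ox Some by blast
        ultimately have "tcong z z'" using less.hyps[of z z' p] Some kk(2) z' by simp
        then show ?thesis using Some z' k by (auto intro: tcong_Node)
      qed
      have "tcong (right_act (left_act x k) y) (right_act (left_act x' k') y')"
      proof (cases y)
        case None
        then have "y' = None" using kk(3) osize_eq_0 by metis
        then show ?thesis using None cx by simp
      next
        case (Some z)
        then obtain z' where z': "y' = Some z'" using kk(3) size1_ge1[of z] by (cases y') auto
        have "expo T z = expo T z'" using parts Some z' by (auto simp: fun_eq_iff)
        moreover have "size1 z < size1 s" using ox Some by blast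
        ultimately have "tcong z z'" using less.hyps[of z z' T] Some kk(3) z' by simp
        then show ?thesis using Some z' cx by (auto intro: tcong_Node)
      qed
      then show ?thesis using s(1) t(1) tcong_trans tcong_sym by metis
    qed
  qed
qed

section \<open>The operad of plants\<close>


lemma plant_fun_eq_prod:
  assumes "N \<subseteq> diagonals n" "D \<subseteq> diagonals n"
  shows "plant_fun N D = (\<Prod>d\<in>diagonals n. diag_form d powi chi N D d)"
proof -
  have nz: "diag_form d \<noteq> 0" if "d \<in> diagonals n" for d
    using that by (auto simp: diagonals_def intro!: diag_form_nonzero)
  have p: "(\<Prod>d\<in>diagonals n. diag_form d powi of_bool (d \<in> A)) = (\<Prod>d\<in>A. diag_form d)"
    if "A \<subseteq> diagonals n" for A
  proof -
    have "(\<Prod>d\<in>A. diag_form d) = (\<Prod>d\<in>A. diag_form d powi of_bool (d \<in> A))"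
      by (rule prod.cong) auto
    also have "\<dots> = (\<Prod>d\<in>diagonals n. diag_form d powi of_bool (d \<in> A))"
      by (rule prod.mono_neutral_left) (use that in auto)
    finally show ?thesis by simp
  qed
  have "(\<Prod>d\<in>diagonals n. diag_form d powi chi N D d)
      = (\<Prod>d\<in>diagonals n. diag_form d powi of_bool (d \<in> N))
        / (\<Prod>d\<in>diagonals n. diag_form d powi of_bool (d \<in> D))"
    unfolding chi_def using nz by (simp add: power_int_diff prod_dividef)
  then show ?thesis using p assms by (simp add: plant_fun_def)
qed

lemma tree_fun_plant:
  assumes "plant 0 n N D" "size1 t = n" "expo 0 t = chi N D"
  shows "tree_fun 0 t = plant_fun N D"
proof -
  have "N \<subseteq> diagonals n" "D \<subseteq> diagonals n"
    using plantD(1,2)[OF assms(1)] by (auto simp: diagonals_def)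
  then show ?thesis using assms(2,3) by (simp add: plant_fun_eq_prod tree_fun_eq_prod[of 0 t n])
qed

text \<open>The functions of non-crossing plants are the functions of trees.\<close>

lemma NCP_eq: "op_set NCP n = tree_fun 0 ` {t. size1 t = n}"
proof -
  consider "n = 0" | "n = 1" | "n \<ge> 2" by linarith
  then show ?thesis
  proof cases
    case 1
    then show ?thesis by (auto simp: NCP_def)
  next
    case 2
    have "t = Leaf" if "size1 t = 1" for t :: "ncp_gen tree"
      using that size1_ge1[of "left t"] size1_ge1[of "right t"] by (cases t) auto
    then have "{t :: ncp_gen tree. size1 t = 1} = {Leaf}" by auto
    then show ?thesis using 2 by (simp add: NCP_def)
  next
    case 3
    have "op_set NCP n = {plant_fun N D | N D. plant 0 n N D}"
      using 3 by (simp add: NCP_def noncrossing_plant_iff)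
    also have "\<dots> = tree_fun 0 ` {t. size1 t = n}"
    proof (intro equalityI subsetI)
      fix f assume "f \<in> {plant_fun N D | N D. plant 0 n N D}"
      then obtain N D where P: "plant 0 n N D" and f: "f = plant_fun N D" by auto
      obtain t where "size1 t = n" "expo 0 t = chi N D" using plant_to_tree[OF P] 3 by auto
      then show "f \<in> tree_fun 0 ` {t. size1 t = n}"
        using tree_fun_plant[OF P] f by (intro image_eqI[of _ _ t]) auto
    next
      fix f assume "f \<in> tree_fun 0 ` {t. size1 t = n}"
      then obtain t where t: "size1 t = n" "f = tree_fun 0 t" by auto
      obtain N D where "plant 0 n N D" "expo 0 t = chi N D" using tree_to_plant[of 0 t] t by auto
      then show "f \<in> {plant_fun N D | N D. plant 0 n N D}" using tree_fun_plant t by blast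
    qed
    finally show ?thesis .
  qed
qed

lemma suboperad_NCP: "suboperad NCP Mould"
  unfolding suboperad_def
proof (intro conjI allI ballI impI)
  show "ns_operad Mould" by (rule ns_operad_Mould)
  show "op_set NCP n \<subseteq> op_set Mould n" for n
    unfolding NCP_eq using tree_fun_Mould[of 0] by auto
  show "op_unit NCP = op_unit Mould" "op_comp NCP = op_comp Mould" by (simp_all add: NCP_def)
  show "op_unit Mould \<in> op_set NCP 1" by (simp add: NCP_def Mould_def)
  fix m n i x y assume "x \<in> op_set NCP m" "y \<in> op_set NCP n" and i: "1 \<le> i" "i \<le> m"
  then obtain s t where "size1 s = m" "x = tree_fun 0 s" "size1 t = n" "y = tree_fun 0 t"
    unfolding NCP_eq by auto
  then show "op_comp Mould m n i x y \<in> op_set NCP (m + n - 1)"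
    unfolding NCP_eq using i tree_fun_comp[of i s t m] size1_graft[of i s t]
    by (auto intro!: image_eqI[of _ _ "graft s i t"])
qed

lemma usum_12: "usum 1 2 = uvar 1 + uvar 2"
  using usum_split[of 1 1 2] by simp

lemma tree_fun_corolla: "tree_fun 0 (corolla g) = ncp_gen_fun g"
  by (cases g) (simp_all add: corolla_def usum_12)

lemma NCP_2: "op_set NCP 2 = {ncp_gen_fun GenA, ncp_gen_fun GenB, ncp_gen_fun GenC}"
proof -
  have "t \<in> range corolla" if two: "size1 t = 2" for t :: "ncp_gen tree"
  proof -
    obtain l g r where t: "t = Node l g r" using two by (cases t) auto
    have "size1 l = 1 \<and> size1 r = 1" using two t size1_ge1[of l] size1_ge1[of r] by simp
    then have "l = Leaf \<and> r = Leaf"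
      using size1_ge1[of "left l"] size1_ge1[of "right l"] size1_ge1[of "left r"] size1_ge1[of "right r"]
      by (cases l; cases r) auto
    then show ?thesis using t by (auto simp: corolla_def)
  qed
  then have "{t :: ncp_gen tree. size1 t = 2} = range corolla" by (auto simp: corolla_def)
  then have "op_set NCP 2 = ncp_gen_fun ` UNIV"
    by (simp add: NCP_eq image_image tree_fun_corolla del: ncp_gen_fun.simps)
  moreover have U: "(UNIV :: ncp_gen set) = {GenA, GenB, GenC}" using ncp_gen.exhaust by auto
  ultimately show ?thesis unfolding U by (simp only: image_insert image_empty)
qed

section \<open>The presentation\<close>

text \<open>Operations on classes are computed on representatives.\<close>

lemma UN_cong_class:
  assumes sym: "\<And>n x y. E n x y \<Longrightarrow> E n y x" and trans: "\<And>n x y z. E n x y \<Longrightarrow> E n y z \<Longrightarrow> E n x z"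
    and x: "E m x x" and y: "E n y y"
    and f: "\<And>x' y'. E m x x' \<Longrightarrow> E n y y' \<Longrightarrow> E k (f x y) (f x' y')"
  shows "(\<Union>x'\<in>cong_class E m x. \<Union>y'\<in>cong_class E n y. cong_class E k (f x' y')) = cong_class E k (f x y)"
proof -
  have "cong_class E k (f x' y') = cong_class E k (f x y)"
    if "x' \<in> cong_class E m x" "y' \<in> cong_class E n y" for x' y'
    using f that sym trans unfolding cong_class_def by blast
  moreover have "x \<in> cong_class E m x" "y \<in> cong_class E n y" using x y by (auto simp: cong_class_def)
  ultimately show ?thesis by blast
qed

lemma quotient_comp:
  assumes "size1 s = m" "size1 t = n" "1 \<le> i" "i \<le> m"
  shows "op_comp (quotient_operad free_operad (op_cong free_operad R)) m n i
      (cong_class (op_cong free_operad R) m s) (cong_class (op_cong free_operad R) n t)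
    = cong_class (op_cong free_operad R) (m + n - 1) (graft s i t)"
  unfolding quotient_operad_def operad_data.select_convs free_operad_simps
  using assms op_cong.comp[of free_operad R m s _ n t]
  by (intro UN_cong_class) (auto intro: op_cong.refl op_cong.sym op_cong.trans)

lemma presented_NCP: "presented_by NCP ncp_gen_fun ncp_rels"
proof -
  let ?E = "op_cong free_operad ncp_rels"
  let ?Q = "quotient_operad free_operad ?E"
  define \<phi> where "\<phi> = (\<lambda>(n::nat) X. tree_fun 0 (SOME t :: ncp_gen tree. t \<in> X))"
  have \<phi>: "\<phi> n (cong_class ?E n t) = tree_fun 0 t" if "size1 t = n" for n t
  proof -
    have "t \<in> cong_class ?E n t" using that by (simp add: cong_class_def op_cong.refl)
    then have "(SOME s. s \<in> cong_class ?E n t) \<in> cong_class ?E n t" by (rule someI)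
    then show ?thesis unfolding \<phi>_def using op_cong_tree_fun by (auto simp: cong_class_def)
  qed
  have Q: "op_set ?Q n = cong_class ?E n ` {t. size1 t = n}" "op_unit ?Q = cong_class ?E 1 Leaf" for n
    by (simp_all add: quotient_operad_def)
  have "operad_hom \<phi> ?Q NCP"
    unfolding operad_hom_def
  proof (intro conjI allI ballI impI)
    show "\<phi> n ` op_set ?Q n \<subseteq> op_set NCP n" for n
      unfolding Q NCP_eq using \<phi> by auto
    show "\<phi> 1 (op_unit ?Q) = op_unit NCP"
      unfolding Q using \<phi>[of Leaf 1] by (simp add: NCP_def Mould_def)
    fix m n i X Y assume X: "X \<in> op_set ?Q m" and Y: "Y \<in> op_set ?Q n" and i: "1 \<le> i" "i \<le> m"
    obtain s where s: "size1 s = m" "X = cong_class ?E m s" using X unfolding Q by auto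
    obtain t where t: "size1 t = n" "Y = cong_class ?E n t" using Y unfolding Q by auto
    have "\<phi> (m + n - 1) (op_comp ?Q m n i X Y) = tree_fun 0 (graft s i t)"
      using s t i size1_graft[of i s t] by (simp add: quotient_comp \<phi>)
    also have "\<dots> = op_comp Mould m n i (tree_fun 0 s) (tree_fun 0 t)"
      using s t i tree_fun_comp[of i s t m] by simp
    also have "\<dots> = op_comp NCP m n i (\<phi> m X) (\<phi> n Y)"
      unfolding s(2) t(2) \<phi>[OF s(1)] \<phi>[OF t(1)] by (simp add: NCP_def)
    finally show "\<phi> (m + n - 1) (op_comp ?Q m n i X Y) = op_comp NCP m n i (\<phi> m X) (\<phi> n Y)" .
  qed
  moreover have "bij_betw (\<phi> n) (op_set ?Q n) (op_set NCP n)" for n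
    unfolding bij_betw_def
  proof
    show "inj_on (\<phi> n) (op_set ?Q n)"
    proof (rule inj_onI)
      fix X Y assume "X \<in> op_set ?Q n" "Y \<in> op_set ?Q n" and eq: "\<phi> n X = \<phi> n Y"
      then obtain s t where st: "size1 s = n" "X = cong_class ?E n s" "size1 t = n" "Y = cong_class ?E n t"
        unfolding Q by auto
      then have "tree_fun 0 s = tree_fun 0 t" using eq \<phi> by simp
      then have "tcong s t" using st tree_fun_eq_iff[of s t 0] tree_expo_inj[of s t 0] by simp
      then have "?E n s t" using st by (simp add: op_cong_tcong)
      then have "?E n s u \<longleftrightarrow> ?E n t u" for u using op_cong.sym op_cong.trans by metis
      then show "X = Y" by (simp add: st cong_class_def)
    qed
    show "\<phi> n ` op_set ?Q n = op_set NCP n"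
      unfolding Q NCP_eq image_image using \<phi> by (intro image_cong) auto
  qed
  moreover have "\<phi> 2 (cong_class ?E 2 (corolla g)) = ncp_gen_fun g" for g
    using \<phi>[of "corolla g" 2] tree_fun_corolla by (simp add: corolla_def)
  ultimately show ?thesis unfolding presented_by_def operad_iso_def by blast
qed

section \<open>Dendriform operations\<close>

text \<open>The map \<open>\<psi>\<close> on trees, which sends \<open>L\<close> to \<open>a\<close> and \<open>R\<close> to \<open>b\<close>.\<close>

fun dend_label :: "dend_gen \<Rightarrow> ncp_gen" where
  "dend_label DL = GenA"
| "dend_label DR = GenB"

definition dend_fun :: "dend_gen tree \<Rightarrow> ratfun" where
  "dend_fun t = tree_fun 0 (map_tree dend_label t)"

text \<open>Linear extension of \<open>dend_fun\<close>.\<close>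

definition dend_eval :: "(dend_gen tree \<Rightarrow>\<^sub>0 rat) \<Rightarrow> ratfun" where
  "dend_eval x = (\<Sum>t\<in>Poly_Mapping.keys x. rconst (Poly_Mapping.lookup x t) * dend_fun t)"

lemma map_tree_graft: "map_tree f (graft s i t) = graft (map_tree f s) i (map_tree f t)"
  by (induction s arbitrary: i) auto

lemma dend_fun_graft:
  assumes "1 \<le> i" "i \<le> size1 s" "size1 t = n"
  shows "dend_fun (graft s i t) = op_comp Mould m n i (dend_fun s) (dend_fun t)"
  unfolding dend_fun_def map_tree_graft using assms
    tree_fun_comp[of i "map_tree dend_label s" "map_tree dend_label t" m] by simp

lemma dend_eval_superset:
  assumes "finite A" "Poly_Mapping.keys x \<subseteq> A"
  shows "dend_eval x = (\<Sum>t\<in>A. rconst (Poly_Mapping.lookup x t) * dend_fun t)"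
  unfolding dend_eval_def using assms
  by (intro sum.mono_neutral_left) (auto simp: in_keys_iff ring_hom1_D[OF ring_hom1_rconst])

lemma dend_eval_add: "dend_eval (x + y) = dend_eval x + dend_eval y"
proof -
  let ?A = "Poly_Mapping.keys x \<union> Poly_Mapping.keys y"
  have "dend_eval (x + y) = (\<Sum>t\<in>?A. rconst (Poly_Mapping.lookup (x + y) t) * dend_fun t)"
    by (rule dend_eval_superset) (use Poly_Mapping.keys_add[of x y] in auto)
  then show ?thesis
    by (simp add: dend_eval_superset[of ?A] lookup_add ring_hom1_D[OF ring_hom1_rconst]
        distrib_right sum.distrib)
qed

lemma dend_eval_single: "dend_eval (Poly_Mapping.single t c) = rconst c * dend_fun t"
  using dend_eval_superset[of "{t}" "Poly_Mapping.single t c"] by (cases "c = 0") simp_all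

lemma dend_eval_sum: "dend_eval (sum f A) = (\<Sum>x\<in>A. dend_eval (f x))"
proof (induction A rule: infinite_finite_induct)
  case (insert x F) then show ?case by (simp add: dend_eval_add)
qed (simp_all add: dend_eval_def)

lemma keys_scale: "Poly_Mapping.keys (Poly_Mapping.map ((*) c) x) \<subseteq> Poly_Mapping.keys (x :: 'a \<Rightarrow>\<^sub>0 rat)"
  by (auto simp: in_keys_iff Poly_Mapping.map.rep_eq when_def)

lemma dend_eval_scale: "dend_eval (Poly_Mapping.map ((*) c) x) = rconst c * dend_eval x"
proof -
  have "Poly_Mapping.lookup (Poly_Mapping.map ((*) c) x) t = c * Poly_Mapping.lookup x t" for t
    by (simp add: Poly_Mapping.map.rep_eq when_def)
  then show ?thesis
    using dend_eval_superset[OF _ keys_scale[of c x]]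
    by (simp add: dend_eval_def ring_hom1_D[OF ring_hom1_rconst] sum_distrib_left mult.assoc)
qed

lemma free_lin_simps:
  "op_set free_lin_operad n = {x. n \<ge> 1 \<and> (\<forall>t\<in>Poly_Mapping.keys x. size1 t = n)}"
  "op_unit free_lin_operad = Poly_Mapping.single Leaf 1"
  "op_comp free_lin_operad m n i x y = (\<Sum>s\<in>Poly_Mapping.keys x. \<Sum>t\<in>Poly_Mapping.keys y.
       Poly_Mapping.single (graft s i t) (Poly_Mapping.lookup x s * Poly_Mapping.lookup y t))"
  "op_add free_lin_operad n x y = x + y"
  "op_scale free_lin_operad n c x = Poly_Mapping.map ((*) c) x"
  by (simp_all add: free_lin_operad_def)

lemma keys_sum_subset:
  "Poly_Mapping.keys (sum f A) \<subseteq> (\<Union>x\<in>A. Poly_Mapping.keys (f x :: 'a \<Rightarrow>\<^sub>0 'b::comm_monoid_add))"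
proof (induction A rule: infinite_finite_induct)
  case (insert x F)
  then show ?case using Poly_Mapping.keys_add[of "f x" "sum f F"] by auto
qed simp_all

lemma free_lin_closed:
  "x \<in> op_set free_lin_operad m \<Longrightarrow> y \<in> op_set free_lin_operad n \<Longrightarrow> 1 \<le> i \<Longrightarrow> i \<le> m
    \<Longrightarrow> op_comp free_lin_operad m n i x y \<in> op_set free_lin_operad (m + n - 1)"
  "x \<in> op_set free_lin_operad n \<Longrightarrow> y \<in> op_set free_lin_operad n
    \<Longrightarrow> op_add free_lin_operad n x y \<in> op_set free_lin_operad n"
  "x \<in> op_set free_lin_operad n \<Longrightarrow> op_scale free_lin_operad n c x \<in> op_set free_lin_operad n"
proof -
  { assume x: "x \<in> op_set free_lin_operad m" and y: "y \<in> op_set free_lin_operad n" and i: "1 \<le> i" "i \<le> m"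
    have "size1 u = m + n - 1" if u: "u \<in> Poly_Mapping.keys (op_comp free_lin_operad m n i x y)" for u
    proof -
      obtain s t where "s \<in> Poly_Mapping.keys x" "t \<in> Poly_Mapping.keys y" "u = graft s i t"
        using u unfolding free_lin_simps
        by (auto dest!: subsetD[OF keys_sum_subset] split: if_splits)
      then show ?thesis using x y i by (auto simp: free_lin_simps size1_graft)
    qed
    then show "op_comp free_lin_operad m n i x y \<in> op_set free_lin_operad (m + n - 1)"
      using x y unfolding free_lin_simps(1) by auto }
  show "x \<in> op_set free_lin_operad n \<Longrightarrow> y \<in> op_set free_lin_operad n
    \<Longrightarrow> op_add free_lin_operad n x y \<in> op_set free_lin_operad n"
    using Poly_Mapping.keys_add[of x y] by (auto simp: free_lin_simps)
  show "x \<in> op_set free_lin_operad n \<Longrightarrow> op_scale free_lin_operad n c x \<in> op_set free_lin_operad n"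
    using keys_scale[of c x] by (auto simp: free_lin_simps)
qed

text \<open>Composition in \<open>Mould\<close> is bilinear.\<close>

lemma Mould_comp_sum:
  assumes "n \<ge> 1" "i \<ge> 1"
  shows "op_comp Mould m n i (\<Sum>s\<in>A. rconst (a s) * f s) (\<Sum>t\<in>B. rconst (b t) * g t)
    = (\<Sum>s\<in>A. \<Sum>t\<in>B. rconst (a s * b t) * op_comp Mould m n i (f s) (g t))"
proof -
  note S = outer_subst_simps[OF assms(1)] and T = inner_subst_simps[OF assms(2)]
  have "op_comp Mould m n i (\<Sum>s\<in>A. rconst (a s) * f s) (\<Sum>t\<in>B. rconst (b t) * g t)
    = usum i (i + n - 1) * ((\<Sum>s\<in>A. rconst (a s) * outer_subst i n (f s))
      * (\<Sum>t\<in>B. rconst (b t) * inner_subst i (g t)))"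
    unfolding Mould_comp ring_hom1_sum[OF S(1)] ring_hom1_sum[OF T(1)] ring_hom1_D(3)[OF S(1)]
      ring_hom1_D(3)[OF T(1)] S(2) T(2) by (simp only: mult.assoc)
  also have "\<dots> = (\<Sum>s\<in>A. \<Sum>t\<in>B. usum i (i + n - 1) * ((rconst (a s) * outer_subst i n (f s))
      * (rconst (b t) * inner_subst i (g t))))"
    by (subst sum_product) (simp only: sum_distrib_left)
  also have "\<dots> = (\<Sum>s\<in>A. \<Sum>t\<in>B. rconst (a s * b t) * op_comp Mould m n i (f s) (g t))"
    by (intro sum.cong refl) (simp_all only: Mould_comp ring_hom1_D(3)[OF ring_hom1_rconst] mult.assoc
        mult.commute mult.left_commute)
  finally show ?thesis .
qed

lemma dend_eval_comp:
  assumes x: "x \<in> op_set free_lin_operad m" and y: "y \<in> op_set free_lin_operad n" and i: "1 \<le> i" "i \<le> m"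
  shows "dend_eval (op_comp free_lin_operad m n i x y) = op_comp Mould m n i (dend_eval x) (dend_eval y)"
proof -
  have n: "n \<ge> 1" using y by (simp add: free_lin_simps)
  have "dend_eval (op_comp free_lin_operad m n i x y)
    = (\<Sum>s\<in>Poly_Mapping.keys x. \<Sum>t\<in>Poly_Mapping.keys y.
        rconst (Poly_Mapping.lookup x s * Poly_Mapping.lookup y t) * dend_fun (graft s i t))"
    by (simp add: free_lin_simps dend_eval_sum dend_eval_single)
  also have "\<dots> = (\<Sum>s\<in>Poly_Mapping.keys x. \<Sum>t\<in>Poly_Mapping.keys y.
        rconst (Poly_Mapping.lookup x s * Poly_Mapping.lookup y t)
        * op_comp Mould m n i (dend_fun s) (dend_fun t))"
    using x y i by (intro sum.cong) (auto simp: free_lin_simps dend_fun_graft)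
  finally show ?thesis unfolding dend_eval_def[of x] dend_eval_def[of y] Mould_comp_sum[OF n i(1)] .
qed

lemma ncp_gen_fun_add: "ncp_gen_fun GenA + ncp_gen_fun GenB = ncp_gen_fun GenC"
proof -
  have "uvar 1 + uvar 2 \<noteq> 0" using usum_nonzero[of 1 2] by (simp add: usum_12)
  then show ?thesis by (simp add: divide_simps)
qed

lemma dend_eval_gen: "dend_eval (dend_free_gen g) = ncp_gen_fun (dend_label g)"
  by (simp add: dend_free_gen_def dend_eval_single ring_hom1_D[OF ring_hom1_rconst] dend_fun_def
      tree_fun_corolla[symmetric]) (simp add: corolla_def)

lemma dend_gen_closed: "dend_free_gen g \<in> op_set free_lin_operad 2"
  by (simp add: free_lin_simps dend_free_gen_def corolla_def)

lemma gen_comp: "op_comp Mould 2 2 i (ncp_gen_fun g) (ncp_gen_fun h) = tree_fun 0 (graft (corolla g) i (corolla h))"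
  if "1 \<le> i" "i \<le> 2"
  using tree_fun_comp[of i "corolla g" "corolla h" 2] that by (simp add: tree_fun_corolla) (simp add: corolla_def)

lemma tcong_tree_fun: "tcong s t \<Longrightarrow> tree_fun 0 s = tree_fun 0 t"
  unfolding tcong_def by (rule op_cong_tree_fun)

lemma dend_eval_rel:
  assumes "(n, x, y) \<in> dend_rels"
  shows "dend_eval x = dend_eval y"
proof -
  let ?c = "op_comp free_lin_operad 2 2" and ?L = "dend_free_gen DL" and ?R = "dend_free_gen DR"
  note cl = dend_gen_closed
  have LR: "?L + ?R \<in> op_set free_lin_operad 2"
    using free_lin_closed(2)[OF cl cl] by (simp add: free_lin_simps(4))
  have evLR: "dend_eval (?L + ?R) = ncp_gen_fun GenC"
    by (simp add: dend_eval_add dend_eval_gen ncp_gen_fun_add del: ncp_gen_fun.simps)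
  note ev = dend_eval_comp[OF cl cl] dend_eval_comp[OF cl LR] dend_eval_gen evLR dend_label.simps
  have "dend_eval (?c 1 ?L (?L + ?R)) = dend_eval (?c 2 ?L ?L)"
    using tcong_tree_fun[OF tcong_ac[of Leaf Leaf Leaf]]
    by (simp add: ev gen_comp del: ncp_gen_fun.simps tree_fun.simps) (simp add: corolla_def del: tree_fun.simps)
  moreover have "dend_eval (?c 1 ?R ?L) = dend_eval (?c 2 ?L ?R)"
    using tcong_tree_fun[OF tcong_ab[of Leaf Leaf Leaf]]
    by (simp add: ev gen_comp del: ncp_gen_fun.simps tree_fun.simps) (simp add: corolla_def del: tree_fun.simps)
  moreover have "dend_eval (?c 1 ?R ?R) = dend_eval (?c 2 ?R (?L + ?R))"
    using tcong_tree_fun[OF tcong_bc[of Leaf Leaf Leaf]]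
    by (simp add: ev gen_comp del: ncp_gen_fun.simps tree_fun.simps) (simp add: corolla_def del: tree_fun.simps)
  ultimately show ?thesis using assms by (auto simp: dend_rels_def Let_def)
qed

lemma lin_op_cong_closed:
  "lin_op_cong free_lin_operad R n x y \<Longrightarrow> x \<in> op_set free_lin_operad n \<and> y \<in> op_set free_lin_operad n"
  by (induction rule: lin_op_cong.induct) (auto intro: free_lin_closed)

lemma lin_op_cong_eval:
  "lin_op_cong free_lin_operad dend_rels n x y \<Longrightarrow> dend_eval x = dend_eval y"
proof (induction rule: lin_op_cong.induct)
  case (rel n x y) then show ?case using dend_eval_rel by blast
next
  case (comp m x x' n y y' i)
  then show ?case using lin_op_cong_closed[OF comp(1)] lin_op_cong_closed[OF comp(2)]
    by (simp add: dend_eval_comp)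
next
  case (add n x x' y y') then show ?case by (simp add: free_lin_simps dend_eval_add)
next
  case (scale n x x' c) then show ?case by (simp add: free_lin_simps dend_eval_scale)
qed auto

text \<open>The congruence that defines \<open>Dend\<close>.\<close>

abbreviation dend_cong :: "nat \<Rightarrow> (dend_gen tree \<Rightarrow>\<^sub>0 rat) \<Rightarrow> (dend_gen tree \<Rightarrow>\<^sub>0 rat) \<Rightarrow> bool" where
  "dend_cong \<equiv> lin_op_cong free_lin_operad dend_rels"

lemma Dend_simps:
  "op_set Dend n = cong_class dend_cong n ` op_set free_lin_operad n"
  "op_unit Dend = cong_class dend_cong 1 (Poly_Mapping.single Leaf 1)"
  "x \<in> op_set free_lin_operad m \<Longrightarrow> y \<in> op_set free_lin_operad n \<Longrightarrow> 1 \<le> i \<Longrightarrow> i \<le> m \<Longrightarrow>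
    op_comp Dend m n i (cong_class dend_cong m x) (cong_class dend_cong n y)
    = cong_class dend_cong (m + n - 1) (op_comp free_lin_operad m n i x y)"
  "x \<in> op_set free_lin_operad n \<Longrightarrow> x' \<in> op_set free_lin_operad n \<Longrightarrow>
    op_add Dend n (cong_class dend_cong n x) (cong_class dend_cong n x') = cong_class dend_cong n (x + x')"
  "x \<in> op_set free_lin_operad n \<Longrightarrow>
    op_scale Dend n c (cong_class dend_cong n x) = cong_class dend_cong n (Poly_Mapping.map ((*) c) x)"
proof -
  note E = lin_op_cong.refl lin_op_cong.sym lin_op_cong.trans
  show "op_set Dend n = cong_class dend_cong n ` op_set free_lin_operad n"
    "op_unit Dend = cong_class dend_cong 1 (Poly_Mapping.single Leaf 1)"
    by (simp_all add: Dend_def quotient_lin_operad_def quotient_operad_def free_lin_simps(2))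
  show "x \<in> op_set free_lin_operad m \<Longrightarrow> y \<in> op_set free_lin_operad n \<Longrightarrow> 1 \<le> i \<Longrightarrow> i \<le> m \<Longrightarrow>
    op_comp Dend m n i (cong_class dend_cong m x) (cong_class dend_cong n y)
    = cong_class dend_cong (m + n - 1) (op_comp free_lin_operad m n i x y)"
    unfolding Dend_def quotient_lin_operad_def quotient_operad_def operad_data.select_convs
    by (intro UN_cong_class) (auto intro: E lin_op_cong.comp)
  show "x \<in> op_set free_lin_operad n \<Longrightarrow> x' \<in> op_set free_lin_operad n \<Longrightarrow>
    op_add Dend n (cong_class dend_cong n x) (cong_class dend_cong n x') = cong_class dend_cong n (x + x')"
    unfolding Dend_def quotient_lin_operad_def lin_operad_data.select_convs free_lin_simps(4)[symmetric, of x x' n]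
    by (intro UN_cong_class) (auto intro: E lin_op_cong.add)
  show "op_scale Dend n c (cong_class dend_cong n x) = cong_class dend_cong n (Poly_Mapping.map ((*) c) x)"
    if x: "x \<in> op_set free_lin_operad n"
  proof -
    have "cong_class dend_cong n (op_scale free_lin_operad n c x')
        = cong_class dend_cong n (op_scale free_lin_operad n c x)"
      if "x' \<in> cong_class dend_cong n x" for x'
    proof -
      have "dend_cong n (op_scale free_lin_operad n c x) (op_scale free_lin_operad n c x')"
        using that by (simp add: cong_class_def lin_op_cong.scale)
      then have "dend_cong n (op_scale free_lin_operad n c x') u
          \<longleftrightarrow> dend_cong n (op_scale free_lin_operad n c x) u" for u
        using lin_op_cong.sym lin_op_cong.trans by metis
      then show ?thesis by (simp add: cong_class_def)
    qed
    moreover have "x \<in> cong_class dend_cong n x" using x by (simp add: cong_class_def lin_op_cong.refl)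
    ultimately show ?thesis
      unfolding Dend_def quotient_lin_operad_def lin_operad_data.select_convs
        free_lin_simps(5)[symmetric, of c x n] by blast
  qed
qed

lemma exists_dend_to_mould: "\<exists>\<psi>. is_dend_to_mould \<psi>"
proof -
  define \<psi> where "\<psi> = (\<lambda>(n::nat) X. dend_eval (SOME x. x \<in> X))"
  have \<psi>: "\<psi> n (cong_class dend_cong n x) = dend_eval x" if "x \<in> op_set free_lin_operad n" for n x
  proof -
    have "x \<in> cong_class dend_cong n x" using that by (simp add: cong_class_def lin_op_cong.refl)
    then have "(SOME y. y \<in> cong_class dend_cong n x) \<in> cong_class dend_cong n x" by (rule someI)
    then show ?thesis unfolding \<psi>_def using lin_op_cong_eval by (auto simp: cong_class_def)
  qed
  have M: "dend_eval x \<in> op_set Mould n" if "x \<in> op_set free_lin_operad n" for n x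
    using that unfolding dend_eval_def dend_fun_def free_lin_simps
    by (intro Mould_sum_closed Mould_closed tree_fun_Mould) auto
  have u: "Poly_Mapping.single Leaf 1 \<in> op_set free_lin_operad 1" by (simp add: free_lin_simps)
  have "operad_hom \<psi> Dend Mould"
    unfolding operad_hom_def
  proof (intro conjI allI ballI impI)
    show "\<psi> n ` op_set Dend n \<subseteq> op_set Mould n" for n using \<psi> M by (auto simp: Dend_simps)
    show "\<psi> 1 (op_unit Dend) = op_unit Mould"
      by (simp add: Dend_simps \<psi>[OF u] dend_eval_single dend_fun_def ring_hom1_D[OF ring_hom1_rconst])
        (simp add: Mould_def)
    fix m n i X Y assume "X \<in> op_set Dend m" "Y \<in> op_set Dend n" and i: "1 \<le> i" "i \<le> m"
    then obtain x y where "x \<in> op_set free_lin_operad m" "X = cong_class dend_cong m x"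
      "y \<in> op_set free_lin_operad n" "Y = cong_class dend_cong n y" by (auto simp: Dend_simps)
    then show "\<psi> (m + n - 1) (op_comp Dend m n i X Y) = op_comp Mould m n i (\<psi> m X) (\<psi> n Y)"
      using i by (simp add: Dend_simps \<psi> free_lin_closed dend_eval_comp)
  qed
  moreover have "\<psi> n (op_add Dend n X Y) = op_add Mould n (\<psi> n X) (\<psi> n Y)"
    if XY: "X \<in> op_set Dend n" "Y \<in> op_set Dend n" for n X Y
  proof -
    obtain x y where "x \<in> op_set free_lin_operad n" "X = cong_class dend_cong n x"
      "y \<in> op_set free_lin_operad n" "Y = cong_class dend_cong n y" using XY by (auto simp: Dend_simps)
    then show ?thesis
      using free_lin_closed(2)[of x n y]
      by (simp add: Dend_simps \<psi> free_lin_simps(4) dend_eval_add) (simp add: Mould_def)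
  qed
  moreover have "\<psi> n (op_scale Dend n c X) = op_scale Mould n c (\<psi> n X)"
    if X: "X \<in> op_set Dend n" for n c X
  proof -
    obtain x where "x \<in> op_set free_lin_operad n" "X = cong_class dend_cong n x"
      using X by (auto simp: Dend_simps)
    then show ?thesis
      using free_lin_closed(3)[of x n c]
      by (simp add: Dend_simps \<psi> free_lin_simps(5) dend_eval_scale) (simp add: Mould_def)
  qed
  moreover have "\<psi> 2 (dend_elem g) = ncp_gen_fun (dend_label g)" for g
    unfolding dend_elem_def by (simp add: \<psi> dend_gen_closed dend_eval_gen)
  from this[of DL] this[of DR] have "\<psi> 2 (dend_elem DL) = 1 / (uvar 1 * (uvar 1 + uvar 2))"
    "\<psi> 2 (dend_elem DR) = 1 / ((uvar 1 + uvar 2) * uvar 2)" by simp_all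
  ultimately show ?thesis unfolding is_dend_to_mould_def lin_operad_hom_def by blast
qed

text \<open>
  The image of \<open>\<psi>\<close> is closed under composition and contains \<open>a\<close>, \<open>b\<close> and \<open>c = a + b\<close>, hence the
  functions of all trees.
\<close>

lemma NCP_in_image:
  assumes "is_dend_to_mould \<psi>"
  shows "op_set NCP n \<subseteq> \<psi> n ` op_set Dend n"
proof -
  have hom: "operad_hom \<psi> Dend Mould"
    and add: "\<And>n x y. x \<in> op_set Dend n \<Longrightarrow> y \<in> op_set Dend n \<Longrightarrow>
      \<psi> n (op_add Dend n x y) = \<psi> n x + \<psi> n y"
    and gens: "\<psi> 2 (dend_elem DL) = ncp_gen_fun GenA" "\<psi> 2 (dend_elem DR) = ncp_gen_fun GenB"
    using assms unfolding is_dend_to_mould_def lin_operad_hom_def by (auto simp: Mould_def)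
  have L: "dend_elem g \<in> op_set Dend 2" for g
    unfolding dend_elem_def Dend_simps using dend_gen_closed by blast
  have gen: "ncp_gen_fun g \<in> \<psi> 2 ` op_set Dend 2" for g
  proof (cases g)
    case GenC
    have "op_add Dend 2 (dend_elem DL) (dend_elem DR) \<in> op_set Dend 2"
      using free_lin_closed(2)[OF dend_gen_closed[of DL] dend_gen_closed[of DR]]
      unfolding dend_elem_def by (simp add: Dend_simps dend_gen_closed free_lin_simps(4))
    moreover have "\<psi> 2 (op_add Dend 2 (dend_elem DL) (dend_elem DR)) = ncp_gen_fun GenC"
      using add[OF L L] gens ncp_gen_fun_add by metis
    ultimately show ?thesis using GenC by (metis image_eqI)
  qed (use gens L in \<open>metis image_eqI\<close>)+
  have comp: "op_comp Mould m n i f g \<in> \<psi> (m + n - 1) ` op_set Dend (m + n - 1)"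
    if fg: "f \<in> \<psi> m ` op_set Dend m" "g \<in> \<psi> n ` op_set Dend n" and i: "1 \<le> i" "i \<le> m" for m n i f g
  proof -
    obtain X Y where XY: "X \<in> op_set Dend m" "f = \<psi> m X" "Y \<in> op_set Dend n" "g = \<psi> n Y"
      using fg by blast
    obtain x y where "x \<in> op_set free_lin_operad m" "X = cong_class dend_cong m x"
      "y \<in> op_set free_lin_operad n" "Y = cong_class dend_cong n y" using XY by (auto simp: Dend_simps)
    then have "op_comp Dend m n i X Y \<in> op_set Dend (m + n - 1)"
      using i free_lin_closed(1)[of x m y n i] by (simp add: Dend_simps)
    moreover have "\<psi> (m + n - 1) (op_comp Dend m n i X Y) = op_comp Mould m n i f g"
      using hom XY i unfolding operad_hom_def by blast
    ultimately show ?thesis by (metis image_eqI)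
  qed
  have "tree_fun 0 t \<in> \<psi> (size1 t) ` op_set Dend (size1 t)" for t
  proof (induction t)
    case Leaf
    have "op_unit Dend \<in> op_set Dend 1" by (auto simp: Dend_simps free_lin_simps)
    moreover have "\<psi> 1 (op_unit Dend) = 1 / uvar 1" using hom by (simp add: operad_hom_def Mould_def)
    ultimately show ?case by (auto simp del: One_nat_def intro!: image_eqI[of _ _ "op_unit Dend"])
  next
    case (Node l g r)
    let ?u = "graft (corolla g) 2 r"
    have u: "size1 ?u = size1 r + 1" by (simp add: corolla_def)
    have "tree_fun 0 ?u = op_comp Mould 2 (size1 r) 2 (ncp_gen_fun g) (tree_fun 0 r)"
      using tree_fun_comp[of 2 "corolla g" r 2] by (simp add: tree_fun_corolla) (simp add: corolla_def)
    moreover have "2 + size1 r - 1 = size1 ?u" using u by simp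
    ultimately have "tree_fun 0 ?u \<in> \<psi> (size1 ?u) ` op_set Dend (size1 ?u)"
      using comp[OF gen[of g] Node.IH(2), of 2] by simp
    moreover have "tree_fun 0 (Node l g r) = op_comp Mould (size1 ?u) (size1 l) 1 (tree_fun 0 ?u) (tree_fun 0 l)"
      using tree_fun_comp[of 1 ?u l "size1 ?u"] Node_eq_graft[of l g r] u by (simp del: tree_fun.simps)
    moreover have "size1 ?u + size1 l - 1 = size1 (Node l g r)" using u by simp
    ultimately show ?case
      using comp[OF _ Node.IH(1), of "tree_fun 0 ?u" "size1 ?u" 1] u
      by (simp add: add.commute del: tree_fun.simps)
  qed
  then show ?thesis unfolding NCP_eq by auto
qed

theorem theorem5p3:
  shows "suboperad NCP Mould
    \<and> (\<exists>\<psi>. is_dend_to_mould \<psi>)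
    \<and> (\<forall>\<psi>. is_dend_to_mould \<psi> \<longrightarrow> (\<forall>n. op_set NCP n \<subseteq> \<psi> n ` op_set Dend n))
    \<and> op_set NCP 2 = {ncp_gen_fun GenA, ncp_gen_fun GenB, ncp_gen_fun GenC}
    \<and> presented_by NCP ncp_gen_fun ncp_rels"
  using suboperad_NCP exists_dend_to_mould NCP_in_image NCP_2 presented_NCP by blast

end
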